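(* Let $T>0$, $d\ge 1$, $0<\alpha,\beta<1$ and $1\le p,q\le\infty$. Let $u:[0,T]\times\mathbb{T}^d\to\mathbb{R}^d$ be weakly divergence-free and let $\theta:[0,T]\times\mathbb{T}^d\to\mathbb{R}$ be a weak solution of $\partial_t\theta+u\cdot\nabla\theta=0$. Suppose $\theta\in L^{p_1}(0,T;\dot{B}_p^{\alpha,\infty}(\mathbb{T}^d))$ and $u\in L^{q_1}(0,T;\dot{B}_q^{\beta,\infty}(\mathbb{T}^d))$, where - $2\alpha+\beta>1$; - $\frac2p+\frac1q=1$; - $2<p_1\le \frac{pd}{(d-p\alpha)_+}$ and $1\le q_1\le\frac{qd}{(d-q\beta)_+}$; - $\frac{2}{p_1}+\frac{1}{q_1}<1$. Then $$\partial_t|\theta|^r+u\cdot\nabla|\theta|^r=0$$ (in the sense of distributions on $(0,T)\times\mathbb{T}^d$) for every $r\ge 1$ for which $|\theta|^r u$ is locally integrable.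
   Context: $\mathbb{T}^d=\mathbb{R}^d/(2\pi\mathbb{Z})^d$. For real $x$, $x_+:=\max\{x,0\}$; a quotient $\frac{pd}{(d-p\alpha)_+}$ or $\frac{qd}{(d-q\beta)_+}$ with zero denominator is read as $+\infty$ (also when $p=\infty$ or $q=\infty$). For $0<\alpha<1$ and $1\le p\le\infty$, $\dot{B}_p^{\alpha,\infty}(\mathbb{T}^d)$ is the space of $f\in L^p(\mathbb{T}^d)$ with mean zero for which $$\|f\|_{\dot{B}_p^{\alpha,\infty}(\mathbb{T}^d)}=\sup_{y\ne 0}\frac{\|f(\cdot+y)-f(\cdot)\|_{L^p(\mathbb{T}^d)}}{|y|^\alpha}<\infty$$ (the supremum taken over $y\in\mathbb{T}^d\setminus\{0\}$, identified with $[-\pi,\pi]^d\setminus\{0\}$); for vector fields the condition is imposed componentwise. In particular $\int_{\mathbb{T}^d}u\,dx=0$ and $\int_{\mathbb{T}^d}\theta\,dx=0$ for a.e. time. $u$ weakly divergence-free means $\operatorname{div}_x u(t,\cdot)=0$ in the sense of distributions for a.e. $t$. $\theta$ is a weak solution of $\partial_t\theta+u\cdot\nabla\theta=0$ if $\int_0^T\int_{\mathbb{T}^d}(\partial_t\varphi+u\cdot\nabla\varphi)\theta\,dx\,dt=0$ for every $\varphi\in C_c^\infty((0,T)\times\mathbb{T}^d)$; the equation for $|\theta|^r$ is understood in the same way, with $|\theta|^r$ in place of $\theta$. *)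

theory Defs
  imports "HOL-Probability.Essential_Supremum"
begin

text \<open>Functions on the torus are \<open>2\<pi>\<close>-periodic functions on \<^typ>\<open>real ^ 'd\<close>, integrated over the
  cell \<open>[-\<pi>,\<pi>]\<^sup>d\<close>.\<close>

definition periodic :: "(real ^ 'd \<Rightarrow> 'b) \<Rightarrow> bool" where
  "periodic f \<longleftrightarrow> (\<forall>x i. f (x + axis i (2 * pi)) = f x)"

definition torus_cell :: "(real ^ 'd) set" where
  "torus_cell = cbox (\<chi> i. - pi) (\<chi> i. pi)"

abbreviation torus :: "(real ^ 'd) measure" where
  "torus \<equiv> lebesgue_on torus_cell"


section \<open>Smooth functions\<close>

text \<open>\<open>C\<^sup>\<infinity>\<close>: every iterated directional derivative exists and is Frechet differentiable everywhere.\<close>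

primrec iter_dir_deriv :: "'a::real_normed_vector list \<Rightarrow> ('a \<Rightarrow> real) \<Rightarrow> 'a \<Rightarrow> real" where
  "iter_dir_deriv [] f = f"
| "iter_dir_deriv (v # vs) f = (\<lambda>x. frechet_derivative (iter_dir_deriv vs f) (at x) v)"

definition smooth :: "('a::euclidean_space \<Rightarrow> real) \<Rightarrow> bool" where
  "smooth f \<longleftrightarrow> (\<forall>vs x. iter_dir_deriv vs f differentiable (at x))"

definition grad :: "(real ^ 'd \<Rightarrow> real) \<Rightarrow> real ^ 'd \<Rightarrow> real ^ 'd" where
  "grad f x = (\<chi> i. frechet_derivative f (at x) (axis i 1))"

text \<open>\<open>C\<^sub>c\<^sup>\<infinity>((0,T) \<times> \<T>\<^sup>d)\<close>, each function being extended by zero to all times.\<close>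

definition test_fun :: "real \<Rightarrow> (real \<Rightarrow> real ^ 'd \<Rightarrow> real) \<Rightarrow> bool" where
  "test_fun T \<phi> \<longleftrightarrow> smooth (\<lambda>(t, x). \<phi> t x) \<and> (\<forall>t. periodic (\<phi> t)) \<and>
     (\<exists>a b. 0 < a \<and> b < T \<and> (\<forall>t x. t \<notin> {a..b} \<longrightarrow> \<phi> t x = 0))"


section \<open>Lebesgue and Besov norms\<close>

text \<open>Powers of positive exponent on \<open>[0,\<infinity>]\<close>.\<close>

definition ennreal_pow :: "ennreal \<Rightarrow> real \<Rightarrow> ennreal" where
  "ennreal_pow x a = (if x = \<infinity> then \<infinity> else ennreal (enn2real x powr a))"

text \<open>The \<open>L\<^sup>p\<close> norm of a \<open>[0,\<infinity>]\<close>-valued function, for \<open>1 \<le> p \<le> \<infinity>\<close>. It is applied to absolute values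
  and, in time, to norms.\<close>

definition Lp_norm :: "ereal \<Rightarrow> 'a measure \<Rightarrow> ('a \<Rightarrow> ennreal) \<Rightarrow> ennreal" where
  "Lp_norm p M g =
     (if p = \<infinity> then esssup M g
      else ennreal_pow (\<integral>\<^sup>+ x. ennreal_pow (g x) (real_of_ereal p) \<partial>M) (1 / real_of_ereal p))"

definition besov_norm :: "real \<Rightarrow> ereal \<Rightarrow> (real ^ 'd \<Rightarrow> real) \<Rightarrow> ennreal" where
  "besov_norm \<alpha> p f =
     (SUP y \<in> torus_cell - {0}.
        Lp_norm p torus (\<lambda>x. ennreal \<bar>f (x + y) - f x\<bar>) / ennreal (norm y powr \<alpha>))"

definition besov :: "real \<Rightarrow> ereal \<Rightarrow> (real ^ 'd \<Rightarrow> real) set" where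
  "besov \<alpha> p = {f. periodic f \<and> f \<in> borel_measurable lebesgue \<and>
     Lp_norm p torus (\<lambda>x. ennreal \<bar>f x\<bar>) < \<infinity> \<and>
     (LINT x|torus. f x) = 0 \<and>
     besov_norm \<alpha> p f < \<infinity>}"

text \<open>\<open>f \<in> L\<^sup>s(0,T; B)\<close>, where \<open>B\<close> is the Besov space with parameters \<open>\<alpha>\<close> and \<open>p\<close>. The Besov space is not
  separable; the measurability imposed is that of \<open>f\<close> in \<open>(t,x)\<close> and of the norm in time.\<close>

definition Lp_besov :: "real \<Rightarrow> ereal \<Rightarrow> real \<Rightarrow> ereal \<Rightarrow> (real \<Rightarrow> real ^ 'd \<Rightarrow> real) set" where
  "Lp_besov T s \<alpha> p = {f.
     (\<lambda>(t, x). f t x) \<in> borel_measurable (lebesgue_on ({0..T} \<times> UNIV)) \<and>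
     (AE t in lebesgue_on {0<..<T}. f t \<in> besov \<alpha> p) \<and>
     (\<lambda>t. besov_norm \<alpha> p (f t)) \<in> borel_measurable (lebesgue_on {0<..<T}) \<and>
     Lp_norm s (lebesgue_on {0<..<T}) (\<lambda>t. besov_norm \<alpha> p (f t)) < \<infinity>}"


section \<open>The transport equation\<close>

definition weakly_div_free :: "real \<Rightarrow> (real \<Rightarrow> real ^ 'd \<Rightarrow> real ^ 'd) \<Rightarrow> bool" where
  "weakly_div_free T u \<longleftrightarrow> (AE t in lebesgue_on {0<..<T}. integrable torus (u t) \<and>
     (\<forall>\<psi>. smooth \<psi> \<and> periodic \<psi> \<longrightarrow> (LINT x|torus. u t x \<bullet> grad \<psi> x) = 0))"

text \<open>The equation \<open>\<partial>\<^sub>t f + u \<cdot> \<nabla>f = 0\<close> for divergence-free \<open>u\<close>. If \<open>f\<close> and \<open>f u\<close> are locally integrable,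
  all integrands are integrable; in general, a test function for which the integrand is not integrable
  imposes no condition, as the Bochner integral is then zero.\<close>

definition weak_transport_solution ::
  "real \<Rightarrow> (real \<Rightarrow> real ^ 'd \<Rightarrow> real ^ 'd) \<Rightarrow> (real \<Rightarrow> real ^ 'd \<Rightarrow> real) \<Rightarrow> bool" where
  "weak_transport_solution T u f \<longleftrightarrow> (\<forall>\<phi>. test_fun T \<phi> \<longrightarrow>
     (LINT (t, x)|lebesgue_on ({0<..<T} \<times> torus_cell).
        (deriv (\<lambda>s. \<phi> s x) t + u t x \<bullet> grad (\<phi> t) x) * f t x) = 0)"

text \<open>Local integrability on \<open>(0,T) \<times> \<T>\<^sup>d\<close>: the sets \<open>[a,b] \<times> \<T>\<^sup>d\<close> exhaust its compact subsets.\<close>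

definition loc_integrable ::
  "real \<Rightarrow> (real \<Rightarrow> real ^ 'd \<Rightarrow> 'b::euclidean_space) \<Rightarrow> bool" where
  "loc_integrable T f \<longleftrightarrow> (\<forall>a b. 0 < a \<and> b < T \<longrightarrow>
     integrable (lebesgue_on ({a..b} \<times> torus_cell)) (\<lambda>(t, x). f t x))"

end

theory Submission
  imports Defs "HOL-Probability.Probability"
begin

text \<open>For \<open>h(s) = sin (\<xi> s + c)\<close> and \<open>\<theta>\<^sub>e\<close> the mollification of \<open>\<theta>\<close> in space at scale \<open>e\<close>, the equation gives
  \<open>\<partial>\<^sub>t h(\<theta>\<^sub>e) = - h'(\<theta>\<^sub>e) div (u \<theta>)\<^sub>e\<close> for almost every time. Tested with \<open>\<phi>\<close>, the divergence splits into
  \<open>u \<cdot> \<nabla>\<theta>\<^sub>e\<close>, which is the transport term of \<open>h(\<theta>\<^sub>e)\<close>, and a commutator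
  \<open>\<integral>\<integral> g(x) \<nabla>K(x - y) \<cdot> (u(y) - u(x)) (\<theta>(y) - \<theta>(x))\<close> with \<open>g = \<phi> h'(\<theta>\<^sub>e)\<close>. Since \<open>\<nabla>K\<close> is odd, \<open>g(x)\<close>
  may be replaced by \<open>(g(x) - g(y)) / 2\<close>; by Hoelder's inequality the three increments make the
  commutator \<open>O(e powr (2 \<alpha> + \<beta> - 1))\<close>. Hence \<open>h(\<theta>)\<close> solves the equation for all \<open>\<xi>\<close> and \<open>c\<close>. So the
  image under \<open>\<theta>\<close> of the signed measure with density \<open>\<partial>\<^sub>t\<phi> + u \<cdot> \<nabla>\<phi>\<close> has vanishing Fourier transform
  and is zero, which gives the equation for every Borel function of \<open>\<theta>\<close>. The kernel \<open>K\<close> is a power of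
  \<open>\<Prod>\<^sub>i (1 + cos x\<^sub>i)\<close>, normalised: convolution with it yields trigonometric polynomials, which are
  smooth.\<close>

subsection \<open>Smooth functions\<close>

text \<open>Estimated by its two visible increments, the commutator is only of order
  \<open>e powr (\<alpha> + \<beta> - 1)\<close>, which may diverge although
  \<open>2 * \<alpha> + \<beta> > 1\<close>. The third increment comes without loss in
  \<open>e\<close>: increments of the mollified solution are averages of increments of
  \<open>\<theta>\<close> and obey the same power \<open>\<alpha>\<close>. No regularity in time is
  available. Sines are bounded with bounded derivatives, so every integral converges without any
  integrability of powers of \<open>\<theta>\<close>; those powers enter only once the image measure
  is known to vanish. A trigonometric kernel has no small support; moments take over that role. The
  powers met against its gradient stay below 3, the gradient adds one more, so a fourth moment is
  enough. In time only the Besov seminorms are integrable; zero mean lets them control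
  \<open>\<theta>\<close> and \<open>u\<close> themselves.\<close>

lemma smooth_coinduct:
  assumes "f \<in> S"
    and step: "\<And>g. g \<in> S \<Longrightarrow> \<exists>D. (\<forall>x. (g has_derivative (\<lambda>v. D v x)) (at x)) \<and> (\<forall>v. D v \<in> S)"
  shows "smooth f"
proof -
  \<comment> \<open>Induction on the list of directions: one more derivative of a member of
    \<open>S\<close> is some \<open>D v\<close>, again a member.\<close>
  have "iter_dir_deriv vs f \<in> S" for vs
  proof (induction vs)
    case Nil
    then show ?case using assms(1) by simp
  next
    case (Cons v vs)
    from step[OF Cons] obtain D where
      D: "\<And>x. (iter_dir_deriv vs f has_derivative (\<lambda>v. D v x)) (at x)" "\<And>v. D v \<in> S" by blast
    have "iter_dir_deriv (v # vs) f = D v"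
      using frechet_derivative_at[OF D(1)] by (auto simp: fun_eq_iff)
    then show ?case using D(2) by simp
  qed
  then show ?thesis
    unfolding smooth_def using step differentiableI by blast
qed

lemma iter_dir_deriv_snoc:
  "iter_dir_deriv (vs @ [v]) f = iter_dir_deriv vs (\<lambda>x. frechet_derivative f (at x) v)"
  by (induction vs) auto

lemma smooth_imp_differentiable: "smooth f \<Longrightarrow> f differentiable (at x)"
  unfolding smooth_def by (drule spec[of _ "[]"]) simp

lemma smooth_has_derivative:
  "smooth f \<Longrightarrow> (f has_derivative frechet_derivative f (at x)) (at x)"
  using smooth_imp_differentiable frechet_derivative_works by blast

lemma smooth_frechet: "smooth f \<Longrightarrow> smooth (\<lambda>x. frechet_derivative f (at x) v)"
  unfolding smooth_def by (metis iter_dir_deriv_snoc)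

lemma smoothI:
  assumes f: "\<And>x. (f has_derivative (\<lambda>v. D v x)) (at x)" and D: "\<And>v. smooth (D v)"
  shows "smooth f"
proof (rule smooth_coinduct[of _ "insert f {g. smooth g}"])
  fix g assume "g \<in> insert f {g. smooth g}"
  then show "\<exists>D. (\<forall>x. (g has_derivative (\<lambda>v. D v x)) (at x)) \<and> (\<forall>v. D v \<in> insert f {g. smooth g})"
  proof
    assume "g = f"
    then show ?thesis using f D by (intro exI[of _ D]) auto
  next
    assume "g \<in> {g. smooth g}"
    then show ?thesis using smooth_has_derivative[of g] smooth_frechet[of g]
      by (intro exI[of _ "\<lambda>v x. frechet_derivative g (at x) v"]) auto
  qed
qed simp

lemma smooth_const [simp]: "smooth (\<lambda>x. c)"
  by (rule smooth_coinduct[of _ "range (\<lambda>c x. c)"])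
     (auto intro!: exI[of _ "\<lambda>v x. 0"])

lemma smooth_bounded_linear: "bounded_linear f \<Longrightarrow> smooth f"
  by (rule smoothI[of _ "\<lambda>v x. f v"]) (auto simp: bounded_linear_imp_has_derivative)

text \<open>A directional derivative on the line is the ordinary derivative times the direction,
  which is why \<open>S\<close> has to absorb the factor \<open>c\<close>.\<close>

lemma smooth_real_coinduct:
  fixes f :: "real \<Rightarrow> real"
  assumes "f \<in> S"
    and step: "\<And>g. g \<in> S \<Longrightarrow> \<exists>g'. (\<forall>x. (g has_real_derivative g' x) (at x)) \<and> (\<forall>c. (\<lambda>x. g' x * c) \<in> S)"
  shows "smooth f"
proof (rule smooth_coinduct[OF assms(1)])
  fix g assume "g \<in> S"
  from step[OF this] obtain g' where
    "\<forall>x. (g has_real_derivative g' x) (at x)" "\<forall>c. (\<lambda>x. g' x * c) \<in> S" by blast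
  then show "\<exists>D. (\<forall>x. (g has_derivative (\<lambda>v. D v x)) (at x)) \<and> (\<forall>v. D v \<in> S)"
    by (intro exI[of _ "\<lambda>v x. g' x * v"]) (auto simp: has_field_derivative_def)
qed

text \<open>The derivative of a product or a composition is a sum of products, so neither class
  alone is closed under differentiation. This joint closure is, and can therefore serve as the set
  \<open>S\<close> of \<open>smooth_coinduct\<close>.\<close>

inductive smooth_gen :: "('a::euclidean_space \<Rightarrow> real) \<Rightarrow> bool" where
  base: "smooth f \<Longrightarrow> smooth_gen f"
| add: "smooth_gen f \<Longrightarrow> smooth_gen g \<Longrightarrow> smooth_gen (\<lambda>x. f x + g x)"
| mult: "smooth_gen f \<Longrightarrow> smooth_gen g \<Longrightarrow> smooth_gen (\<lambda>x. f x * g x)"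
| comp: "smooth (h :: real \<Rightarrow> real) \<Longrightarrow> smooth_gen f \<Longrightarrow> smooth_gen (\<lambda>x. h (f x))"

lemma smooth_gen_derivative:
  assumes "smooth_gen g"
  shows "\<exists>D. (\<forall>x. (g has_derivative (\<lambda>v. D v x)) (at x)) \<and> (\<forall>v. smooth_gen (D v))"
  using assms
proof induction
  case (base f)
  then show ?case using smooth_has_derivative[of f] smooth_frechet[of f]
    by (intro exI[of _ "\<lambda>v x. frechet_derivative f (at x) v"]) (auto intro: smooth_gen.base)
next
  case (add f g)
  then obtain D E where "\<forall>x. (f has_derivative (\<lambda>v. D v x)) (at x)" "\<forall>v. smooth_gen (D v)"
    "\<forall>x. (g has_derivative (\<lambda>v. E v x)) (at x)" "\<forall>v. smooth_gen (E v)" by blast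
  then show ?case
    by (intro exI[of _ "\<lambda>v x. D v x + E v x"]) (auto intro!: has_derivative_add smooth_gen.add)
next
  case (mult f g)
  then obtain D E where "\<forall>x. (f has_derivative (\<lambda>v. D v x)) (at x)" "\<forall>v. smooth_gen (D v)"
    "\<forall>x. (g has_derivative (\<lambda>v. E v x)) (at x)" "\<forall>v. smooth_gen (E v)" by blast
  then show ?case using mult.hyps
    by (intro exI[of _ "\<lambda>v x. f x * E v x + D v x * g x"])
       (auto intro!: has_derivative_mult smooth_gen.intros(2,3))
next
  case (comp h f)
  then obtain D where D: "\<forall>x. (f has_derivative (\<lambda>v. D v x)) (at x)" "\<forall>v. smooth_gen (D v)"
    by blast
  let ?h = "\<lambda>y. frechet_derivative h (at y) 1"
  have h: "(h has_real_derivative ?h y) (at y)" for y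
  proof -
    \<comment> \<open>By linearity the derivative on the line is multiplication by its value at 1;
      the chain rule then yields a product, which is one of the generators.\<close>
    have "frechet_derivative h (at y) = (*) (?h y)"
    proof
      fix v
      show "frechet_derivative h (at y) v = ?h y * v"
        using linear_scale[OF linear_frechet_derivative[OF smooth_imp_differentiable[OF comp.hyps(1)]], of y v 1]
        by (simp add: mult.commute)
    qed
    then show ?thesis
      using smooth_has_derivative[OF comp.hyps(1), of y] unfolding has_field_derivative_def by simp
  qed
  have "((\<lambda>x. h (f x)) has_derivative (\<lambda>v. ?h (f x) * D v x)) (at x)" for x
    using has_derivative_compose[OF D(1)[rule_format] h[unfolded has_field_derivative_def], of x] by simp
  then show ?case
    using D comp.hyps smooth_frechet[OF comp.hyps(1), of 1]
    by (intro exI[of _ "\<lambda>v x. ?h (f x) * D v x"])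
       (auto intro!: smooth_gen.intros(3) smooth_gen.intros(4)[of ?h f])
qed

lemma smooth_gen_imp_smooth: "smooth_gen f \<Longrightarrow> smooth f"
  by (rule smooth_coinduct[of _ "{g. smooth_gen g}"]) (use smooth_gen_derivative in auto)

lemma smooth_add: "smooth f \<Longrightarrow> smooth g \<Longrightarrow> smooth (\<lambda>x. f x + g x)"
  by (rule smooth_gen_imp_smooth[OF smooth_gen.add[OF smooth_gen.base smooth_gen.base]])

lemma smooth_mult: "smooth f \<Longrightarrow> smooth g \<Longrightarrow> smooth (\<lambda>x. f x * g x)"
  by (rule smooth_gen_imp_smooth[OF smooth_gen.mult[OF smooth_gen.base smooth_gen.base]])

lemma smooth_comp: "smooth (h :: real \<Rightarrow> real) \<Longrightarrow> smooth f \<Longrightarrow> smooth (\<lambda>x. h (f x))"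
  by (rule smooth_gen_imp_smooth[OF smooth_gen.comp[OF _ smooth_gen.base]])

text \<open>Differentiation shifts the phase by \<open>pi / 2\<close> and rescales the amplitude, so
  the multiples of \<open>sin (a * x + c)\<close> over all phases form a closed family. The cosine
  is included as a phase.\<close>

lemma smooth_sin: "smooth (\<lambda>x. sin (a * x + c))"
proof (rule smooth_real_coinduct[of _ "{\<lambda>x. b * sin (a * x + c) | b c. True}"])
  fix g assume "g \<in> {\<lambda>x. b * sin (a * x + c) | b c. True}"
  then obtain b c where g: "g = (\<lambda>x. b * sin (a * x + c))" by blast
  have *: "sin (a * x + (c + pi / 2)) = cos (a * x + c)" for x
    by (simp add: sin_add cos_add algebra_simps)
  have "\<forall>x. (g has_real_derivative b * a * cos (a * x + c)) (at x)"
    unfolding g by (auto intro!: derivative_eq_intros)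
  moreover have "(\<lambda>x. b * a * cos (a * x + c) * e) \<in> {\<lambda>x. b * sin (a * x + c) | b c. True}" for e
  proof -
    have "(\<lambda>x. b * a * cos (a * x + c) * e) = (\<lambda>x. (b * a * e) * sin (a * x + (c + pi / 2)))" for e
      by (rule ext, subst *, simp add: ac_simps)
    then show ?thesis by blast
  qed
  ultimately show "\<exists>g'. (\<forall>x. (g has_real_derivative g' x) (at x)) \<and>
      (\<forall>e. (\<lambda>x. g' x * e) \<in> {\<lambda>x. b * sin (a * x + c) | b c. True})"
    by (intro exI[of _ "\<lambda>x. b * a * cos (a * x + c)"]) auto
qed (rule CollectI, rule exI[of _ 1], rule exI[of _ c], simp)

lemma smooth_imp_continuous_on: "smooth f \<Longrightarrow> continuous_on S f"
  by (meson continuous_at_imp_continuous_on differentiable_imp_continuous_within smooth_imp_differentiable)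

lemma smooth_real_DERIV:
  fixes f :: "real \<Rightarrow> real"
  assumes "smooth f"
  shows "(f has_real_derivative deriv f x) (at x)"
  by (metis DERIV_imp_deriv assms real_differentiable_def smooth_imp_differentiable)

lemma smooth_real_primitive:
  fixes F :: "real \<Rightarrow> real"
  assumes "\<And>x. (F has_real_derivative f x) (at x)" and "smooth f"
  shows "smooth F"
  by (rule smoothI[of _ "\<lambda>v x. f x * v"])
     (use assms in \<open>auto simp: has_field_derivative_def intro!: smooth_mult\<close>)

subsection \<open>Bump functions on the line\<close>

text \<open>\<open>flat 1\<close> is the classical smooth function that vanishes to infinite order
  at 0. The polynomial in \<open>1 / s\<close> is carried along because derivatives of
  \<open>exp (- 1 / s)\<close> are of this form.\<close>

definition flat :: "real poly \<Rightarrow> real \<Rightarrow> real" where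
  "flat P s = (if s > 0 then exp (- 1 / s) * poly P (1 / s) else 0)"

lemma poly_exp_tendsto_0:
  fixes P :: "real poly"
  shows "((\<lambda>x. exp (- x) * poly P x) \<longlongrightarrow> 0) at_top"
proof -
  have "((\<lambda>x. \<Sum>i\<le>degree P. coeff P i * (x ^ i / exp x)) \<longlongrightarrow> (\<Sum>i\<le>degree P. coeff P i * 0)) at_top"
    by (intro tendsto_sum tendsto_mult tendsto_const tendsto_power_div_exp_0)
  then show ?thesis
    by (simp add: poly_altdef exp_minus field_simps sum_distrib_left)
qed

text \<open>With z = 1/s, the derivative of exp(-z) P(z) in s is z^2 exp(-z) (P(z) - P'(z)); the
  factor z^2 is \<open>monom 1 2\<close>. At the origin exponential decay beats every
  polynomial.\<close>

lemma flat_has_derivative: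
  "(flat P has_real_derivative flat (monom 1 2 * (P - pderiv P)) x) (at x)"
proof -
  consider "x < 0" | "x = 0" | "x > 0" by linarith
  then show ?thesis
  proof cases
    case 1
    have "((\<lambda>s. 0) has_real_derivative 0) (at x)" by simp
    then have "(flat P has_real_derivative 0) (at x)"
      by (rule has_field_derivative_transform_within_open[where S="{..<0}"])
         (use 1 in \<open>auto simp: flat_def\<close>)
    then show ?thesis using 1 by (simp add: flat_def)
  next
    case 2
    \<comment> \<open>The difference quotient at 0 divides by s, that is, multiplies the polynomial
      by its variable; this is \<open>pCons 0 P\<close>.\<close>
    have "((\<lambda>s. exp (- (1 / s)) * poly (pCons 0 P) (1 / s)) \<longlongrightarrow> 0) (at_right 0)"
      by (rule filterlim_compose[OF poly_exp_tendsto_0])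
         (simp add: filterlim_inverse_at_top_right flip: inverse_eq_divide)
    then have R: "((\<lambda>s. flat P s / s) \<longlongrightarrow> 0) (at_right 0)"
      by (rule Lim_transform_eventually)
         (auto simp: eventually_at_filter flat_def)
    have L: "((\<lambda>s. flat P s / s) \<longlongrightarrow> 0) (at_left 0)"
      by (rule tendsto_eventually) (auto simp: eventually_at_filter flat_def)
    have "((\<lambda>s. flat P s / s) \<longlongrightarrow> 0) (at 0)"
      using L R by (simp add: filterlim_split_at)
    then show ?thesis using 2 by (simp add: has_field_derivative_iff flat_def)
  next
    case 3
    have i: "((\<lambda>s. 1 / s) has_real_derivative - (1 / x\<^sup>2)) (at x)"
      using 3 by (auto intro!: derivative_eq_intros simp: power2_eq_square)
    have p: "((\<lambda>s. poly P (1 / s)) has_real_derivative poly (pderiv P) (1 / x) * - (1 / x\<^sup>2)) (at x)"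
      by (rule DERIV_chain2[OF poly_DERIV i])
    have e: "((\<lambda>s. exp (- 1 / s)) has_real_derivative exp (- 1 / x) * (1 / x\<^sup>2)) (at x)"
      using DERIV_chain2[OF DERIV_exp DERIV_minus[OF i]] by simp
    have "((\<lambda>s. exp (- 1 / s) * poly P (1 / s)) has_real_derivative
        exp (- 1 / x) * poly (monom 1 2 * (P - pderiv P)) (1 / x)) (at x)"
      by (rule DERIV_cong[OF DERIV_mult[OF e p]]) (simp add: poly_monom algebra_simps power_one_over)
    then have "(flat P has_real_derivative exp (- 1 / x) * poly (monom 1 2 * (P - pderiv P)) (1 / x)) (at x)"
      by (rule has_field_derivative_transform_within_open[where S="{0<..}"])
         (use 3 in \<open>auto simp: flat_def\<close>)
    then show ?thesis using 3 by (simp add: flat_def)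
  qed
qed

lemma smooth_flat: "smooth (flat P)"
proof (rule smooth_real_coinduct[of _ "range flat"])
  fix g assume "g \<in> range flat"
  then obtain P where g: "g = flat P" by blast
  have "(\<lambda>x. flat (monom 1 2 * (P - pderiv P)) x * c) = flat (smult c (monom 1 2 * (P - pderiv P)))" for c
    by (auto simp: flat_def fun_eq_iff)
  then show "\<exists>g'. (\<forall>x. (g has_real_derivative g' x) (at x)) \<and> (\<forall>c. (\<lambda>x. g' x * c) \<in> range flat)"
    unfolding g using flat_has_derivative[of P] by (intro exI[of _ "flat (monom 1 2 * (P - pderiv P))"]) auto
qed simp

text \<open>The product \<open>(t - a) * (b - t)\<close> is positive exactly inside the interval.
  The factor \<open>k\<close> steepens the bump: as it grows, the values inside increase to 1, so
  that intervals can be reached as limits of smooth functions.\<close>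

definition bump :: "real \<Rightarrow> real \<Rightarrow> real \<Rightarrow> real \<Rightarrow> real" where
  "bump k a b t = flat 1 (k * ((t - a) * (b - t)))"

lemma bump_pos: "k > 0 \<Longrightarrow> a < t \<Longrightarrow> t < b \<Longrightarrow> bump k a b t > 0"
  by (simp add: bump_def flat_def)

lemma bump_zero: "k > 0 \<Longrightarrow> a \<le> b \<Longrightarrow> t \<le> a \<or> b \<le> t \<Longrightarrow> bump k a b t = 0"
  by (auto simp: bump_def flat_def zero_less_mult_iff)

lemma bump_nonneg: "bump k a b t \<ge> 0"
  by (simp add: bump_def flat_def)

lemma bump_le_1: "bump k a b t \<le> 1"
  by (simp add: bump_def flat_def)

lemma smooth_bump: "smooth (bump k a b)"
proof -
  have "smooth (\<lambda>t. k * ((t + (- a)) * (b + (- 1) * t)))"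
    by (intro smooth_mult smooth_add smooth_const smooth_bounded_linear bounded_linear_ident)
  then show ?thesis
    unfolding bump_def using smooth_comp[OF smooth_flat] by simp
qed

lemma bump_tendsto_indicator:
  assumes "a \<le> b"
  shows "(\<lambda>n. bump (real (Suc n)) a b t) \<longlonglongrightarrow> indicator {a<..<b} t"
proof (cases "t \<in> {a<..<b}")
  case True
  then have p: "(t - a) * (b - t) > 0" by auto
  have "(\<lambda>n. exp (- (inverse ((t - a) * (b - t)) * inverse (real (Suc n))))) \<longlonglongrightarrow> exp (- (inverse ((t - a) * (b - t)) * 0))"
    by (intro tendsto_intros LIMSEQ_inverse_real_of_nat)
  moreover have "exp (- (inverse ((t - a) * (b - t)) * inverse (real (Suc n)))) = bump (real (Suc n)) a b t" for n
  proof -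
    have "real (Suc n) * ((t - a) * (b - t)) > 0" using p by simp
    then show ?thesis unfolding bump_def flat_def by (auto simp: field_simps)
  qed
  ultimately show ?thesis using True by simp
next
  case False
  then show ?thesis using assms by (auto simp: bump_zero)
qed

subsection \<open>Integration over the torus\<close>

text \<open>Borel counterpart of \<open>torus\<close>. As a density it keeps the whole space as its
  carrier and the Borel sets as its sets, so that functions stay total and product measures behave
  well; the passage from Lebesgue data is made once, at the end.\<close>

definition tor :: "(real ^ 'd) measure" where
  "tor = density lborel (indicator torus_cell)"

lemma sets_tor [simp, measurable_cong]: "sets tor = sets borel"
  by (simp add: tor_def)

lemma space_tor [simp]: "space tor = UNIV"
  by (simp add: tor_def)

lemma torus_cell_iff: "x \<in> torus_cell \<longleftrightarrow> (\<forall>i. \<bar>x $ i\<bar> \<le> pi)"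
  unfolding torus_cell_def mem_box_cart by (auto simp: abs_le_iff minus_le_iff)

lemma torus_cell_borel [measurable]: "torus_cell \<in> sets borel"
  by (simp add: torus_cell_def)

lemma nn_integral_tor:
  "f \<in> borel_measurable borel \<Longrightarrow> (\<integral>\<^sup>+x. f x \<partial>tor) = (\<integral>\<^sup>+x. f x * indicator torus_cell x \<partial>lborel)"
  unfolding tor_def by (subst nn_integral_density) (auto simp: mult.commute)

lemma AE_tor: "(AE x in tor. P x) \<longleftrightarrow> (AE x in lborel. x \<in> torus_cell \<longrightarrow> P x)"
  unfolding tor_def by (subst AE_density) (auto simp: indicator_def)

lemma AE_tor_cell: "AE x in tor. x \<in> torus_cell"
  by (simp add: AE_tor)

lemma emeasure_tor: "emeasure (tor :: (real ^ 'd) measure) UNIV = ennreal ((2 * pi) ^ CARD('d))"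
proof -
  have "emeasure (tor :: (real ^ 'd) measure) UNIV = emeasure lborel (torus_cell :: (real ^ 'd) set)"
    unfolding tor_def by (subst emeasure_density) auto
  also have "\<dots> = (\<Prod>b\<in>Basis. ((\<chi> i. pi) - (\<chi> i. - pi)) \<bullet> (b :: real ^ 'd))"
    unfolding torus_cell_def by (rule emeasure_lborel_cbox) (auto simp: inner_Basis Basis_vec_def inner_axis)
  also have "(\<Prod>b\<in>Basis. ((\<chi> i. pi) - (\<chi> i. - pi)) \<bullet> (b :: real ^ 'd)) = (\<Prod>b\<in>(Basis :: (real ^ 'd) set). 2 * pi)"
    by (intro prod.cong) (auto simp: Basis_vec_def inner_axis)
  finally show ?thesis by simp
qed

interpretation tor: finite_measure "tor :: (real ^ 'd) measure"
  by standard (simp add: emeasure_tor)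

lemma AE_lborel_coord: "AE x in lborel. (x :: real ^ 'd) $ i \<noteq> c"
proof -
  have "negligible {x :: real ^ 'd. x $ i = c}"
    using negligible_standard_hyperplane[of "axis i 1 :: real ^ 'd" c] by (simp add: inner_axis axis_in_Basis_iff)
  then have "{x :: real ^ 'd. x $ i = c} \<in> null_sets lborel"
    by (subst null_sets_completion_iff[symmetric]) (auto simp: negligible_iff_null_sets)
  then show ?thesis by (auto dest: AE_not_in)
qed

section \<open>Translation invariance of integration over the torus\<close>

lemma periodic_shift: "periodic f \<Longrightarrow> periodic (\<lambda>x. f (x + a))"
  unfolding periodic_def by (metis add.commute add.left_commute)

lemma periodic_axis_nat:
  fixes x :: "real ^ 'd"
  shows "periodic f \<Longrightarrow> f (x + axis i (2 * pi * real n)) = f x"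
proof (induction n arbitrary: x)
  case (Suc n)
  have "axis i (2 * pi * real (Suc n)) = axis i (2 * pi * real n) + (axis i (2 * pi) :: real ^ 'd)"
    by (auto simp: axis_def vec_eq_iff algebra_simps)
  then show ?case using Suc by (simp add: periodic_def flip: add.assoc)
qed (simp add: axis_def zero_vec_def[symmetric])

lemma periodic_axis_int:
  fixes x :: "real ^ 'd"
  shows "periodic f \<Longrightarrow> f (x + axis i (2 * pi * of_int k)) = f x"
proof (cases k rule: int_cases2)
  case (nonneg n)
  then show "periodic f \<Longrightarrow> ?thesis" using periodic_axis_nat[of f x i n] by simp
next
  case (nonpos n)
  have "x + axis i (2 * pi * of_int k) + axis i (2 * pi * real n) = x"
    using nonpos by (auto simp: axis_def vec_eq_iff)
  then show "periodic f \<Longrightarrow> ?thesis" using periodic_axis_nat[of f "x + axis i (2 * pi * of_int k)" i n] by (metis (no_types))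
qed

lemma nn_integral_lborel_shift:
  fixes f :: "'a::euclidean_space \<Rightarrow> ennreal"
  assumes "f \<in> borel_measurable borel"
  shows "(\<integral>\<^sup>+x. f (x + a) \<partial>lborel) = (\<integral>\<^sup>+x. f x \<partial>lborel)"
proof -
  have "(\<integral>\<^sup>+x. f x \<partial>lborel) = (\<integral>\<^sup>+x. f x \<partial>(distr lborel borel (\<lambda>x. a + x)))"
    by (simp add: lborel_distr_plus)
  also have "\<dots> = (\<integral>\<^sup>+x. f (a + x) \<partial>lborel)"
    by (rule nn_integral_distr) (use assms in auto)
  finally show ?thesis by (simp add: add.commute)
qed

text \<open>An exact fundamental domain: its lattice translates are disjoint and cover the space,
  while those of the closed cell overlap in their faces.\<close>

definition hcell :: "(real ^ 'd) set" where
  "hcell = {x. \<forall>j. - pi \<le> x $ j \<and> x $ j < pi}"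

lemma hcell_borel [measurable]: "hcell \<in> sets borel"
  unfolding hcell_def by measurable

lemma nn_integral_tor_hcell:
  assumes "f \<in> borel_measurable borel"
  shows "(\<integral>\<^sup>+x. f x \<partial>tor) = (\<integral>\<^sup>+x. f x * indicator hcell x \<partial>(lborel :: (real ^ 'd) measure))"
proof -
  have "AE x in (lborel :: (real ^ 'd) measure). \<forall>i\<in>UNIV. x $ i \<noteq> pi"
    by (rule AE_finite_allI) (auto intro: AE_lborel_coord)
  then show ?thesis
    unfolding nn_integral_tor[OF assms]
    by (intro nn_integral_cong_AE, eventually_elim)
       (auto simp: indicator_def hcell_def torus_cell_iff abs_le_iff minus_le_iff less_le split: if_splits)
qed

lemma nn_integral_tor_axis:
  fixes f :: "real ^ 'd \<Rightarrow> ennreal"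
  assumes f [measurable]: "f \<in> borel_measurable borel" and p: "periodic f" and s: "0 \<le> s" "s \<le> 2 * pi"
  shows "(\<integral>\<^sup>+x. f (x + axis i s) \<partial>tor) = (\<integral>\<^sup>+x. f x \<partial>tor)"
proof -
  \<comment> \<open>\<open>A\<close> is the overlap of the cell with its translate by
    \<open>s\<close>; \<open>B\<close> is the strip left uncovered, which one full period carries
    onto the part sticking out on the other side.\<close>
  define A :: "(real ^ 'd) set" where "A = {x. (\<forall>j. j \<noteq> i \<longrightarrow> - pi \<le> x $ j \<and> x $ j < pi) \<and> - pi + s \<le> x $ i \<and> x $ i < pi}"
  define B :: "(real ^ 'd) set" where "B = {x. (\<forall>j. j \<noteq> i \<longrightarrow> - pi \<le> x $ j \<and> x $ j < pi) \<and> - pi \<le> x $ i \<and> x $ i < - pi + s}"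
  have [measurable]: "A \<in> sets borel" "B \<in> sets borel" unfolding A_def B_def by measurable
  \<comment> \<open>The indicator is written with \<open>x + axis i s - axis i s\<close> so that the
    whole integrand is a function of the translated variable.\<close>
  have "(\<integral>\<^sup>+x. f (x + axis i s) \<partial>tor) = (\<integral>\<^sup>+x. f (x + axis i s) * indicator hcell (x + axis i s - axis i s) \<partial>lborel)"
    by (subst nn_integral_tor_hcell) auto
  also have "\<dots> = (\<integral>\<^sup>+x. f x * indicator hcell (x - axis i s) \<partial>lborel)"
    by (rule nn_integral_lborel_shift) measurable
  also have "\<dots> = (\<integral>\<^sup>+x. f x * indicator A x + f x * indicator B (x + axis i (- 2 * pi)) \<partial>lborel)"
  proof (intro nn_integral_cong)
    fix x :: "real ^ 'd"
    have 1: "x - axis i s \<in> hcell \<longleftrightarrow> (\<forall>j. j \<noteq> i \<longrightarrow> - pi \<le> x $ j \<and> x $ j < pi) \<and> - pi + s \<le> x $ i \<and> x $ i < pi + s"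
      unfolding hcell_def by (auto simp: axis_def split: if_splits)
    have 2: "x + axis i (- 2 * pi) \<in> B \<longleftrightarrow> (\<forall>j. j \<noteq> i \<longrightarrow> - pi \<le> x $ j \<and> x $ j < pi) \<and> pi \<le> x $ i \<and> x $ i < pi + s"
      unfolding B_def by (auto simp: axis_def)
    show "f x * indicator hcell (x - axis i s) = f x * indicator A x + f x * indicator B (x + axis i (- 2 * pi))"
      unfolding indicator_def 1 2 A_def using s by auto
  qed
  also have "\<dots> = (\<integral>\<^sup>+x. f x * indicator A x \<partial>lborel) + (\<integral>\<^sup>+x. f x * indicator B (x + axis i (- 2 * pi)) \<partial>lborel)"
    by (rule nn_integral_add) auto
  also have "(\<integral>\<^sup>+x. f x * indicator B (x + axis i (- 2 * pi)) \<partial>lborel) =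
      (\<integral>\<^sup>+x. f (x + axis i (- 2 * pi)) * indicator B (x + axis i (- 2 * pi)) \<partial>lborel)"
    using periodic_axis_int[OF p, of _ i "-1"] by simp
  also have "\<dots> = (\<integral>\<^sup>+x. f x * indicator B x \<partial>lborel)"
    by (rule nn_integral_lborel_shift) measurable
  also have "(\<integral>\<^sup>+x. f x * indicator A x \<partial>lborel) + (\<integral>\<^sup>+x. f x * indicator B x \<partial>lborel) =
      (\<integral>\<^sup>+x. f x * indicator A x + f x * indicator B x \<partial>lborel)"
    by (rule nn_integral_add[symmetric]) auto
  also have "\<dots> = (\<integral>\<^sup>+x. f x * indicator hcell x \<partial>lborel)"
  proof (intro nn_integral_cong)
    fix x :: "real ^ 'd"
    have 1: "x \<in> hcell \<longleftrightarrow> (\<forall>j. j \<noteq> i \<longrightarrow> - pi \<le> x $ j \<and> x $ j < pi) \<and> - pi \<le> x $ i \<and> x $ i < pi"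
      unfolding hcell_def by auto
    show "f x * indicator A x + f x * indicator B x = f x * indicator hcell x"
      unfolding indicator_def 1 A_def B_def using s by auto
  qed
  finally show ?thesis by (simp add: nn_integral_tor_hcell)
qed

text \<open>A translation is a composition of shifts along the axes, and each of these is reduced to
  a shift between 0 and \<open>2 * pi\<close> by removing whole periods.\<close>

lemma nn_integral_tor_shift:
  fixes f :: "real ^ 'd \<Rightarrow> ennreal"
  assumes f: "f \<in> borel_measurable borel" and p: "periodic f"
  shows "(\<integral>\<^sup>+x. f (x + a) \<partial>tor) = (\<integral>\<^sup>+x. f x \<partial>tor)"
proof -
  have ax: "(\<integral>\<^sup>+x. g (x + axis i s) \<partial>tor) = (\<integral>\<^sup>+x. g x \<partial>tor)"
    if "g \<in> borel_measurable borel" "periodic g" for g :: "real ^ 'd \<Rightarrow> ennreal" and i s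
  proof -
    define k where "k = \<lfloor>s / (2 * pi)\<rfloor>"
    define r where "r = s - 2 * pi * of_int k"
    have "of_int k \<le> s / (2 * pi)" "s / (2 * pi) \<le> of_int k + 1" unfolding k_def by linarith+
    then have r: "0 \<le> r" "r \<le> 2 * pi" unfolding r_def by (auto simp: field_simps)
    have "x + axis i s = x + axis i r + axis i (2 * pi * of_int k)" for x :: "real ^ 'd"
      unfolding r_def by (auto simp: axis_def vec_eq_iff)
    then have "g (x + axis i s) = g (x + axis i r)" for x
      using periodic_axis_int[OF that(2)] by (metis (no_types))
    then show ?thesis using nn_integral_tor_axis[OF that r] by simp
  qed
  have "(\<integral>\<^sup>+x. f (x + (\<Sum>i\<in>S. axis i (a $ i))) \<partial>tor) = (\<integral>\<^sup>+x. f x \<partial>tor)" if "finite S" for S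
    using that
  proof induction
    case (insert i S)
    have "(\<integral>\<^sup>+x. f (x + (\<Sum>i\<in>insert i S. axis i (a $ i))) \<partial>tor) =
        (\<integral>\<^sup>+x. f (x + axis i (a $ i) + (\<Sum>i\<in>S. axis i (a $ i))) \<partial>tor)"
      using insert by (simp add: add.assoc)
    also have "\<dots> = (\<integral>\<^sup>+x. f (x + (\<Sum>i\<in>S. axis i (a $ i))) \<partial>tor)"
      by (rule ax[of "\<lambda>x. f (x + (\<Sum>i\<in>S. axis i (a $ i)))"]) (use f in measurable, use p periodic_shift in auto)
    finally show ?case using insert by simp
  qed simp
  from this[of UNIV] have "(\<integral>\<^sup>+x. f (x + (\<Sum>i\<in>UNIV. axis i (a $ i))) \<partial>tor) = (\<integral>\<^sup>+x. f x \<partial>tor)"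
    by simp
  moreover have "(\<Sum>i\<in>UNIV. axis i (a $ i)) = a"
    by (simp add: vec_eq_iff axis_def sum.delta)
  ultimately show ?thesis by (simp only:)
qed

lemma AE_tor_shift:
  fixes P :: "real ^ 'd \<Rightarrow> bool"
  assumes P: "Measurable.pred borel P" and p: "periodic P" and "AE x in tor. P x"
  shows "AE x in tor. P (x + a)"
proof -
  have [measurable]: "Measurable.pred borel P" by fact
  have "(\<integral>\<^sup>+x. indicator {x. \<not> P x} x \<partial>tor) = (0 :: ennreal)"
    using assms(3) by (subst nn_integral_0_iff_AE) (auto simp: indicator_def)
  moreover have "(\<integral>\<^sup>+x. indicator {x. \<not> P x} (x + a) \<partial>tor) = (\<integral>\<^sup>+x. indicator {x. \<not> P x} x \<partial>(tor :: (real ^ 'd) measure) :: ennreal)"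
    by (rule nn_integral_tor_shift) (use p in \<open>auto simp: periodic_def indicator_def\<close>)
  ultimately have "(\<integral>\<^sup>+x. indicator {x. \<not> P x} (x + a) \<partial>(tor :: (real ^ 'd) measure)) = (0 :: ennreal)"
    by simp
  then have "AE x in tor. indicator {x. \<not> P x} (x + a) = (0 :: ennreal)"
    by (subst (asm) nn_integral_0_iff_AE) auto
  then show ?thesis by eventually_elim (auto simp: indicator_def split: if_splits)
qed

lemma integral_tor_shift:
  fixes f :: "real ^ 'd \<Rightarrow> real"
  assumes f [measurable]: "f \<in> borel_measurable borel" and p: "periodic f"
  shows "integrable tor (\<lambda>x. f (x + a)) \<longleftrightarrow> integrable tor f"
    and "(\<integral>x. f (x + a) \<partial>tor) = (\<integral>x. f x \<partial>tor)"
proof -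
  have *: "(\<integral>\<^sup>+x. ennreal (h (f (x + a))) \<partial>tor) = (\<integral>\<^sup>+x. ennreal (h (f x)) \<partial>tor)"
    if [measurable]: "h \<in> borel_measurable borel" for h :: "real \<Rightarrow> real"
    by (rule nn_integral_tor_shift[of "\<lambda>x. ennreal (h (f x))"]) (use p in \<open>auto simp: periodic_def\<close>)
  show i: "integrable tor (\<lambda>x. f (x + a)) \<longleftrightarrow> integrable tor f"
    using *[of abs] by (simp add: integrable_iff_bounded)
  show "(\<integral>x. f (x + a) \<partial>tor) = (\<integral>x. f x \<partial>tor)"
  proof (cases "integrable tor f")
    case True
    then show ?thesis using i *[of "\<lambda>x. x"] *[of uminus] by (simp add: real_lebesgue_integral_def)
  next
    case False
    then show ?thesis using i by (simp add: not_integrable_integral_eq)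
  qed
qed

lemma integral_tor_uminus:
  fixes f :: "real ^ 'd \<Rightarrow> real"
  assumes [measurable]: "f \<in> borel_measurable borel"
  shows "(\<integral>x. f (- x) \<partial>tor) = (\<integral>x. f x \<partial>tor)"
proof -
  have "density (distr lborel borel uminus) (\<lambda>x. 1) = (lborel :: (real ^ 'd) measure)"
    using lborel_affine[of "-1" "0 :: real ^ 'd"] by (simp add: scaleR_minus1_left cong: distr_cong)
  then have d: "distr lborel borel uminus = (lborel :: (real ^ 'd) measure)"
    by (simp add: density_1)
  have c: "indicator torus_cell (- x) = (indicator torus_cell x :: real)" for x :: "real ^ 'd"
    by (simp add: indicator_def torus_cell_iff)
  have e: "(\<integral>x. g x \<partial>tor) = (\<integral>x. indicator torus_cell x * g x \<partial>lborel)"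
    if "g \<in> borel_measurable borel" for g :: "real ^ 'd \<Rightarrow> real"
    using integral_density[of g lborel "indicator torus_cell"] that
    unfolding tor_def ennreal_indicator by simp
  have "(\<integral>x. f x \<partial>tor) = (\<integral>x. indicator torus_cell x * f x \<partial>(distr lborel borel uminus))"
    unfolding d by (simp add: e)
  also have "\<dots> = (\<integral>x. indicator torus_cell (- x) * f (- x) \<partial>lborel)"
    by (rule integral_distr) auto
  finally show ?thesis by (simp add: c e)
qed

subsection \<open>Trigonometric polynomials\<close>

text \<open>The algebra of trigonometric polynomials, generated rather than given by coefficients:
  smoothness, periodicity, boundedness and closure under derivatives then follow by rule
  induction.\<close>

inductive trig :: "(real ^ 'd \<Rightarrow> real) \<Rightarrow> bool" where
  const: "trig (\<lambda>x. c)"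
| cos: "trig (\<lambda>x. cos (x $ i))"
| sin: "trig (\<lambda>x. sin (x $ i))"
| add: "trig f \<Longrightarrow> trig g \<Longrightarrow> trig (\<lambda>x. f x + g x)"
| mult: "trig f \<Longrightarrow> trig g \<Longrightarrow> trig (\<lambda>x. f x * g x)"

lemma smooth_nth: "smooth (\<lambda>x :: real ^ 'd. x $ i)"
  by (rule smooth_bounded_linear) (rule bounded_linear_vec_nth)

lemma trig_smooth: "trig f \<Longrightarrow> smooth f"
proof (induction rule: trig.induct)
  case (cos i)
  show ?case using smooth_comp[OF smooth_sin[of 1 "pi / 2"] smooth_nth[of i]] by (simp add: sin_add)
next
  case (sin i)
  show ?case using smooth_comp[OF smooth_sin[of 1 0] smooth_nth[of i]] by simp
qed (auto intro: smooth_add smooth_mult)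

lemma trig_periodic: "trig f \<Longrightarrow> periodic f"
proof (induction rule: trig.induct)
  case (cos i)
  show ?case by (auto simp: periodic_def axis_def)
next
  case (sin i)
  show ?case by (auto simp: periodic_def axis_def)
qed (auto simp: periodic_def)

lemma trig_bounded: "trig f \<Longrightarrow> \<exists>B. \<forall>x. \<bar>f x\<bar> \<le> B"
proof (induction rule: trig.induct)
  case (add f g)
  then obtain B C where "\<And>x. \<bar>f x\<bar> \<le> B" "\<And>x. \<bar>g x\<bar> \<le> C" by blast
  then have "\<bar>f x + g x\<bar> \<le> B + C" for x
    by (meson abs_triangle_ineq add_mono order_trans)
  then show ?case by blast
next
  case (mult f g)
  then obtain B C where B: "\<And>x. \<bar>f x\<bar> \<le> B" "\<And>x. \<bar>g x\<bar> \<le> C" by blast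
  then have "\<bar>f x * g x\<bar> \<le> B * C" for x
    unfolding abs_mult by (intro mult_mono) (auto intro: order_trans[OF abs_ge_zero B(1)])
  then show ?case by blast
qed (auto intro: abs_cos_le_one abs_sin_le_one)

lemma trig_measurable: "trig f \<Longrightarrow> f \<in> borel_measurable borel"
  by (intro borel_measurable_continuous_onI smooth_imp_continuous_on trig_smooth)

lemma trig_uminus: "trig f \<Longrightarrow> trig (\<lambda>x. - f x)"
  using trig.mult[OF trig.const[of "-1"], of f] by simp

lemma trig_reflect: "trig f \<Longrightarrow> trig (\<lambda>x. f (- x))"
  by (induction rule: trig.induct) (auto intro!: trig.intros(1,2,4,5) trig_uminus trig.sin)

lemma trig_power: "trig f \<Longrightarrow> trig (\<lambda>x. f x ^ n)"
  by (induction n) (auto intro: trig.const trig.mult)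

lemma trig_prod: "(\<And>i. i \<in> I \<Longrightarrow> trig (f i)) \<Longrightarrow> trig (\<lambda>x. \<Prod>i\<in>I. f i x)"
  by (induction I rule: infinite_finite_induct) (auto intro: trig.const trig.mult)

lemma trig_sum: "(\<And>i. i \<in> I \<Longrightarrow> trig (f i)) \<Longrightarrow> trig (\<lambda>x. \<Sum>i\<in>I. f i x)"
  by (induction I rule: infinite_finite_induct) (auto intro: trig.const trig.add)

lemma trig_frechet: "trig f \<Longrightarrow> trig (\<lambda>x. frechet_derivative f (at x) v)"
proof (induction rule: trig.induct)
  case (const c)
  then show ?case by (simp add: frechet_derivative_const trig.const)
next
  case (cos i)
  have "((\<lambda>x :: real ^ 'a. cos (x $ i)) has_derivative (\<lambda>v. v $ i * - sin (x $ i))) (at x)" for x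
    by (auto intro!: derivative_eq_intros simp: bounded_linear_imp_has_derivative[OF bounded_linear_vec_nth])
  from frechet_derivative_at[OF this, symmetric] show ?case
    by simp (intro trig_uminus trig.mult trig.const trig.sin)
next
  case (sin i)
  have "((\<lambda>x :: real ^ 'a. sin (x $ i)) has_derivative (\<lambda>v. v $ i * cos (x $ i))) (at x)" for x
    by (auto intro!: derivative_eq_intros simp: bounded_linear_imp_has_derivative[OF bounded_linear_vec_nth])
  from frechet_derivative_at[OF this, symmetric] show ?case
    by simp (intro trig.mult trig.const trig.cos)
next
  case (add f g)
  have "((\<lambda>x. f x + g x) has_derivative (\<lambda>v. frechet_derivative f (at x) v + frechet_derivative g (at x) v)) (at x)" for x
    by (intro has_derivative_add smooth_has_derivative trig_smooth add)
  from frechet_derivative_at[OF this, symmetric] show ?case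
    by simp (intro trig.add add)
next
  case (mult f g)
  have "((\<lambda>x. f x * g x) has_derivative (\<lambda>v. f x * frechet_derivative g (at x) v + frechet_derivative f (at x) v * g x)) (at x)" for x
    by (intro has_derivative_mult smooth_has_derivative trig_smooth mult)
  from frechet_derivative_at[OF this, symmetric] show ?case
    by simp (intro trig.add trig.mult mult)
qed

text \<open>The kernels \<open>h(x,y)\<close> of finite rank: the functions \<open>k(x - y)\<close> with \<open>k\<close> trigonometric are among
  them, so that convolution with \<open>k\<close> produces trigonometric polynomials.\<close>

inductive sep :: "(real ^ 'd \<Rightarrow> real ^ 'd \<Rightarrow> real) \<Rightarrow> bool" where
  one: "trig a \<Longrightarrow> trig b \<Longrightarrow> sep (\<lambda>x y. a x * b y)"
| plus: "sep g \<Longrightarrow> sep h \<Longrightarrow> sep (\<lambda>x y. g x y + h x y)"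

lemma sep_mult1: "sep h \<Longrightarrow> trig a \<Longrightarrow> trig b \<Longrightarrow> sep (\<lambda>x y. (a x * b y) * h x y)"
proof (induction rule: sep.induct)
  case (one c d)
  then show ?case using sep.one[OF trig.mult[of a c] trig.mult[of b d]] by (simp add: mult.commute mult.left_commute)
next
  case (plus g h)
  then show ?case unfolding distrib_left by (intro sep.plus)
qed

lemma sep_mult: "sep g \<Longrightarrow> sep h \<Longrightarrow> sep (\<lambda>x y. g x y * h x y)"
proof (induction rule: sep.induct)
  case (one a b)
  then show ?case by (intro sep_mult1)
next
  case (plus g1 g2)
  then show ?case unfolding distrib_right by (intro sep.plus)
qed

lemma trig_sep: "trig k \<Longrightarrow> sep (\<lambda>x y. k (x - y))"
proof (induction rule: trig.induct)
  case (const c)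
  show ?case using sep.one[OF trig.const[of c] trig.const[of 1]] by simp
next
  case (cos i)
  show ?case unfolding vector_minus_component cos_diff
    by (intro sep.plus sep.one trig.cos trig.sin)
next
  case (sin i)
  have "sep (\<lambda>x y. sin (x $ i) * cos (y $ i) + cos (x $ i) * - sin (y $ i))"
    by (intro sep.plus sep.one trig.cos trig.sin trig_uminus)
  then show ?case unfolding vector_minus_component sin_diff by simp
next
  case (add f g)
  then show ?case by (intro sep.plus)
next
  case (mult f g)
  then show ?case by (intro sep_mult)
qed

lemma integrable_trig_mult:
  assumes "trig k" "integrable tor g"
  shows "integrable tor (\<lambda>y. k y * g y)"
proof -
  obtain B where B: "\<And>x. \<bar>k x\<bar> \<le> B" using trig_bounded[OF assms(1)] by blast
  have m [measurable]: "k \<in> borel_measurable borel" "g \<in> borel_measurable borel"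
    using trig_measurable assms by (auto dest: borel_measurable_integrable)
  show ?thesis
    by (rule Bochner_Integration.integrable_bound[OF integrable_mult_right[OF assms(2), of B]])
       (auto simp: abs_mult intro!: mult_mono order_trans[OF B abs_ge_self] AE_I2)
qed

lemma integrable_sep_mult: "sep h \<Longrightarrow> integrable tor g \<Longrightarrow> integrable tor (\<lambda>y. h x y * g y)"
proof (induction rule: sep.induct)
  case (one a b)
  then show ?case using integrable_trig_mult[of b g] by (simp add: mult.assoc)
qed (simp add: distrib_right)

lemma sep_smooth: "sep h \<Longrightarrow> smooth (\<lambda>x. h x y)"
proof (induction rule: sep.induct)
  case (one a b)
  then show ?case by (intro smooth_mult trig_smooth smooth_const)
next
  case (plus g h)
  then show ?case by (intro smooth_add)
qed

lemma sep_frechet: "sep h \<Longrightarrow> sep (\<lambda>x y. frechet_derivative (\<lambda>x. h x y) (at x) v)"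
proof (induction rule: sep.induct)
  case (one a b)
  have "((\<lambda>x. a x * b y) has_derivative (\<lambda>v. frechet_derivative a (at x) v * b y)) (at x)" for x y
    by (intro has_derivative_mult_left smooth_has_derivative trig_smooth one)
  from frechet_derivative_at[OF this, symmetric] show ?case
    by simp (intro sep.one trig_frechet one)
next
  case (plus g h)
  have "((\<lambda>x. g x y + h x y) has_derivative (\<lambda>v. frechet_derivative (\<lambda>x. g x y) (at x) v + frechet_derivative (\<lambda>x. h x y) (at x) v)) (at x)" for x y
    by (intro has_derivative_add smooth_has_derivative sep_smooth plus)
  from frechet_derivative_at[OF this, symmetric] show ?case
    by simp (intro sep.plus plus)
qed

text \<open>For a single product \<open>a x * b y\<close> the integral is \<open>a x\<close> times a
  number, so differentiation under the integral sign is mere linearity and requires no domination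
  argument.\<close>

lemma sep_integral:
  assumes "sep h" and g: "integrable tor g"
  shows "trig (\<lambda>x. \<integral>y. h x y * g y \<partial>tor)" (is ?T)
    and "((\<lambda>x. \<integral>y. h x y * g y \<partial>tor) has_derivative
      (\<lambda>v. \<integral>y. frechet_derivative (\<lambda>x. h x y) (at x) v * g y \<partial>tor)) (at x)" (is ?D)
proof -
  have "?T \<and> ?D" using assms(1)
  proof (induction rule: sep.induct)
    case (one a b)
    have i: "integrable tor (\<lambda>y. b y * g y)" using one g by (intro integrable_trig_mult)
    have e: "(\<integral>y. c * b y * g y \<partial>tor) = c * (\<integral>y. b y * g y \<partial>tor)" for c
      using i by (simp add: mult.assoc)
    have d: "((\<lambda>x. a x * c) has_derivative (\<lambda>v. frechet_derivative a (at x) v * c)) (at x)" for c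
      by (intro has_derivative_mult_left smooth_has_derivative trig_smooth one)
    show ?case unfolding frechet_derivative_at[OF d, symmetric] e
      by (intro conjI d trig.mult trig.const one)
  next
    case (plus h1 h2)
    have d: "((\<lambda>x. h1 x y + h2 x y) has_derivative (\<lambda>v. frechet_derivative (\<lambda>x. h1 x y) (at x) v + frechet_derivative (\<lambda>x. h2 x y) (at x) v)) (at x)" for x y
      by (intro has_derivative_add smooth_has_derivative sep_smooth plus)
    show ?case unfolding frechet_derivative_at[OF d, symmetric] distrib_right
      using plus integrable_sep_mult[OF plus.hyps(1) g] integrable_sep_mult[OF plus.hyps(2) g]
        integrable_sep_mult[OF sep_frechet[OF plus.hyps(1)] g] integrable_sep_mult[OF sep_frechet[OF plus.hyps(2)] g]
      by (auto intro!: trig.add has_derivative_add)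
  qed
  then show ?T ?D by auto
qed

section \<open>Convolution with trigonometric polynomials\<close>

lemma frechet_translate:
  assumes "smooth k"
  shows "frechet_derivative (\<lambda>x. k (x - y)) (at x) = frechet_derivative k (at (x - y))"
proof -
  have "((\<lambda>x. k (x - y)) has_derivative frechet_derivative k (at (x - y))) (at x)"
    by (rule has_derivative_compose[OF _ smooth_has_derivative[OF assms], of "\<lambda>x. x - y" "\<lambda>v. v" x UNIV])
       (auto intro!: derivative_eq_intros)
  then show ?thesis by (rule frechet_derivative_at[symmetric])
qed

lemma frechet_reflect:
  assumes "smooth k"
  shows "frechet_derivative (\<lambda>y. k (x - y)) (at y) v = - frechet_derivative k (at (x - y)) v"
proof -
  have d: "((\<lambda>y. k (x - y)) has_derivative (\<lambda>v. frechet_derivative k (at (x - y)) (- v))) (at y)"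
    by (rule has_derivative_compose[OF _ smooth_has_derivative[OF assms], of "\<lambda>y. x - y" "\<lambda>v. - v" y UNIV])
       (auto intro!: derivative_eq_intros)
  moreover have "frechet_derivative k (at (x - y)) (- v) = - frechet_derivative k (at (x - y)) v"
    by (rule linear_neg[OF linear_frechet_derivative[OF smooth_imp_differentiable[OF assms]]])
  ultimately show ?thesis by (simp only: frechet_derivative_at[OF d, symmetric])
qed

lemma conv_trig:
  assumes k: "trig k" and g: "integrable tor g"
  shows "trig (\<lambda>x. \<integral>y. k (x - y) * g y \<partial>tor)"
    and "((\<lambda>x. \<integral>y. k (x - y) * g y \<partial>tor) has_derivative
      (\<lambda>v. \<integral>y. frechet_derivative k (at (x - y)) v * g y \<partial>tor)) (at x)"
    and "integrable tor (\<lambda>y. k (x - y) * g y)"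
  using sep_integral[OF trig_sep[OF k] g] integrable_sep_mult[OF trig_sep[OF k] g]
  by (simp_all add: frechet_translate[OF trig_smooth[OF k]])

lemma integral_tor_trig_shift:
  assumes k: "trig k"
  shows "(\<integral>y. k (x - y) \<partial>tor) = (\<integral>y. k y \<partial>tor)"
proof -
  have r: "trig (\<lambda>y. k (- y))" by (rule trig_reflect[OF k])
  have "(\<integral>y. k (- (y + - x)) \<partial>tor) = (\<integral>y. k (- y) \<partial>tor)"
    by (rule integral_tor_shift(2)) (auto intro: trig_measurable trig_periodic r)
  also have "\<dots> = (\<integral>y. k y \<partial>tor)"
    by (rule integral_tor_uminus) (rule trig_measurable[OF k])
  finally show ?thesis by simp
qed

text \<open>Integration by parts on the torus. The convolution of \<open>k\<close> with the constant
  1 does not depend on the point, by translation invariance; its derivative is the integral in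
  question.\<close>

lemma integral_tor_frechet_trig:
  assumes k: "trig k"
  shows "(\<integral>y. frechet_derivative k (at y) v \<partial>tor) = 0"
proof -
  have "((\<lambda>x. \<integral>y. k (x - y) * 1 \<partial>tor) has_derivative
      (\<lambda>v. \<integral>y. frechet_derivative k (at (0 - y)) v * 1 \<partial>tor)) (at 0)"
    by (rule conv_trig[OF k]) simp
  moreover have "((\<lambda>x. \<integral>y. k (x - y) * 1 \<partial>tor) has_derivative (\<lambda>v. 0)) (at 0)"
    by (simp add: integral_tor_trig_shift[OF k])
  ultimately have "(\<lambda>v. \<integral>y. frechet_derivative k (at (0 - y)) v * 1 \<partial>tor) = (\<lambda>v. 0)"
    by (rule has_derivative_unique)
  then have "(\<integral>y. frechet_derivative k (at (0 - y)) v * 1 \<partial>tor) = 0"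
    by (rule fun_cong)
  then show ?thesis
    using integral_tor_trig_shift[OF trig_frechet[OF k], of 0 v] by simp
qed

subsection \<open>The kernels \<open>\<Prod>\<^sub>i ((1 + cos x\<^sub>i)/2)\<^sup>n\<close>\<close>

lemma frechet_directional:
  assumes "smooth f" "((\<lambda>s. f (x + s *\<^sub>R v)) has_real_derivative D) (at 0)"
  shows "frechet_derivative f (at x) v = D"
proof -
  have "((\<lambda>s. f (x + s *\<^sub>R v)) has_derivative (\<lambda>s. frechet_derivative f (at x) (s *\<^sub>R v))) (at 0)"
    by (rule has_derivative_compose[of "\<lambda>s. x + s *\<^sub>R v" "\<lambda>s. s *\<^sub>R v" 0 UNIV f "frechet_derivative f (at x)"])
      (use smooth_has_derivative[OF assms(1)] in \<open>auto intro!: derivative_eq_intros\<close>)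
  moreover have "((\<lambda>s. f (x + s *\<^sub>R v)) has_derivative (\<lambda>s. D * s)) (at 0)"
    using assms(2) unfolding has_field_derivative_def by simp
  ultimately have "(\<lambda>s. frechet_derivative f (at x) (s *\<^sub>R v)) = (\<lambda>s. D * s)"
    by (rule has_derivative_unique)
  from fun_cong[OF this, of 1] show ?thesis by simp
qed

text \<open>A product of de la Vallee-Poussin kernels without normalisation, since
  \<open>(1 + cos x) / 2\<close> is the square of \<open>cos (x / 2)\<close>. Each coordinate has
  its own exponent because differentiation along axis \<open>i\<close> lowers \<open>m i\<close>
  only.\<close>

definition kk :: "('d \<Rightarrow> nat) \<Rightarrow> real ^ 'd \<Rightarrow> real" where
  "kk m x = (\<Prod>j\<in>UNIV. ((1 + cos (x $ j)) / 2) ^ m j)"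

lemma trig_kk: "trig (kk m)"
proof -
  have *: "(1 + c) / 2 = 1 / 2 * (1 + c)" for c :: real by simp
  show ?thesis unfolding kk_def *
    by (intro trig_prod trig_power trig.mult trig.add trig.const trig.cos)
qed

lemma kk_nonneg: "kk m x \<ge> 0"
proof -
  have "0 \<le> 1 + cos (x $ j)" for j using cos_ge_minus_one[of "x $ j"] by linarith
  then show ?thesis unfolding kk_def by (intro prod_nonneg) auto
qed

lemma kk_even: "kk m (- x) = kk m x"
  by (simp add: kk_def)

lemma kk_split:
  "kk m (x + s *\<^sub>R axis i 1) = ((1 + cos (x $ i + s)) / 2) ^ m i * (\<Prod>j\<in>UNIV - {i}. ((1 + cos (x $ j)) / 2) ^ m j)"
proof -
  have "(\<Prod>j\<in>UNIV - {i}. ((1 + cos ((x + s *\<^sub>R axis i 1) $ j)) / 2) ^ m j) = (\<Prod>j\<in>UNIV - {i}. ((1 + cos (x $ j)) / 2) ^ m j)"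
    by (intro prod.cong) (auto simp: axis_def)
  then show ?thesis unfolding kk_def by (subst prod.remove[of _ i]) (auto simp: axis_def)
qed

text \<open>A source of identities: the integral of the left side over the torus is 0. The weight 1
  gives the gradient of the kernel, \<open>sin\<close> and \<open>sin * (1 - cos)\<close> give its
  first two moments.\<close>

lemma frechet_weighted_kk:
  assumes p: "(p has_real_derivative p') (at (x $ i))" and s: "smooth (\<lambda>x. p (x $ i) * kk m x)"
  shows "frechet_derivative (\<lambda>x. p (x $ i) * kk m x) (at x) (axis i 1) =
    p' * kk m x - real (m i) / 2 * p (x $ i) * sin (x $ i) * kk (m(i := m i - 1)) x"
proof (rule frechet_directional[OF s])
  define R where "R = (\<Prod>j\<in>UNIV - {i}. ((1 + cos (x $ j)) / 2) ^ m j)"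
  have R': "R = (\<Prod>j\<in>UNIV - {i}. ((1 + cos (x $ j)) / 2) ^ (m(i := m i - 1)) j)"
    unfolding R_def by (intro prod.cong) auto
  have k: "kk m (x + s *\<^sub>R axis i 1) = ((1 + cos (x $ i + s)) / 2) ^ m i * R" for s
    unfolding R_def by (rule kk_split)
  have k0: "kk m x = ((1 + cos (x $ i)) / 2) ^ m i * R" using k[of 0] by simp
  have k1: "kk (m(i := m i - 1)) x = ((1 + cos (x $ i)) / 2) ^ (m i - 1) * R"
    using kk_split[of "m(i := m i - 1)" x 0 i, folded R'] by simp
  have "((\<lambda>s. x $ i + s) has_real_derivative 1) (at 0)" by (auto intro!: derivative_eq_intros)
  then have p0: "((\<lambda>s. p (x $ i + s)) has_real_derivative p') (at 0)"
    using DERIV_chain2[of p p' "\<lambda>s. x $ i + s" 0 1 UNIV] p by simp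
  have "((\<lambda>s. p (x $ i + s) * (((1 + cos (x $ i + s)) / 2) ^ m i * R)) has_real_derivative
     p' * kk m x - real (m i) / 2 * p (x $ i) * sin (x $ i) * kk (m(i := m i - 1)) x) (at 0)"
    unfolding k0 k1 by (rule derivative_eq_intros p0 refl | simp)+
  then show "((\<lambda>s. p ((x + s *\<^sub>R axis i 1) $ i) * kk m (x + s *\<^sub>R axis i 1)) has_real_derivative
     p' * kk m x - real (m i) / 2 * p (x $ i) * sin (x $ i) * kk (m(i := m i - 1)) x) (at 0)"
    unfolding k by (simp add: axis_def)
qed

lemma frechet_kk:
  "frechet_derivative (kk m) (at x) (axis i 1) = - (real (m i) / 2 * sin (x $ i) * kk (m(i := m i - 1)) x)"
  using frechet_weighted_kk[of "\<lambda>y. 1" 0 x i m] trig_smooth[OF trig_kk[of m]] by simp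

lemma kk_pred:
  "m i \<ge> 1 \<Longrightarrow> (1 + cos (x $ i)) / 2 * kk (m(i := m i - 1)) x = kk m x" (is "_ \<Longrightarrow> ?thesis")
proof -
  assume "m i \<ge> 1"
  moreover have "(\<Prod>j\<in>UNIV - {i}. ((1 + cos (x $ j)) / 2) ^ (m(i := m i - 1)) j) =
      (\<Prod>j\<in>UNIV - {i}. ((1 + cos (x $ j)) / 2) ^ m j)"
    by (intro prod.cong) auto
  ultimately show ?thesis
    using kk_split[of m x 0 i] kk_split[of "m(i := m i - 1)" x 0 i]
    by (simp add: power_eq_if)
qed

text \<open>The square of the sine is \<open>(1 - cos) * (1 + cos)\<close>, and the second factor
  restores the power that differentiation removed.\<close>

lemma sin_sq_kk:
  "real (m i) / 2 * (sin (x $ i) * sin (x $ i)) * kk (m(i := m i - 1)) x = real (m i) * (1 - cos (x $ i)) * kk m x"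
proof (cases "m i = 0")
  case False
  have "sin (x $ i) * sin (x $ i) = (1 - cos (x $ i)) * (1 + cos (x $ i))"
    using sin_cos_squared_add[of "x $ i"] by (simp add: power2_eq_square algebra_simps)
  then show ?thesis using kk_pred[of m i x] False by (simp flip: mult.assoc)
qed simp

section \<open>Moments of the kernel in one coordinate\<close>

lemma integrable_trig: "trig f \<Longrightarrow> integrable tor f"
  using integrable_trig_mult[of f "\<lambda>x. 1"] by simp

lemma trig_diff: "trig f \<Longrightarrow> trig g \<Longrightarrow> trig (\<lambda>x. f x - g x)"
  using trig.add[OF _ trig_uminus] by force

text \<open>The derivative of \<open>sin (x $ i) * kk m x\<close> has integral 0; by
  \<open>sin_sq_kk\<close> it equals \<open>kk m x\<close> minus \<open>m i + 1\<close> times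
  \<open>(1 - cos (x $ i)) * kk m x\<close>.\<close>

lemma kk_moment1:
  "real (m i + 1) * (\<integral>x. (1 - cos (x $ i)) * kk m x \<partial>tor) = (\<integral>x. kk m x \<partial>tor)"
proof -
  have t: "trig (\<lambda>x. sin (x $ i) * kk m x)" by (intro trig.mult trig.sin trig_kk)
  have i: "integrable tor (\<lambda>x. (1 - cos (x $ i)) * kk m x)" "integrable tor (kk m)"
    by (intro integrable_trig trig.mult trig_diff trig.const trig.cos trig_kk)+
  have "frechet_derivative (\<lambda>x. sin (x $ i) * kk m x) (at x) (axis i 1) =
      kk m x - real (m i + 1) * ((1 - cos (x $ i)) * kk m x)" for x
    using frechet_weighted_kk[OF DERIV_sin trig_smooth[OF t], of x] sin_sq_kk[of m i x]
    by (simp add: algebra_simps)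
  then have "(\<integral>x. kk m x - real (m i + 1) * ((1 - cos (x $ i)) * kk m x) \<partial>tor) = 0"
    using integral_tor_frechet_trig[OF t, of "axis i 1"] by simp
  then show ?thesis using i by simp
qed

text \<open>The same argument with the weight \<open>sin * (1 - cos)\<close>, whose derivative is
  \<open>(1 - cos) * (1 + 2 * cos)\<close>. Bounding the last factor by 3 reduces the second moment
  to the first, and each step gains one factor \<open>1 / m i\<close>.\<close>

lemma kk_moment2:
  assumes "m i \<ge> 1"
  shows "(\<integral>x. (1 - cos (x $ i))\<^sup>2 * kk m x \<partial>tor) \<le> 3 / (real (m i))\<^sup>2 * (\<integral>x. kk m x \<partial>tor)"
proof -
  have t: "trig (\<lambda>x. (sin (x $ i) * (1 - cos (x $ i))) * kk m x)"
    by (intro trig.mult trig.sin trig_kk trig_diff trig.const trig.cos)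
  have i: "integrable tor (\<lambda>x. (1 - cos (x $ i)) * kk m x)" "integrable tor (\<lambda>x. (1 - cos (x $ i))\<^sup>2 * kk m x)"
     "integrable tor (\<lambda>x. (1 - cos (x $ i)) * (1 + 2 * cos (x $ i)) * kk m x)"
    by (intro integrable_trig trig.mult trig_power trig_diff trig.add trig.const trig.cos trig_kk)+
  have d: "((\<lambda>y. sin y * (1 - cos y)) has_real_derivative (1 - cos y) * (1 + 2 * cos y)) (at y)" for y
    using sin_cos_squared_add[of y]
    by (auto intro!: derivative_eq_intros simp: power2_eq_square algebra_simps)
  have "frechet_derivative (\<lambda>x. (sin (x $ i) * (1 - cos (x $ i))) * kk m x) (at x) (axis i 1) =
      (1 - cos (x $ i)) * (1 + 2 * cos (x $ i)) * kk m x - real (m i) * ((1 - cos (x $ i))\<^sup>2 * kk m x)" for x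
  proof -
    have "real (m i) / 2 * (sin (x $ i) * (1 - cos (x $ i))) * sin (x $ i) * kk (m(i := m i - 1)) x =
        (1 - cos (x $ i)) * (real (m i) / 2 * (sin (x $ i) * sin (x $ i)) * kk (m(i := m i - 1)) x)"
      by (simp only: ac_simps)
    also have "\<dots> = real (m i) * ((1 - cos (x $ i))\<^sup>2 * kk m x)"
      unfolding sin_sq_kk by (simp only: ac_simps power2_eq_square)
    finally show ?thesis
      by (intro trans[OF frechet_weighted_kk[OF d trig_smooth[OF t]]]) (simp only:)
  qed
  then have "(\<integral>x. (1 - cos (x $ i)) * (1 + 2 * cos (x $ i)) * kk m x - real (m i) * ((1 - cos (x $ i))\<^sup>2 * kk m x) \<partial>tor) = 0"
    using integral_tor_frechet_trig[OF t, of "axis i 1"] by simp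
  then have "real (m i) * (\<integral>x. (1 - cos (x $ i))\<^sup>2 * kk m x \<partial>tor) = (\<integral>x. (1 - cos (x $ i)) * (1 + 2 * cos (x $ i)) * kk m x \<partial>tor)"
    using i by simp
  also have "\<dots> \<le> (\<integral>x. 3 * ((1 - cos (x $ i)) * kk m x) \<partial>tor)"
  proof (rule integral_mono)
    show "(1 - cos (x $ i)) * (1 + 2 * cos (x $ i)) * kk m x \<le> 3 * ((1 - cos (x $ i)) * kk m x)" for x
    proof -
      have "(1 - cos (x $ i)) * kk m x * (1 + 2 * cos (x $ i)) \<le> (1 - cos (x $ i)) * kk m x * 3"
        by (intro mult_left_mono mult_nonneg_nonneg kk_nonneg) auto
      then show ?thesis by (simp add: ac_simps)
    qed
  qed (use i in auto)
  also have "\<dots> = 3 / real (m i + 1) * (\<integral>x. kk m x \<partial>tor)"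
    unfolding kk_moment1[of m i, symmetric] by simp
  also have "\<dots> \<le> 3 / real (m i) * (\<integral>x. kk m x \<partial>tor)"
    using assms by (intro mult_right_mono integral_nonneg_AE) (auto simp: kk_nonneg field_simps)
  finally show ?thesis using assms by (simp add: field_simps power2_eq_square)
qed

text \<open>The gradient of the kernel carries a lowered exponent but is normalised by the original
  one. With respect to the lowered kernel, \<open>(1 + cos) / 2\<close> has mean
  \<open>1 - 1 / (2 * m i)\<close>, which is at least one half.\<close>

lemma kk_integral_pred:
  assumes "m i \<ge> 1"
  shows "(\<integral>x. kk (m(i := m i - 1)) x \<partial>tor) \<le> 2 * (\<integral>x. kk m x \<partial>tor)"
proof -
  let ?m = "m(i := m i - 1)"
  define L where "L = (\<integral>x. kk ?m x \<partial>tor)"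
  have L: "L \<ge> 0" unfolding L_def by (intro integral_nonneg_AE) (auto simp: kk_nonneg)
  have "(\<integral>x. kk m x \<partial>tor) = (\<integral>x. kk ?m x - 1 / 2 * ((1 - cos (x $ i)) * kk ?m x) \<partial>tor)"
    unfolding kk_pred[where m=m and i=i, OF assms, symmetric] by (intro Bochner_Integration.integral_cong) (auto simp: field_simps)
  also have "\<dots> = L - 1 / 2 * (\<integral>x. (1 - cos (x $ i)) * kk ?m x \<partial>tor)"
    unfolding L_def
    by (subst Bochner_Integration.integral_diff)
       (auto intro!: integrable_trig trig.mult trig_diff trig.const trig.cos trig_kk
          simp del: times_divide_eq_right times_divide_eq_left mult_1_left One_nat_def)
  also have "(\<integral>x. (1 - cos (x $ i)) * kk ?m x \<partial>tor) = L / real (m i)"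
    using kk_moment1[of ?m i] assms unfolding L_def by (simp add: field_simps)
  finally have "(\<integral>x. kk m x \<partial>tor) = L - 1 / 2 * (L / real (m i))" .
  moreover have "L / real (m i) \<le> L" using assms L mult_left_mono[of 1 "real (m i)" L] by (simp add: field_simps)
  ultimately show ?thesis unfolding L_def by linarith
qed

lemma kk_integral_pos: "(\<integral>x. kk m x \<partial>tor) > 0"
proof (rule ccontr)
  assume "\<not> ?thesis"
  moreover have "(\<integral>x. kk m x \<partial>tor) \<ge> 0" by (intro integral_nonneg_AE) (auto simp: kk_nonneg)
  ultimately have "(\<integral>x. kk m x \<partial>tor) = 0" by linarith
  then have ae: "AE x in tor. kk m x = 0"
    by (subst (asm) integral_nonneg_eq_0_iff_AE) (auto intro!: integrable_trig trig_kk simp: kk_nonneg)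
  \<comment> \<open>In the cell the kernel can vanish only where some coordinate is
    \<open>pi\<close> or \<open>- pi\<close>, a null set. If it vanished almost everywhere, the cell
    itself would be null.\<close>
  have "AE x in (lborel :: (real ^ 'a) measure). \<forall>i\<in>UNIV. x $ i \<noteq> pi \<and> x $ i \<noteq> - pi"
    by (rule AE_finite_allI) (auto intro: AE_lborel_coord)
  then have "AE x in tor. \<forall>i\<in>UNIV. (x :: real ^ 'a) $ i \<noteq> pi \<and> x $ i \<noteq> - pi"
    unfolding AE_tor by eventually_elim auto
  with ae AE_tor_cell have "AE x in (tor :: (real ^ 'a) measure). False"
  proof eventually_elim
    case (elim x)
    then obtain i where i: "m i > 0" "(1 + cos (x $ i)) / 2 = 0" unfolding kk_def by (auto simp: prod_zero_iff)
    have b: "- pi < x $ i" "x $ i < pi" using elim unfolding torus_cell_iff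
      by (metis UNIV_I abs_le_D1 abs_le_D2 linorder_not_less minus_le_iff order_le_less)+
    have "cos (x $ i) > cos pi"
    proof -
      have "cos \<bar>x $ i\<bar> > cos pi" by (rule cos_monotone_0_pi) (use b in auto)
      then show ?thesis by simp
    qed
    then show ?case using i by simp
  qed
  then have "emeasure (tor :: (real ^ 'a) measure) UNIV = 0"
    using emeasure_eq_0_AE[of "\<lambda>x. True" "tor :: (real ^ 'a) measure"] by simp
  then show False using zero_less_power[of "2 * pi" "CARD('a)"] pi_gt_zero
    unfolding emeasure_tor ennreal_eq_0_iff by linarith
qed

text \<open>Concavity of the sine gives Jordan's inequality: \<open>sin y\<close> is at least
  \<open>y / (pi / 2)\<close> up to \<open>pi / 2\<close>. The claim is its square at
  \<open>y = \<bar>x\<bar> / 2\<close>, because \<open>1 - cos x\<close> is twice the squared sine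
  of \<open>x / 2\<close>.\<close>

lemma one_minus_cos_lower:
  assumes "\<bar>x\<bar> \<le> pi"
  shows "x\<^sup>2 \<le> pi\<^sup>2 / 2 * (1 - cos x)"
proof -
  define y where "y = \<bar>x\<bar> / 2"
  define t where "t = y / (pi / 2)"
  have y: "0 \<le> y" "y \<le> pi / 2" and t: "0 \<le> t" "t \<le> 1" and ty: "y = t * (pi / 2)"
    using assms by (auto simp: y_def t_def field_simps)
  have "concave_on {0..pi} sin"
    by (rule f''_le0_imp_concave[where f' = cos and f'' = "\<lambda>x. - sin x"])
       (auto intro!: derivative_eq_intros sin_ge_zero)
  then have "(1 - t) * sin 0 + t * sin (pi / 2) \<le> sin ((1 - t) *\<^sub>R 0 + t *\<^sub>R (pi / 2))"
    by (rule concave_onD) (use t in auto)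
  then have "t \<le> sin y" unfolding ty by simp
  then have "t\<^sup>2 \<le> (sin y)\<^sup>2" using t by (intro power_mono)
  also have "2 * (sin y)\<^sup>2 = 1 - cos x"
    using cos_double_sin[of y] by (simp add: y_def)
  finally have "2 * t\<^sup>2 \<le> 1 - cos x" by simp
  then have "pi\<^sup>2 / 2 * (2 * t\<^sup>2) \<le> pi\<^sup>2 / 2 * (1 - cos x)"
    by (intro mult_left_mono) auto
  then show ?thesis by (simp add: t_def y_def power_divide)
qed

text \<open>The dimension comes from the Cauchy-Schwarz inequality over the coordinates, the squared
  factor from \<open>one_minus_cos_lower\<close>. Fourth powers of the norm are thus within reach of
  \<open>kk_moment2\<close>.\<close>

lemma norm_pow4_le:
  fixes x :: "real ^ 'd"
  assumes "x \<in> torus_cell"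
  shows "norm x ^ 4 \<le> real CARD('d) * (pi\<^sup>2 / 2)\<^sup>2 * (\<Sum>j\<in>UNIV. (1 - cos (x $ j))\<^sup>2)"
proof -
  have "norm x ^ 4 = ((norm x)\<^sup>2)\<^sup>2" by simp
  also have "(norm x)\<^sup>2 = (\<Sum>j\<in>UNIV. (x $ j)\<^sup>2)"
    unfolding norm_vec_def L2_set_def by (simp add: sum_nonneg)
  also have "(\<Sum>j\<in>UNIV. (x $ j)\<^sup>2)\<^sup>2 \<le> (\<Sum>j\<in>UNIV. ((x $ j)\<^sup>2)\<^sup>2) * real CARD('d)"
    using sum_squared_le_sum_of_squares[of "\<lambda>j. (x $ j)\<^sup>2" UNIV] by (simp add: mult.commute)
  also have "\<dots> \<le> (\<Sum>j\<in>UNIV. (pi\<^sup>2 / 2 * (1 - cos (x $ j)))\<^sup>2) * real CARD('d)"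
    using assms one_minus_cos_lower unfolding torus_cell_iff
    by (intro mult_right_mono sum_mono power_mono) auto
  also have "(\<Sum>j\<in>UNIV. (pi\<^sup>2 / 2 * (1 - cos (x $ j)))\<^sup>2) = (pi\<^sup>2 / 2)\<^sup>2 * (\<Sum>j\<in>UNIV. (1 - cos (x $ j))\<^sup>2)"
    unfolding power_mult_distrib by (rule sum_distrib_left[symmetric])
  finally show ?thesis by (simp only: mult_ac)
qed

text \<open>Makes the fourth moment sufficient for all smaller ones: up to distance \<open>e\<close>
  the power is at most \<open>e powr s\<close>, and beyond it \<open>r / e\<close> exceeds 1, so
  raising the exponent to 4 only increases it.\<close>

lemma powr_le_pow4:
  fixes r e s :: real
  assumes "r \<ge> 0" "e > 0" "0 \<le> s" "s \<le> 4"
  shows "r powr s \<le> e powr s * (1 + r ^ 4 / e ^ 4)"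
proof (cases "r \<le> e")
  case True
  then have "r powr s \<le> e powr s" using assms by (intro powr_mono2) auto
  also have "\<dots> \<le> e powr s * (1 + r ^ 4 / e ^ 4)"
    using assms mult_left_mono[of 1 "1 + r ^ 4 / e ^ 4" "e powr s"] by simp
  finally show ?thesis .
next
  case False
  then have re: "r / e \<ge> 1" using assms by simp
  have "(r / e) powr s \<le> (r / e) powr 4" using re assms by (intro powr_mono) auto
  also have "\<dots> = (r / e) ^ 4" using powr_realpow[of "r / e" 4] re by simp
  finally have "(r / e) powr s \<le> 1 + r ^ 4 / e ^ 4" by (simp add: power_divide)
  then have "e powr s * (r / e) powr s \<le> e powr s * (1 + r ^ 4 / e ^ 4)"
    by (intro mult_left_mono) auto
  then show ?thesis using assms by (simp add: powr_divide)
qed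

text \<open>The summand 1 stems from \<open>powr_le_pow4\<close>. In the other one, 12 is the 3 of
  \<open>kk_moment2\<close> with \<open>m j\<close> replaced by \<open>n / 2\<close>, the first
  dimension counts the coordinates, and the bracket is the constant of
  \<open>norm_pow4_le\<close>.\<close>

definition kk_const :: "'d itself \<Rightarrow> real" where
  "kk_const _ = 1 + 12 * real CARD('d) * (real CARD('d) * (pi\<^sup>2 / 2)\<^sup>2)"

text \<open>Requiring only \<open>real n \<le> 2 * real (m j)\<close> covers both the kernel, with
  all exponents \<open>n\<close>, and its gradient, where one exponent is \<open>n - 1\<close>; for
  the latter \<open>n \<ge> 2\<close> is what makes the inequality true.\<close>

lemma kk_powr_moment:
  fixes m :: "'d::finite \<Rightarrow> nat"
  assumes n: "n \<ge> 1" "\<And>j. real n \<le> 2 * real (m j)" and s: "0 \<le> s" "s \<le> 4"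
    and e: "e = 1 / sqrt (real n)"
  shows "(\<integral>\<^sup>+x. ennreal (kk m x * norm x powr s) \<partial>tor) \<le> ennreal (kk_const TYPE('d) * e powr s * (\<integral>x. kk m x \<partial>tor))"
proof -
  have e0: "e > 0" and en: "1 / e ^ 4 = (real n)\<^sup>2"
    using n by (auto simp: e power_divide eval_nat_numeral)
  define c where "c = real CARD('d) * (pi\<^sup>2 / 2)\<^sup>2"
  define L where "L = (\<integral>x. kk m x \<partial>tor)"
  have L: "L > 0" unfolding L_def by (rule kk_integral_pos)
  define V where "V x = (\<Sum>j\<in>UNIV. (1 - cos (x $ j))\<^sup>2 * kk m x)" for x :: "real ^ 'd"
  have t: "trig (\<lambda>x :: real ^ 'd. (1 - cos (x $ j))\<^sup>2 * kk m x)" for j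
    by (intro trig.mult trig_power trig_diff trig.const trig.cos trig_kk)
  have tV: "trig V" unfolding V_def by (intro trig_sum t)
  have V0: "V x \<ge> 0" for x unfolding V_def by (intro sum_nonneg mult_nonneg_nonneg kk_nonneg) auto
  have "(\<integral>x. V x \<partial>tor) = (\<Sum>j\<in>UNIV. \<integral>x. (1 - cos (x $ j))\<^sup>2 * kk m x \<partial>tor)"
    unfolding V_def by (intro Bochner_Integration.integral_sum integrable_trig t)
  also have "\<dots> \<le> (\<Sum>j\<in>(UNIV :: 'd set). 12 / (real n)\<^sup>2 * L)"
  proof (rule sum_mono)
    fix j :: 'd
    have mj: "real (m j) \<ge> real n / 2" "m j \<ge> 1" using n(1) n(2)[of j] by auto
    have "(\<integral>x. (1 - cos (x $ j))\<^sup>2 * kk m x \<partial>tor) \<le> 3 / (real (m j))\<^sup>2 * L"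
      unfolding L_def by (rule kk_moment2[where m=m and i=j, OF mj(2)])
    also have "\<dots> \<le> 3 / (real n / 2)\<^sup>2 * L"
      using mj n L by (intro mult_right_mono divide_left_mono power_mono) auto
    finally show "(\<integral>x. (1 - cos (x $ j))\<^sup>2 * kk m x \<partial>tor) \<le> 12 / (real n)\<^sup>2 * L"
      by (simp add: power_divide)
  qed
  finally have IV: "(\<integral>x. V x \<partial>tor) \<le> real CARD('d) * 12 / (real n)\<^sup>2 * L" by simp
  have c0: "c \<ge> 0" unfolding c_def by simp
  have "(\<integral>\<^sup>+x. ennreal (kk m x * norm x powr s) \<partial>tor) \<le> (\<integral>\<^sup>+x. ennreal (e powr s * (kk m x + c * (real n)\<^sup>2 * V x)) \<partial>tor)"
  proof (rule nn_integral_mono_AE)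
    show "AE x in (tor :: (real ^ 'd) measure). ennreal (kk m x * norm x powr s) \<le> ennreal (e powr s * (kk m x + c * (real n)\<^sup>2 * V x))"
      using AE_tor_cell
    proof eventually_elim
      case (elim x)
      have "norm x powr s \<le> e powr s * (1 + norm x ^ 4 * (1 / e ^ 4))"
        using powr_le_pow4[of "norm x" e s] e0 s by simp
      also have "\<dots> \<le> e powr s * (1 + c * (\<Sum>j\<in>UNIV. (1 - cos (x $ j))\<^sup>2) * (1 / e ^ 4))"
        using norm_pow4_le[OF elim] unfolding c_def by (intro mult_left_mono add_left_mono mult_right_mono) auto
      finally have "kk m x * norm x powr s \<le> kk m x * (e powr s * (1 + c * (\<Sum>j\<in>UNIV. (1 - cos (x $ j))\<^sup>2) * (1 / e ^ 4)))"
        by (rule mult_left_mono[OF _ kk_nonneg])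
      also have "\<dots> = e powr s * (kk m x + c * (real n)\<^sup>2 * V x)"
        unfolding en V_def by (simp add: algebra_simps sum_distrib_left sum_distrib_right)
      finally show ?case by (rule ennreal_leI)
    qed
  qed
  also have "\<dots> = ennreal (\<integral>x. e powr s * (kk m x + c * (real n)\<^sup>2 * V x) \<partial>tor)"
    by (rule nn_integral_eq_integral)
       (use c0 V0 kk_nonneg tV in \<open>auto intro!: integrable_trig trig.mult trig.add trig.const trig_kk AE_I2 mult_nonneg_nonneg add_nonneg_nonneg\<close>)
  also have "(\<integral>x. e powr s * (kk m x + c * (real n)\<^sup>2 * V x) \<partial>tor) = e powr s * (L + c * (real n)\<^sup>2 * (\<integral>x. V x \<partial>tor))"
    unfolding L_def using integrable_trig[OF tV] integrable_trig[OF trig_kk[of m]] by simp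
  also have "\<dots> \<le> e powr s * (L + c * (real n)\<^sup>2 * (real CARD('d) * 12 / (real n)\<^sup>2 * L))"
    using IV c0 by (intro mult_left_mono add_left_mono) auto
  also have "\<dots> = kk_const TYPE('d) * e powr s * L"
    using n unfolding kk_const_def c_def by (simp add: field_simps)
  finally show ?thesis unfolding L_def by (simp add: ennreal_leI)
qed

text \<open>An approximate identity at scale \<open>e\<close>, with the moments that a smooth kernel supported in a ball of
  radius \<open>e\<close> would have.\<close>

locale mollifier =
  fixes e :: real and K :: "real ^ 'd \<Rightarrow> real"
  assumes e_pos: "e > 0" and trig_K: "trig K" and K_nonneg: "K x \<ge> 0" and K_even: "K (- x) = K x"
    and K_integral: "(\<integral>x. K x \<partial>tor) = 1"
    and K_moment: "0 \<le> s \<Longrightarrow> s \<le> 4 \<Longrightarrow> (\<integral>\<^sup>+x. ennreal (K x * norm x powr s) \<partial>tor) \<le> ennreal (kk_const TYPE('d) * e powr s)"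
    and K_frechet_moment: "0 \<le> s \<Longrightarrow> s \<le> 3 \<Longrightarrow>
      (\<integral>\<^sup>+x. ennreal (\<bar>frechet_derivative K (at x) (axis i 1)\<bar> * norm x powr s) \<partial>tor) \<le> ennreal (kk_const TYPE('d) * e powr (s - 1))"

text \<open>The scale is \<open>1 / sqrt n\<close> because \<open>((1 + cos x) / 2) ^ n\<close>
  concentrates at this distance from the origin. Differentiation costs a factor \<open>n\<close>,
  that is, two powers of \<open>1 / e\<close>, but also produces a sine, which gives one of them
  back.\<close>

lemma mollifier_exists:
  fixes n :: nat
  assumes n: "n \<ge> 2" and e: "e = 1 / sqrt (real n)"
  shows "\<exists>K :: real ^ 'd \<Rightarrow> real. mollifier e K"
proof -
  define m :: "'d \<Rightarrow> nat" where "m = (\<lambda>_. n)"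
  define J where "J = (\<integral>x. kk m x \<partial>tor)"
  have J: "J > 0" unfolding J_def by (rule kk_integral_pos)
  define K where "K x = 1 / J * kk m x" for x
  have e0: "e > 0" using n e by simp
  have en: "real n = e powr (- 2)"
    using n unfolding e by (simp add: powr_minus powr_divide powr_half_sqrt[symmetric] powr_powr)
  have K: "trig K" unfolding K_def by (intro trig.mult trig.const trig_kk)
  have fr: "frechet_derivative K (at x) (axis i 1) = - (1 / J * (real n / 2 * sin (x $ i) * kk (m(i := m i - 1)) x))" for x i
  proof -
    have "(K has_derivative (\<lambda>v. 1 / J * frechet_derivative (kk m) (at x) v)) (at x)"
      unfolding K_def by (intro has_derivative_mult_right smooth_has_derivative trig_smooth trig_kk)
    from frechet_derivative_at[OF this, symmetric] show ?thesis
      using frechet_kk[of m x i] by (simp add: m_def)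
  qed
  have C0: "kk_const TYPE('d) \<ge> 0" unfolding kk_const_def by simp
  have "mollifier e K"
  proof
    show "e > 0" by (rule e0)
    show "trig K" by (rule K)
    show "K x \<ge> 0" for x unfolding K_def using J kk_nonneg[of m x] by simp
    show "K (- x) = K x" for x unfolding K_def by (simp add: kk_even)
    show "(\<integral>x. K x \<partial>tor) = 1" unfolding K_def using J by (simp add: J_def)
    fix s :: real
    assume s0: "0 \<le> s"
    show "(\<integral>\<^sup>+x. ennreal (K x * norm x powr s) \<partial>tor) \<le> ennreal (kk_const TYPE('d) * e powr s)" if "s \<le> 4"
    proof -
      have [measurable]: "kk m \<in> borel_measurable borel" by (intro trig_measurable trig_kk)
      have "(\<integral>\<^sup>+x. ennreal (K x * norm x powr s) \<partial>tor) = (\<integral>\<^sup>+x. ennreal (1 / J) * ennreal (kk m x * norm x powr s) \<partial>tor)"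
        unfolding K_def using J by (intro nn_integral_cong) (simp add: ennreal_mult'[symmetric] mult_ac)
      also have "\<dots> = ennreal (1 / J) * (\<integral>\<^sup>+x. ennreal (kk m x * norm x powr s) \<partial>tor)"
        by (rule nn_integral_cmult) measurable
      also have "\<dots> \<le> ennreal (1 / J) * ennreal (kk_const TYPE('d) * e powr s * J)"
        unfolding J_def by (intro mult_left_mono kk_powr_moment[OF _ _ s0 that e]) (use n in \<open>auto simp: m_def\<close>)
      also have "\<dots> = ennreal (kk_const TYPE('d) * e powr s)"
        using J by (subst ennreal_mult'[symmetric]) auto
      finally show ?thesis .
    qed
    show "(\<integral>\<^sup>+x. ennreal (\<bar>frechet_derivative K (at x) (axis i 1)\<bar> * norm x powr s) \<partial>tor) \<le> ennreal (kk_const TYPE('d) * e powr (s - 1))"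
      if s3: "s \<le> 3" for i
    proof -
      let ?m = "m(i := m i - 1)"
      define c where "c = 1 / J * (real n / 2)"
      have c0: "c \<ge> 0" unfolding c_def using J by simp
      have [measurable]: "kk ?m \<in> borel_measurable borel" by (intro trig_measurable trig_kk)
      have "(\<integral>\<^sup>+x. ennreal (\<bar>frechet_derivative K (at x) (axis i 1)\<bar> * norm x powr s) \<partial>tor) \<le>
          (\<integral>\<^sup>+x. ennreal c * ennreal (kk ?m x * norm x powr (s + 1)) \<partial>tor)"
      proof (rule nn_integral_mono)
        fix x :: "real ^ 'd"
        \<comment> \<open>The sine raises the moment from \<open>s\<close> to \<open>s + 1\<close>.
          Since moments are available up to 4, this is why the gradient is handled only for
          \<open>s \<le> 3\<close>.\<close>
        have "\<bar>sin (x $ i)\<bar> \<le> norm x"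
          using abs_sin_x_le_abs_x[of "x $ i"] component_le_norm_cart[of x i] by linarith
        then have "c * kk ?m x * norm x powr s * \<bar>sin (x $ i)\<bar> \<le> c * kk ?m x * norm x powr s * norm x"
          using c0 kk_nonneg[of ?m x] by (intro mult_left_mono mult_nonneg_nonneg) auto
        also have "norm x powr s * norm x = norm x powr (s + 1)" by (simp add: powr_add)
        then have "c * kk ?m x * norm x powr s * norm x = c * (kk ?m x * norm x powr (s + 1))" by simp
        finally have "c * kk ?m x * norm x powr s * \<bar>sin (x $ i)\<bar> \<le> c * (kk ?m x * norm x powr (s + 1))" .
        moreover have "\<bar>frechet_derivative K (at x) (axis i 1)\<bar> * norm x powr s = c * kk ?m x * norm x powr s * \<bar>sin (x $ i)\<bar>"
          unfolding fr c_def using J kk_nonneg[of ?m x] by (simp add: abs_mult)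
        ultimately show "ennreal (\<bar>frechet_derivative K (at x) (axis i 1)\<bar> * norm x powr s) \<le> ennreal c * ennreal (kk ?m x * norm x powr (s + 1))"
          unfolding ennreal_mult'[OF c0, symmetric] by (intro ennreal_leI) (simp only:)
      qed
      also have "\<dots> = ennreal c * (\<integral>\<^sup>+x. ennreal (kk ?m x * norm x powr (s + 1)) \<partial>tor)"
        by (rule nn_integral_cmult) measurable
      also have "\<dots> \<le> ennreal c * ennreal (kk_const TYPE('d) * e powr (s + 1) * (\<integral>x. kk ?m x \<partial>tor))"
        using s0 s3 n by (intro mult_left_mono kk_powr_moment[OF _ _ _ _ e]) (auto simp: m_def)
      also have "\<dots> \<le> ennreal c * ennreal (kk_const TYPE('d) * e powr (s + 1) * (2 * J))"
        unfolding J_def using n C0 by (intro mult_left_mono ennreal_leI mult_nonneg_nonneg kk_integral_pred) (auto simp: m_def)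
      also have "\<dots> = ennreal (kk_const TYPE('d) * (real n * e powr (s + 1)))"
        using c0 J by (subst ennreal_mult'[symmetric]) (auto simp: c_def mult_ac)
      also have "real n * e powr (s + 1) = e powr (s - 1)"
        unfolding en by (simp add: powr_add[symmetric])
      finally show ?thesis .
    qed
  qed
  then show ?thesis by blast
qed

subsection \<open>Mollification at a fixed time\<close>

lemma frechet_eq_grad:
  fixes f :: "real ^ 'd \<Rightarrow> real"
  assumes "smooth f"
  shows "frechet_derivative f (at x) v = v \<bullet> grad f x"
proof -
  have l: "linear (frechet_derivative f (at x))"
    by (rule linear_frechet_derivative[OF smooth_imp_differentiable[OF assms]])
  have "frechet_derivative f (at x) (\<Sum>i\<in>UNIV. v $ i *\<^sub>R axis i 1) = (\<Sum>i\<in>UNIV. v $ i * frechet_derivative f (at x) (axis i 1))"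
    using l by (simp add: linear_sum linear_scale)
  moreover have "(\<Sum>i\<in>UNIV. v $ i *\<^sub>R axis i 1) = v"
    using basis_expansion[of v] by (simp add: scalar_mult_eq_scaleR)
  ultimately show ?thesis by (simp add: grad_def inner_vec_def)
qed

lemma continuous_on_grad: "smooth f \<Longrightarrow> continuous_on S (grad f)"
  unfolding grad_def by (intro continuous_on_vec_lambda smooth_imp_continuous_on smooth_frechet)

lemma grad_measurable: "smooth f \<Longrightarrow> grad f \<in> borel_measurable borel"
  by (intro borel_measurable_continuous_onI continuous_on_grad)

lemma smooth_measurable: "smooth f \<Longrightarrow> f \<in> borel_measurable borel"
  by (intro borel_measurable_continuous_onI smooth_imp_continuous_on)

lemma norm_torus_cell:
  fixes w :: "real ^ 'd"
  assumes "w \<in> torus_cell" shows "norm w \<le> real CARD('d) * pi"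
proof -
  have "norm w \<le> (\<Sum>i\<in>UNIV. \<bar>w $ i\<bar>)" by (rule norm_le_l1_cart)
  also have "\<dots> \<le> (\<Sum>i\<in>(UNIV :: 'd set). pi)" using assms by (intro sum_mono) (auto simp: torus_cell_iff)
  finally show ?thesis by simp
qed

text \<open>Turns the Lipschitz increment of a test function into a power \<open>a\<close>, to match
  the increments of the solution. The constant is at least 1 and bounds the norm on the cell, and a
  number in [0,1] is at most its power \<open>a\<close>.\<close>

lemma norm_le_powr_cell:
  fixes w :: "real ^ 'd"
  assumes "w \<in> torus_cell" "0 < a" "a < 1"
  shows "norm w \<le> real CARD('d) * pi * norm w powr a"
proof -
  define D where "D = real CARD('d) * pi"
  have "1 * 1 \<le> real CARD('d) * pi" using pi_ge_two by (intro mult_mono) (auto simp: Suc_leI)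
  then have D: "D \<ge> 1" "norm w \<le> D" using norm_torus_cell[OF assms(1)] by (auto simp: D_def)
  have t: "norm w / D \<le> (norm w / D) powr a"
  proof (cases "w = 0")
    case False
    then have "(norm w / D) powr 1 \<le> (norm w / D) powr a"
      using D assms by (intro powr_mono') auto
    then show ?thesis using D False by simp
  qed simp
  also have "\<dots> \<le> norm w powr a"
    using D assms mult_right_mono[of 1 D "norm w"] by (intro powr_mono2) (auto simp: field_simps)
  finally show ?thesis using D by (simp add: D_def field_simps)
qed

definition conv :: "(real ^ 'd \<Rightarrow> real) \<Rightarrow> (real ^ 'd \<Rightarrow> real) \<Rightarrow> real ^ 'd \<Rightarrow> real" where
  "conv K f x = (\<integral>y. K (x - y) * f y \<partial>tor)"

text \<open>The divergence of the mollified field \<open>V\<close>, with the derivative placed on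
  the kernel.\<close>

definition div_conv :: "(real ^ 'd \<Rightarrow> real) \<Rightarrow> (real ^ 'd \<Rightarrow> real ^ 'd) \<Rightarrow> real ^ 'd \<Rightarrow> real" where
  "div_conv K V x = (\<integral>y. V y \<bullet> grad K (x - y) \<partial>tor)"

context mollifier
begin

lemma smooth_K: "smooth K" by (rule trig_smooth[OF trig_K])

lemma K_measurable [measurable]: "K \<in> borel_measurable borel"
  by (rule smooth_measurable[OF smooth_K])

lemma grad_K_measurable [measurable]: "grad K \<in> borel_measurable borel"
  by (rule grad_measurable[OF smooth_K])

lemma grad_K_nth: "grad K x $ i = frechet_derivative K (at x) (axis i 1)"
  by (simp add: grad_def)

lemma trig_grad_K: "trig (\<lambda>x. grad K x $ i)"
  unfolding grad_K_nth by (rule trig_frechet[OF trig_K])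

lemma grad_K_odd: "grad K (- x) = - grad K x"
proof -
  have "(\<lambda>y. K (0 - y)) = K" using K_even by auto
  then have "frechet_derivative K (at x) (axis i 1) = - frechet_derivative K (at (- x)) (axis i 1)" for i
    using frechet_reflect[OF smooth_K, of 0 x "axis i 1"] by (simp only: diff_0)
  then have "grad K x $ i = - grad K (- x) $ i" for i unfolding grad_K_nth .
  then have "grad K x = - grad K (- x)" by (simp only: vec_eq_iff vector_uminus_component simp_thms)
  then show ?thesis by simp
qed

lemma grad_K_nth_measurable [measurable]: "(\<lambda>x. grad K x $ i) \<in> borel_measurable borel"
  by (rule trig_measurable[OF trig_grad_K])

lemma grad_K_bounded: obtains M where "M \<ge> 0" "\<And>x. norm (grad K x) \<le> M"
proof -
  have "\<forall>i. \<exists>B. \<forall>x. \<bar>grad K x $ i\<bar> \<le> B" using trig_bounded[OF trig_grad_K] by blast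
  then obtain B where B: "\<And>i x. \<bar>grad K x $ i\<bar> \<le> B i" by metis
  have "norm (grad K x) \<le> (\<Sum>i\<in>UNIV. B i)" for x
    by (rule order_trans[OF norm_le_l1_cart sum_mono]) (rule B)
  moreover have "(\<Sum>i\<in>UNIV. B i) \<ge> 0" by (rule sum_nonneg) (rule order_trans[OF abs_ge_zero B])
  ultimately show ?thesis using that by blast
qed

lemma grad_K_moment:
  assumes "0 \<le> s" "s \<le> 3"
  shows "(\<integral>\<^sup>+x. ennreal (norm (grad K x) * norm x powr s) \<partial>tor) \<le> ennreal (real CARD('d) * kk_const TYPE('d) * e powr (s - 1))"
proof -
  have C0: "kk_const TYPE('d) \<ge> 0" unfolding kk_const_def by simp
  have "(\<integral>\<^sup>+x. ennreal (norm (grad K x) * norm x powr s) \<partial>tor) \<le>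
      (\<integral>\<^sup>+x. (\<Sum>i\<in>UNIV. ennreal (\<bar>grad K x $ i\<bar> * norm x powr s)) \<partial>tor)"
  proof (rule nn_integral_mono)
    fix x :: "real ^ 'd"
    have "norm (grad K x) * norm x powr s \<le> (\<Sum>i\<in>UNIV. \<bar>grad K x $ i\<bar>) * norm x powr s"
      by (intro mult_right_mono norm_le_l1_cart) auto
    then show "ennreal (norm (grad K x) * norm x powr s) \<le> (\<Sum>i\<in>UNIV. ennreal (\<bar>grad K x $ i\<bar> * norm x powr s))"
      by (simp add: sum_ennreal sum_distrib_right ennreal_leI)
  qed
  also have "\<dots> = (\<Sum>i\<in>UNIV. \<integral>\<^sup>+x. ennreal (\<bar>grad K x $ i\<bar> * norm x powr s) \<partial>tor)"
    by (rule nn_integral_sum) measurable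
  also have "\<dots> \<le> (\<Sum>i\<in>(UNIV :: 'd set). ennreal (kk_const TYPE('d) * e powr (s - 1)))"
    unfolding grad_K_nth using assms by (intro sum_mono K_frechet_moment)
  also have "\<dots> = ennreal (real CARD('d) * kk_const TYPE('d) * e powr (s - 1))"
    using C0 by (simp add: ennreal_of_nat_eq_real_of_nat ennreal_mult'[symmetric] mult_ac)
  finally show ?thesis .
qed

lemma integrable_grad_K_inner:
  assumes "integrable tor V" shows "integrable tor (\<lambda>y. V y \<bullet> grad K (x - y))"
proof -
  obtain M where M: "M \<ge> 0" "\<And>x. norm (grad K x) \<le> M" using grad_K_bounded by blast
  have [measurable]: "V \<in> borel_measurable borel" using borel_measurable_integrable[OF assms] by simp
  show ?thesis
  proof (rule Bochner_Integration.integrable_bound[OF integrable_mult_left[OF integrable_norm[OF assms], of M]])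
    show "AE y in tor. norm (V y \<bullet> grad K (x - y)) \<le> norm (norm (V y) * M)"
    proof (rule AE_I2)
      fix y
      have "\<bar>V y \<bullet> grad K (x - y)\<bar> \<le> norm (V y) * norm (grad K (x - y))" by (rule Cauchy_Schwarz_ineq2)
      also have "\<dots> \<le> norm (V y) * M" using M by (intro mult_left_mono) auto
      finally show "norm (V y \<bullet> grad K (x - y)) \<le> norm (norm (V y) * M)" by simp
    qed
  qed measurable
qed

lemma trig_conv: "integrable tor f \<Longrightarrow> trig (conv K f)"
  unfolding conv_def by (rule conv_trig(1)[OF trig_K])

lemma grad_conv:
  assumes "integrable tor f"
  shows "V \<bullet> grad (conv K f) x = (\<integral>y. (V \<bullet> grad K (x - y)) * f y \<partial>tor)"
proof -
  have "frechet_derivative (conv K f) (at x) V = (\<integral>y. frechet_derivative K (at (x - y)) V * f y \<partial>tor)"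
    using fun_cong[OF frechet_derivative_at[OF conv_trig(2)[OF trig_K assms, of x]], of V]
    unfolding conv_def[abs_def] by simp
  then show ?thesis
    using frechet_eq_grad[OF trig_smooth[OF trig_conv[OF assms]]] frechet_eq_grad[OF smooth_K] by simp
qed

text \<open>The substitution \<open>y = x + z\<close> moves the translation from the kernel to
  \<open>f\<close>, so that differences of mollified values become averages of increments of
  \<open>f\<close>; evenness of \<open>K\<close> removes the sign.\<close>

lemma conv_shift:
  assumes [measurable]: "f \<in> borel_measurable borel" and p: "periodic f"
  shows "conv K f x = (\<integral>z. K z * f (x + z) \<partial>tor)"
proof -
  have "(\<integral>z. K (x - (z + x)) * f (z + x) \<partial>tor) = (\<integral>y. K (x - y) * f y \<partial>tor)"
  proof (rule integral_tor_shift(2))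
    have "K (x - (y + axis i (2 * pi))) = K (x - y)" for y i
    proof -
      have "K (x - (y + axis i (2 * pi))) = K ((y - x) + axis i (2 * pi))"
        using K_even[of "x - (y + axis i (2 * pi))"] by (simp add: algebra_simps)
      also have "\<dots> = K (y - x)" using trig_periodic[OF trig_K] by (simp add: periodic_def)
      also have "\<dots> = K (x - y)" using K_even[of "x - y"] by simp
      finally show ?thesis .
    qed
    then show "periodic (\<lambda>y. K (x - y) * f y)" using p by (simp add: periodic_def)
  qed measurable
  then show ?thesis unfolding conv_def by (simp add: K_even add.commute)
qed

lemma integrable_K_shift:
  assumes f: "integrable tor f" and p: "periodic f"
  shows "integrable tor (\<lambda>z. K z * f (x + z))"
proof -
  have "integrable tor (\<lambda>z. f (z + x))"
    using integral_tor_shift(1)[of f x] f p borel_measurable_integrable[OF f] by simp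
  then show ?thesis using integrable_trig_mult[OF trig_K, of "\<lambda>z. f (x + z)"] by (simp add: add.commute)
qed

text \<open>Mollification does not worsen increments, uniformly in \<open>e\<close>. The price is
  the averaging variable \<open>z\<close>, and it is for its sake that the hypothesis
  \<open>H3\<close> of \<open>slice\<close> allows a further shift.\<close>

lemma conv_increment:
  assumes f: "integrable tor f" and p: "periodic f"
  shows "ennreal \<bar>conv K f (x + w) - conv K f x\<bar> \<le> (\<integral>\<^sup>+z. ennreal (K z) * ennreal \<bar>f (x + w + z) - f (x + z)\<bar> \<partial>tor)"
proof -
  have m: "f \<in> borel_measurable borel" using borel_measurable_integrable[OF f] by simp
  have i: "integrable tor (\<lambda>z. K z * f (x + w + z))" "integrable tor (\<lambda>z. K z * f (x + z))"
    using integrable_K_shift[OF f p] by auto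
  have "conv K f (x + w) - conv K f x = (\<integral>z. K z * (f (x + w + z) - f (x + z)) \<partial>tor)"
    unfolding conv_shift[OF m p] right_diff_distrib using i by simp
  moreover have "ennreal (norm (\<integral>z. K z * (f (x + w + z) - f (x + z)) \<partial>tor)) \<le>
      (\<integral>\<^sup>+z. ennreal (norm (K z * (f (x + w + z) - f (x + z)))) \<partial>tor)"
    by (rule integral_norm_bound_ennreal) (use i in \<open>simp add: right_diff_distrib\<close>)
  ultimately show ?thesis by (simp add: abs_mult K_nonneg ennreal_mult')
qed

lemma conv_minus_self:
  assumes f: "integrable tor f" and p: "periodic f"
  shows "ennreal \<bar>conv K f x - f x\<bar> \<le> (\<integral>\<^sup>+z. ennreal (K z) * ennreal \<bar>f (x + z) - f x\<bar> \<partial>tor)"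
proof -
  have m: "f \<in> borel_measurable borel" using borel_measurable_integrable[OF f] by simp
  have i: "integrable tor (\<lambda>z. K z * f (x + z))" "integrable tor (\<lambda>z. K z * f x)"
    using integrable_K_shift[OF f p] integrable_trig[OF trig_K] by auto
  have "conv K f x - f x = (\<integral>z. K z * (f (x + z) - f x) \<partial>tor)"
    unfolding conv_shift[OF m p] right_diff_distrib using i K_integral by simp
  moreover have "ennreal (norm (\<integral>z. K z * (f (x + z) - f x) \<partial>tor)) \<le>
      (\<integral>\<^sup>+z. ennreal (norm (K z * (f (x + z) - f x))) \<partial>tor)"
    by (rule integral_norm_bound_ennreal) (use i in \<open>simp add: right_diff_distrib\<close>)
  ultimately show ?thesis by (simp add: abs_mult K_nonneg ennreal_mult')
qed

lemma K_mass: "(\<integral>\<^sup>+z. ennreal (K z) \<partial>tor) = 1"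
  using nn_integral_eq_integral[OF integrable_trig[OF trig_K]] K_nonneg K_integral by simp

end

text \<open>The data at a fixed time: \<open>f\<close> is the transported scalar, \<open>v\<close> the velocity, and \<open>G\<close> controls the
  increments of \<open>f\<close> and \<open>v\<close> in the integrated form in which they are needed.\<close>

locale slice =
  fixes f :: "real ^ 'd \<Rightarrow> real" and v :: "real ^ 'd \<Rightarrow> real ^ 'd" and a b G :: real
  assumes f_int: "integrable tor f" and v_int: "integrable tor v" and fv_int: "integrable tor (\<lambda>x. f x *\<^sub>R v x)"
    and f_per: "periodic f" and v_per: "periodic v"
    and a: "0 < a" "a < 1" and b: "0 < b" "b < 1" and G: "G \<ge> 0"
    and div_free: "smooth \<psi> \<Longrightarrow> periodic \<psi> \<Longrightarrow> (\<integral>x. v x \<bullet> grad \<psi> x \<partial>tor) = 0"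
    and H3: "w \<in> torus_cell \<Longrightarrow>
      (\<integral>\<^sup>+x. ennreal (norm (v (x + w) - v x) * \<bar>f (x + w) - f x\<bar>) * ennreal \<bar>f (x + w + z) - f (x + z)\<bar> \<partial>tor)
        \<le> ennreal (G * norm w powr (2 * a + b))"
    and H2: "w \<in> torus_cell \<Longrightarrow>
      (\<integral>\<^sup>+x. ennreal (norm (v (x + w) - v x) * \<bar>f (x + w) - f x\<bar>) \<partial>tor) \<le> ennreal (G * norm w powr (a + b))"
    and H1: "w \<in> torus_cell \<Longrightarrow>
      (\<integral>\<^sup>+x. ennreal (norm (v x)) * ennreal \<bar>f (x + w) - f x\<bar> \<partial>tor) \<le> ennreal (G * norm w powr a)"
    and H0: "w \<in> torus_cell \<Longrightarrow> (\<integral>\<^sup>+x. ennreal \<bar>f (x + w) - f x\<bar> \<partial>tor) \<le> ennreal (G * norm w powr a)"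
begin

lemma f_measurable [measurable]: "f \<in> borel_measurable borel"
  using borel_measurable_integrable[OF f_int] by simp

lemma v_measurable [measurable]: "v \<in> borel_measurable borel"
  using borel_measurable_integrable[OF v_int] by simp

end

interpretation tor_pair: pair_sigma_finite "tor :: (real ^ 'd) measure" "tor :: (real ^ 'e) measure"
  by standard

locale slice_mollifier = slice f v a b G + mollifier e K
  for f :: "real ^ 'd \<Rightarrow> real" and v a b G e and K :: "real ^ 'd \<Rightarrow> real"
begin

lemma smooth_conv_f: "smooth (conv K f)"
  by (rule trig_smooth[OF trig_conv[OF f_int]])

lemma conv_f_measurable [measurable]: "conv K f \<in> borel_measurable borel"
  by (rule smooth_measurable[OF smooth_conv_f])

text \<open>Measures the error of replacing \<open>f\<close> by its mollification. The weight
  \<open>h\<close> will be 1 for the time derivative of the test function and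
  \<open>norm (v x)\<close> for the transport term.\<close>

lemma weighted_conv_error:
  assumes m [measurable]: "h \<in> borel_measurable borel" and h: "\<And>x. h x \<ge> 0"
    and H: "\<And>w. w \<in> torus_cell \<Longrightarrow> (\<integral>\<^sup>+x. ennreal (h x) * ennreal \<bar>f (x + w) - f x\<bar> \<partial>tor) \<le> ennreal (G * norm w powr a)"
  shows "(\<integral>\<^sup>+x. ennreal (h x) * ennreal \<bar>conv K f x - f x\<bar> \<partial>tor) \<le> ennreal (G * (kk_const TYPE('d) * e powr a))"
proof -
  have "(\<integral>\<^sup>+x. ennreal (h x) * ennreal \<bar>conv K f x - f x\<bar> \<partial>tor) \<le>
      (\<integral>\<^sup>+x. ennreal (h x) * (\<integral>\<^sup>+z. ennreal (K z) * ennreal \<bar>f (x + z) - f x\<bar> \<partial>tor) \<partial>tor)"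
    by (intro nn_integral_mono mult_left_mono conv_minus_self f_int f_per) auto
  also have "\<dots> = (\<integral>\<^sup>+x. \<integral>\<^sup>+z. ennreal (h x) * (ennreal (K z) * ennreal \<bar>f (x + z) - f x\<bar>) \<partial>tor \<partial>tor)"
    by (intro nn_integral_cong nn_integral_cmult[symmetric]) measurable
  also have "\<dots> = (\<integral>\<^sup>+z. \<integral>\<^sup>+x. ennreal (h x) * (ennreal (K z) * ennreal \<bar>f (x + z) - f x\<bar>) \<partial>tor \<partial>tor)"
    by (rule tor_pair.Fubini'[symmetric]) measurable
  also have "\<dots> = (\<integral>\<^sup>+z. ennreal (K z) * (\<integral>\<^sup>+x. ennreal (h x) * ennreal \<bar>f (x + z) - f x\<bar> \<partial>tor) \<partial>tor)"
    by (intro nn_integral_cong, subst nn_integral_cmult[symmetric]) (measurable, simp add: mult_ac)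
  also have "\<dots> \<le> (\<integral>\<^sup>+z. ennreal G * ennreal (K z * norm z powr a) \<partial>tor)"
  proof (rule nn_integral_mono_AE)
    show "AE z in tor. ennreal (K z) * (\<integral>\<^sup>+x. ennreal (h x) * ennreal \<bar>f (x + z) - f x\<bar> \<partial>tor) \<le> ennreal G * ennreal (K z * norm z powr a)"
      using AE_tor_cell
    proof eventually_elim
      case (elim z)
      have "ennreal (K z) * (\<integral>\<^sup>+x. ennreal (h x) * ennreal \<bar>f (x + z) - f x\<bar> \<partial>tor) \<le> ennreal (K z) * ennreal (G * norm z powr a)"
        by (intro mult_left_mono H elim) auto
      also have "\<dots> = ennreal G * ennreal (K z * norm z powr a)"
        using K_nonneg G by (simp add: ennreal_mult'[symmetric] mult_ac)
      finally show ?case .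
    qed
  qed
  also have "\<dots> = ennreal G * (\<integral>\<^sup>+z. ennreal (K z * norm z powr a) \<partial>tor)"
    by (rule nn_integral_cmult) measurable
  also have "\<dots> \<le> ennreal G * ennreal (kk_const TYPE('d) * e powr a)"
    using a by (intro mult_left_mono K_moment) auto
  finally show ?thesis using G by (simp add: ennreal_mult')
qed

lemma grad_K_integral: "(\<integral>y. grad K (x - y) $ i \<partial>tor) = 0"
  using integral_tor_trig_shift[OF trig_grad_K] integral_tor_frechet_trig[OF trig_K] by (simp add: grad_K_nth)

lemma grad_K_const_integral: "(\<integral>y. V \<bullet> grad K (x - y) \<partial>tor) = 0"
proof -
  have "integrable tor (\<lambda>y. grad K (x - y) $ i)" for i
    using conv_trig(3)[OF trig_grad_K, of "\<lambda>y. 1" x i] by simp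
  then have "(\<integral>y. V \<bullet> grad K (x - y) \<partial>tor) = (\<Sum>i\<in>UNIV. V $ i * (\<integral>y. grad K (x - y) $ i \<partial>tor))"
    unfolding inner_vec_def by (subst Bochner_Integration.integral_sum) auto
  then show ?thesis by (simp add: grad_K_integral)
qed

lemma v_grad_K_integral: "(\<integral>y. v y \<bullet> grad K (x - y) \<partial>tor) = 0"
proof -
  have s: "smooth (\<lambda>y. K (y - x))" by (rule sep_smooth[OF trig_sep[OF trig_K]])
  have g: "grad (\<lambda>y. K (y - x)) y = - grad K (x - y)" for y
  proof -
    have "grad (\<lambda>y. K (y - x)) y = grad K (y - x)"
      by (simp add: grad_def frechet_translate[OF smooth_K])
    then show ?thesis using grad_K_odd[of "x - y"] by simp
  qed
  have "(\<integral>y. v y \<bullet> grad (\<lambda>y. K (y - x)) y \<partial>tor) = 0"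
    using periodic_shift[OF trig_periodic[OF trig_K], of "- x"] by (intro div_free s) simp
  then show ?thesis unfolding g by simp
qed

text \<open>Multiplying out the two increments gives four terms. The one with \<open>f x\<close> and
  \<open>v y\<close> vanishes because \<open>v\<close> is divergence-free, the one with
  \<open>f x\<close> and \<open>v x\<close> because \<open>grad K\<close> has mean zero, and the one
  with \<open>f y\<close> and \<open>v x\<close> is the transport term of
  \<open>conv K f\<close>.\<close>

lemma div_conv_eq:
  "div_conv K (\<lambda>y. f y *\<^sub>R v y) x =
    (\<integral>y. ((v y - v x) \<bullet> grad K (x - y)) * (f y - f x) \<partial>tor) + v x \<bullet> grad (conv K f) x"
proof -
  have i1: "integrable tor (\<lambda>y. (f y *\<^sub>R v y) \<bullet> grad K (x - y))" by (rule integrable_grad_K_inner[OF fv_int])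
  have i2: "integrable tor (\<lambda>y. v y \<bullet> grad K (x - y))" by (rule integrable_grad_K_inner[OF v_int])
  have i3: "integrable tor (\<lambda>y. (f y *\<^sub>R v x) \<bullet> grad K (x - y))"
    by (rule integrable_grad_K_inner) (use f_int in simp)
  have i4: "integrable tor (\<lambda>y. v x \<bullet> grad K (x - y))" by (rule integrable_grad_K_inner) simp
  have "(\<integral>y. ((v y - v x) \<bullet> grad K (x - y)) * (f y - f x) \<partial>tor) =
     (\<integral>y. ((f y *\<^sub>R v y) \<bullet> grad K (x - y) - (f y *\<^sub>R v x) \<bullet> grad K (x - y)) - (f x * (v y \<bullet> grad K (x - y)) - f x * (v x \<bullet> grad K (x - y))) \<partial>tor)"
    by (intro Bochner_Integration.integral_cong) (auto simp: inner_diff_left algebra_simps)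
  also have "\<dots> = (\<integral>y. (f y *\<^sub>R v y) \<bullet> grad K (x - y) \<partial>tor) - (\<integral>y. (f y *\<^sub>R v x) \<bullet> grad K (x - y) \<partial>tor)
      - (f x * (\<integral>y. v y \<bullet> grad K (x - y) \<partial>tor) - f x * (\<integral>y. v x \<bullet> grad K (x - y) \<partial>tor))"
    using i1 i2 i3 i4 by simp
  also have "\<dots> = div_conv K (\<lambda>y. f y *\<^sub>R v y) x - v x \<bullet> grad (conv K f) x"
    unfolding grad_conv[OF f_int] v_grad_K_integral grad_K_const_integral div_conv_def
    by (simp add: mult.commute)
  finally show ?thesis by simp
qed

end

subsection \<open>The commutator estimate\<close>

text \<open>Pairing \<open>x \<mapsto> g x\<close> with the commutator integral and exchanging \<open>x\<close> and \<open>y\<close> flips the sign of the odd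
  kernel \<open>\<nabla>K (x - y)\<close>; half the sum of the two forms carries the increment \<open>g x - g y\<close>, which
  yields the third factor needed for the exponent \<open>2 a + b - 1\<close>.\<close>

definition S_const :: "'d itself \<Rightarrow> real \<Rightarrow> real \<Rightarrow> real" where
  "S_const _ B \<xi> = B * \<bar>\<xi>\<bar> * (real CARD('d) * pi) + B * \<xi>\<^sup>2"

context slice_mollifier
begin

definition A :: "real ^ 'd \<Rightarrow> real ^ 'd \<Rightarrow> real" where
  "A x y = ((v y - v x) \<bullet> grad K (x - y)) * (f y - f x)"

text \<open>Both increments change sign under the exchange, which cancels, and the odd gradient of
  the even kernel leaves one minus sign.\<close>

lemma A_swap: "A y x = - A x y"
  using grad_K_odd[of "x - y"] unfolding A_def by (simp add: inner_diff_left algebra_simps)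

lemma A_measurable [measurable]: "(\<lambda>(x, y). A x y) \<in> borel_measurable (borel \<Otimes>\<^sub>M borel)"
  unfolding A_def by measurable

lemma A_measurable' [measurable (raw)]:
  "F \<in> measurable M borel \<Longrightarrow> F' \<in> measurable M borel \<Longrightarrow> (\<lambda>z. A (F z) (F' z)) \<in> borel_measurable M"
  using measurable_compose[OF measurable_Pair A_measurable, of F M F'] by simp

lemma A_le:
  "ennreal \<bar>A x (x + w)\<bar> \<le> ennreal (norm (grad K w)) * ennreal (norm (v (x + w) - v x) * \<bar>f (x + w) - f x\<bar>)"
proof -
  have "\<bar>A x (x + w)\<bar> \<le> norm (v (x + w) - v x) * norm (grad K (- w)) * \<bar>f (x + w) - f x\<bar>"
    unfolding A_def abs_mult using Cauchy_Schwarz_ineq2[of "v (x + w) - v x" "grad K (- w)"]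
    by (intro mult_right_mono) auto
  then show ?thesis
    by (subst ennreal_mult'[symmetric]) (auto simp: grad_K_odd mult_ac intro!: ennreal_leI)
qed

lemma periodic_grad_K: "periodic (\<lambda>y. grad K (x - y))"
proof -
  have "grad K (x - (y + axis i (2 * pi))) = grad K (x - y)" for y i
  proof -
    have "grad K (x - (y + axis i (2 * pi))) = - grad K ((y - x) + axis i (2 * pi))"
      using grad_K_odd[of "x - (y + axis i (2 * pi))"] by (simp add: algebra_simps)
    also have "\<dots> = - grad K (y - x)"
      using trig_periodic[OF trig_grad_K] by (simp add: periodic_def vec_eq_iff)
    also have "\<dots> = grad K (x - y)" using grad_K_odd[of "x - y"] by simp
    finally show ?thesis .
  qed
  then show ?thesis by (simp add: periodic_def)
qed

lemma A_periodic: "A x (y + axis i (2 * pi)) = A x y"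
  using periodic_grad_K[of x] v_per f_per unfolding A_def periodic_def by simp

lemma iterated_tor_shift:
  fixes \<Phi> :: "real ^ 'd \<Rightarrow> real ^ 'd \<Rightarrow> ennreal"
  assumes [measurable]: "(\<lambda>(x, y). \<Phi> x y) \<in> borel_measurable (borel \<Otimes>\<^sub>M borel)" and p: "\<And>x. periodic (\<Phi> x)"
  shows "(\<integral>\<^sup>+x. \<integral>\<^sup>+y. \<Phi> x y \<partial>tor \<partial>tor) = (\<integral>\<^sup>+w. \<integral>\<^sup>+x. \<Phi> x (x + w) \<partial>tor \<partial>tor)"
proof -
  have "(\<integral>\<^sup>+x. \<integral>\<^sup>+y. \<Phi> x y \<partial>tor \<partial>tor) = (\<integral>\<^sup>+x. \<integral>\<^sup>+w. \<Phi> x (w + x) \<partial>tor \<partial>tor)"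
    by (intro nn_integral_cong nn_integral_tor_shift[symmetric] p) measurable
  also have "\<dots> = (\<integral>\<^sup>+w. \<integral>\<^sup>+x. \<Phi> x (w + x) \<partial>tor \<partial>tor)"
    by (rule tor_pair.Fubini'[symmetric]) measurable
  finally show ?thesis by (simp add: add.commute)
qed

text \<open>In the variables \<open>x\<close> and \<open>w = y - x\<close> the kernel depends on
  \<open>w\<close> alone, so a bound by \<open>norm w powr s\<close> for each displacement is
  integrated against \<open>grad K\<close> and loses one power of \<open>e\<close>. The factor
  \<open>h\<close> is 1 for integrability and the increment of \<open>g\<close> for the estimate
  proper.\<close>

lemma iterated_A_bound:
  assumes hm [measurable]: "(\<lambda>(x, y). h x y) \<in> borel_measurable (borel \<Otimes>\<^sub>M borel)"
    and hp: "\<And>x y i. h x (y + axis i (2 * pi)) = h x y"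
    and C: "C \<ge> 0" and s: "0 \<le> s" "s \<le> 3"
    and H: "\<And>w. w \<in> torus_cell \<Longrightarrow> (\<integral>\<^sup>+x. h x (x + w) * ennreal (norm (v (x + w) - v x) * \<bar>f (x + w) - f x\<bar>) \<partial>tor)
      \<le> ennreal (C * norm w powr s)"
  shows "(\<integral>\<^sup>+x. \<integral>\<^sup>+y. h x y * ennreal \<bar>A x y\<bar> \<partial>tor \<partial>tor) \<le> ennreal (C * (real CARD('d) * kk_const TYPE('d) * e powr (s - 1)))"
proof -
  have "(\<integral>\<^sup>+x. \<integral>\<^sup>+y. h x y * ennreal \<bar>A x y\<bar> \<partial>tor \<partial>tor) = (\<integral>\<^sup>+w. \<integral>\<^sup>+x. h x (x + w) * ennreal \<bar>A x (x + w)\<bar> \<partial>tor \<partial>tor)"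
    by (rule iterated_tor_shift) (measurable, auto simp: periodic_def hp A_periodic)
  also have "\<dots> \<le> (\<integral>\<^sup>+w. ennreal C * ennreal (norm (grad K w) * norm w powr s) \<partial>tor)"
  proof (rule nn_integral_mono_AE)
    show "AE w in tor. (\<integral>\<^sup>+x. h x (x + w) * ennreal \<bar>A x (x + w)\<bar> \<partial>tor) \<le> ennreal C * ennreal (norm (grad K w) * norm w powr s)"
      using AE_tor_cell
    proof eventually_elim
      case (elim w)
      have "(\<integral>\<^sup>+x. h x (x + w) * ennreal \<bar>A x (x + w)\<bar> \<partial>tor) \<le>
          (\<integral>\<^sup>+x. ennreal (norm (grad K w)) * (h x (x + w) * ennreal (norm (v (x + w) - v x) * \<bar>f (x + w) - f x\<bar>)) \<partial>tor)"
      proof (rule nn_integral_mono)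
        fix x
        have "h x (x + w) * ennreal \<bar>A x (x + w)\<bar> \<le> h x (x + w) * (ennreal (norm (grad K w)) * ennreal (norm (v (x + w) - v x) * \<bar>f (x + w) - f x\<bar>))"
          by (intro mult_left_mono A_le) auto
        then show "h x (x + w) * ennreal \<bar>A x (x + w)\<bar> \<le> ennreal (norm (grad K w)) * (h x (x + w) * ennreal (norm (v (x + w) - v x) * \<bar>f (x + w) - f x\<bar>))"
          by (simp only: mult.left_commute)
      qed
      also have "\<dots> = ennreal (norm (grad K w)) * (\<integral>\<^sup>+x. h x (x + w) * ennreal (norm (v (x + w) - v x) * \<bar>f (x + w) - f x\<bar>) \<partial>tor)"
        by (rule nn_integral_cmult) measurable
      also have "\<dots> \<le> ennreal (norm (grad K w)) * ennreal (C * norm w powr s)"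
        by (intro mult_left_mono H elim) auto
      also have "\<dots> = ennreal C * ennreal (norm (grad K w) * norm w powr s)"
        using C by (simp add: ennreal_mult'[symmetric] mult_ac)
      finally show ?case .
    qed
  qed
  also have "\<dots> = ennreal C * (\<integral>\<^sup>+w. ennreal (norm (grad K w) * norm w powr s) \<partial>tor)"
    by (rule nn_integral_cmult) measurable
  also have "\<dots> \<le> ennreal C * ennreal (real CARD('d) * kk_const TYPE('d) * e powr (s - 1))"
    by (intro mult_left_mono grad_K_moment s) auto
  finally show ?thesis using C by (simp add: ennreal_mult')
qed

text \<open>Two increments suffice at a fixed scale. The bound may blow up as \<open>e\<close> tends
  to 0; it serves only to justify the exchange of integrals.\<close>

lemma A_integrable: "(\<integral>\<^sup>+x. \<integral>\<^sup>+y. ennreal \<bar>A x y\<bar> \<partial>tor \<partial>tor) < \<infinity>"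
proof -
  have "(\<integral>\<^sup>+x. \<integral>\<^sup>+y. 1 * ennreal \<bar>A x y\<bar> \<partial>tor \<partial>tor) \<le> ennreal (G * (real CARD('d) * kk_const TYPE('d) * e powr ((a + b) - 1)))"
    by (rule iterated_A_bound) (use a b G H2 in auto)
  then show ?thesis by (simp add: order_le_less_trans)
qed

context
  fixes \<phi> :: "real ^ 'd \<Rightarrow> real" and B \<xi> c :: real and g :: "real ^ 'd \<Rightarrow> real"
  assumes \<phi>: "smooth \<phi>" "periodic \<phi>" and B: "\<And>x. \<bar>\<phi> x\<bar> \<le> B" "\<And>x w. \<bar>\<phi> (x + w) - \<phi> x\<bar> \<le> B * norm w"
    and B': "\<And>x. norm (grad \<phi> x) \<le> B"
    and g: "g = (\<lambda>x. \<phi> x * (\<xi> * cos (\<xi> * conv K f x + c)))"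
begin

lemma B_nonneg: "B \<ge> 0"
  using B(1)[of 0] by linarith

lemma \<phi>_measurable [measurable]: "\<phi> \<in> borel_measurable borel"
  by (rule smooth_measurable[OF \<phi>(1)])

lemma g_measurable [measurable]: "g \<in> borel_measurable borel"
  unfolding g by measurable

lemma g_bounded: "\<bar>g x\<bar> \<le> B * \<bar>\<xi>\<bar>"
proof -
  have "\<bar>\<xi> * cos (\<xi> * conv K f x + c)\<bar> \<le> \<bar>\<xi>\<bar>" by (simp add: abs_mult mult_left_le)
  then show ?thesis unfolding g abs_mult[of "\<phi> x"] using B(1)[of x] B_nonneg by (intro mult_mono) auto
qed

lemma g_increment: "\<bar>g (x + w) - g x\<bar> \<le> B * \<bar>\<xi>\<bar> * norm w + B * \<xi>\<^sup>2 * \<bar>conv K f (x + w) - conv K f x\<bar>"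
proof -
  have cos_lip: "\<bar>cos s - cos t\<bar> \<le> \<bar>s - t\<bar>" for s t :: real
  proof -
    have "\<bar>cos s - cos t\<bar> = 2 * \<bar>sin ((s + t) / 2)\<bar> * \<bar>sin ((t - s) / 2)\<bar>"
      by (simp add: cos_diff_cos abs_mult)
    also have "\<dots> \<le> 2 * 1 * \<bar>(t - s) / 2\<bar>"
      by (intro mult_mono abs_sin_le_one abs_sin_x_le_abs_x) auto
    finally show ?thesis by simp
  qed
  define k where "k x = cos (\<xi> * conv K f x + c)" for x
  have "g (x + w) - g x = (\<phi> (x + w) - \<phi> x) * (\<xi> * k (x + w)) + \<phi> x * (\<xi> * (k (x + w) - k x))"
    unfolding g k_def by (simp add: algebra_simps)
  then have "\<bar>g (x + w) - g x\<bar> \<le> \<bar>\<phi> (x + w) - \<phi> x\<bar> * (\<bar>\<xi>\<bar> * \<bar>k (x + w)\<bar>) + \<bar>\<phi> x\<bar> * (\<bar>\<xi>\<bar> * \<bar>k (x + w) - k x\<bar>)"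
    by (metis abs_mult abs_triangle_ineq)
  also have "\<dots> \<le> (B * norm w) * (\<bar>\<xi>\<bar> * 1) + B * (\<bar>\<xi>\<bar> * (\<bar>\<xi>\<bar> * \<bar>conv K f (x + w) - conv K f x\<bar>))"
  proof -
    have "\<bar>k (x + w) - k x\<bar> \<le> \<bar>\<xi>\<bar> * \<bar>conv K f (x + w) - conv K f x\<bar>"
      unfolding k_def using cos_lip[of "\<xi> * conv K f (x + w) + c" "\<xi> * conv K f x + c"]
      by (simp add: abs_mult[symmetric] right_diff_distrib)
    moreover have "\<bar>k (x + w)\<bar> \<le> 1" by (simp add: k_def)
    ultimately show ?thesis using B B_nonneg by (intro add_mono mult_mono) auto
  qed
  finally show ?thesis by (simp add: power2_eq_square abs_mult_self_eq mult_ac flip: mult.assoc[of "\<bar>\<xi>\<bar>"])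
qed

lemma S_const_nonneg: "S_const TYPE('d) B \<xi> \<ge> 0"
  unfolding S_const_def using B_nonneg by simp

text \<open>The increment of \<phi> is Lipschitz; weakened to the power \<open>a\<close> it combines
  with \<open>H2\<close>. The increment of the cosine is that of the mollified solution, an average
  over \<open>z\<close>, and combines with \<open>H3\<close>. Both reach the exponent
  \<open>2 * a + b\<close>, with a constant free of \<open>e\<close>.\<close>

lemma g_increment_integral:
  assumes w: "w \<in> torus_cell"
  shows "(\<integral>\<^sup>+x. ennreal \<bar>g x - g (x + w)\<bar> * ennreal (norm (v (x + w) - v x) * \<bar>f (x + w) - f x\<bar>) \<partial>tor)
    \<le> ennreal (S_const TYPE('d) B \<xi> * G * norm w powr (2 * a + b))"
proof -
  let ?P = "\<lambda>x. ennreal (norm (v (x + w) - v x) * \<bar>f (x + w) - f x\<bar>)"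
  let ?D = "\<lambda>x z. ennreal \<bar>f (x + w + z) - f (x + z)\<bar>"
  have "(\<integral>\<^sup>+x. ennreal \<bar>g x - g (x + w)\<bar> * ?P x \<partial>tor) \<le>
      (\<integral>\<^sup>+x. ennreal (B * \<bar>\<xi>\<bar> * norm w) * ?P x + ennreal (B * \<xi>\<^sup>2) * (\<integral>\<^sup>+z. ennreal (K z) * (?P x * ?D x z) \<partial>tor) \<partial>tor)"
  proof (rule nn_integral_mono)
    fix x
    have "ennreal \<bar>g x - g (x + w)\<bar> \<le> ennreal (B * \<bar>\<xi>\<bar> * norm w) + ennreal (B * \<xi>\<^sup>2) * ennreal \<bar>conv K f (x + w) - conv K f x\<bar>"
    proof -
      have "ennreal \<bar>g x - g (x + w)\<bar> \<le> ennreal (B * \<bar>\<xi>\<bar> * norm w + B * \<xi>\<^sup>2 * \<bar>conv K f (x + w) - conv K f x\<bar>)"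
        using g_increment[of x w] by (intro ennreal_leI) (simp add: abs_minus_commute)
      then show ?thesis using B_nonneg by (simp add: ennreal_mult')
    qed
    also have "\<dots> \<le> ennreal (B * \<bar>\<xi>\<bar> * norm w) + ennreal (B * \<xi>\<^sup>2) * (\<integral>\<^sup>+z. ennreal (K z) * ?D x z \<partial>tor)"
      by (intro add_left_mono mult_left_mono conv_increment f_int f_per) auto
    finally have "ennreal \<bar>g x - g (x + w)\<bar> * ?P x \<le>
       (ennreal (B * \<bar>\<xi>\<bar> * norm w) + ennreal (B * \<xi>\<^sup>2) * (\<integral>\<^sup>+z. ennreal (K z) * ?D x z \<partial>tor)) * ?P x"
      by (rule mult_right_mono) auto
    also have "\<dots> = ennreal (B * \<bar>\<xi>\<bar> * norm w) * ?P x + ennreal (B * \<xi>\<^sup>2) * (?P x * (\<integral>\<^sup>+z. ennreal (K z) * ?D x z \<partial>tor))"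
      unfolding distrib_right by (simp only: mult_ac)
    also have "?P x * (\<integral>\<^sup>+z. ennreal (K z) * ?D x z \<partial>tor) = (\<integral>\<^sup>+z. ennreal (K z) * (?P x * ?D x z) \<partial>tor)"
      by (subst nn_integral_cmult[symmetric]) (measurable, simp add: mult_ac)
    finally show "ennreal \<bar>g x - g (x + w)\<bar> * ?P x \<le>
      ennreal (B * \<bar>\<xi>\<bar> * norm w) * ?P x + ennreal (B * \<xi>\<^sup>2) * (\<integral>\<^sup>+z. ennreal (K z) * (?P x * ?D x z) \<partial>tor)" .
  qed
  also have "\<dots> = ennreal (B * \<bar>\<xi>\<bar> * norm w) * (\<integral>\<^sup>+x. ?P x \<partial>tor) +
      ennreal (B * \<xi>\<^sup>2) * (\<integral>\<^sup>+x. \<integral>\<^sup>+z. ennreal (K z) * (?P x * ?D x z) \<partial>tor \<partial>tor)"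
    by (subst nn_integral_add) (measurable, simp add: nn_integral_cmult)
  also have "(\<integral>\<^sup>+x. \<integral>\<^sup>+z. ennreal (K z) * (?P x * ?D x z) \<partial>tor \<partial>tor) = (\<integral>\<^sup>+z. \<integral>\<^sup>+x. ennreal (K z) * (?P x * ?D x z) \<partial>tor \<partial>tor)"
    by (rule tor_pair.Fubini'[symmetric]) measurable
  also have "\<dots> = (\<integral>\<^sup>+z. ennreal (K z) * (\<integral>\<^sup>+x. ?P x * ?D x z \<partial>tor) \<partial>tor)"
    by (intro nn_integral_cong nn_integral_cmult) measurable
  also have "\<dots> \<le> (\<integral>\<^sup>+z. ennreal (K z) * ennreal (G * norm w powr (2 * a + b)) \<partial>tor)"
    by (intro nn_integral_mono mult_left_mono H3 w) auto
  also have "\<dots> = ennreal (G * norm w powr (2 * a + b))"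
    by (subst nn_integral_multc) (auto simp: K_mass)
  finally have "(\<integral>\<^sup>+x. ennreal \<bar>g x - g (x + w)\<bar> * ?P x \<partial>tor) \<le>
      ennreal (B * \<bar>\<xi>\<bar> * norm w) * (\<integral>\<^sup>+x. ?P x \<partial>tor) + ennreal (B * \<xi>\<^sup>2) * ennreal (G * norm w powr (2 * a + b))"
    by (simp add: add_left_mono mult_left_mono)
  also have "\<dots> \<le> ennreal (B * \<bar>\<xi>\<bar> * (real CARD('d) * pi * norm w powr a)) * ennreal (G * norm w powr (a + b))
      + ennreal (B * \<xi>\<^sup>2) * ennreal (G * norm w powr (2 * a + b))"
    using B_nonneg norm_le_powr_cell[OF w a]
    by (intro add_right_mono mult_mono H2 w ennreal_leI mult_left_mono) auto
  also have "\<dots> = ennreal (B * \<bar>\<xi>\<bar> * (real CARD('d) * pi * norm w powr a) * (G * norm w powr (a + b)) + B * \<xi>\<^sup>2 * (G * norm w powr (2 * a + b)))"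
    using B_nonneg G by (simp add: ennreal_mult'[symmetric] ennreal_plus[symmetric] del: ennreal_plus)
  also have "B * \<bar>\<xi>\<bar> * (real CARD('d) * pi * norm w powr a) * (G * norm w powr (a + b)) + B * \<xi>\<^sup>2 * (G * norm w powr (2 * a + b))
      = S_const TYPE('d) B \<xi> * G * norm w powr (2 * a + b)"
  proof -
    have "norm w powr (2 * a + b) = norm w powr a * norm w powr (a + b)"
      by (simp add: powr_add[symmetric])
    then show ?thesis unfolding S_const_def by (simp add: algebra_simps)
  qed
  finally show ?thesis .
qed

lemma conv_f_periodic: "periodic (conv K f)"
  by (rule trig_periodic[OF trig_conv[OF f_int]])

lemma g_periodic: "periodic g"
  using \<phi>(2) conv_f_periodic unfolding g periodic_def by simp

lemma integrable_g_A: "integrable (tor \<Otimes>\<^sub>M tor) (\<lambda>(x, y). g x * A x y)"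
proof (rule integrableI_bounded)
  have "(\<integral>\<^sup>+z. ennreal (norm (case z of (x, y) \<Rightarrow> g x * A x y)) \<partial>(tor \<Otimes>\<^sub>M tor)) =
      (\<integral>\<^sup>+x. \<integral>\<^sup>+y. ennreal (norm (g x * A x y)) \<partial>tor \<partial>tor)"
    by (subst tor.nn_integral_fst[symmetric]) auto
  also have "\<dots> \<le> (\<integral>\<^sup>+x. \<integral>\<^sup>+y. ennreal (B * \<bar>\<xi>\<bar>) * ennreal \<bar>A x y\<bar> \<partial>tor \<partial>tor)"
  proof (intro nn_integral_mono)
    fix x y
    have "norm (g x * A x y) \<le> B * \<bar>\<xi>\<bar> * \<bar>A x y\<bar>"
      unfolding real_norm_def abs_mult[of "g x"] by (intro mult_right_mono g_bounded) auto
    then show "ennreal (norm (g x * A x y)) \<le> ennreal (B * \<bar>\<xi>\<bar>) * ennreal \<bar>A x y\<bar>"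
      using B_nonneg by (simp add: ennreal_mult'[symmetric] ennreal_leI)
  qed
  also have "\<dots> = ennreal (B * \<bar>\<xi>\<bar>) * (\<integral>\<^sup>+x. \<integral>\<^sup>+y. ennreal \<bar>A x y\<bar> \<partial>tor \<partial>tor)"
    by (simp add: nn_integral_cmult)
  also have "\<dots> < \<infinity>" using A_integrable by (simp add: ennreal_mult_less_top)
  finally show "(\<integral>\<^sup>+z. ennreal (norm (case z of (x, y) \<Rightarrow> g x * A x y)) \<partial>(tor \<Otimes>\<^sub>M tor)) < \<infinity>" .
qed measurable

lemma commutator_bound:
  "\<bar>\<integral>x. g x * (\<integral>y. A x y \<partial>tor) \<partial>tor\<bar> \<le> S_const TYPE('d) B \<xi> * G * (real CARD('d) * kk_const TYPE('d) * e powr (2 * a + b - 1))"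
proof -
  note gA = integrable_g_A
  define S where "S = (\<integral>x. \<integral>y. g x * A x y \<partial>tor \<partial>tor)"
  have S1: "S = (\<integral>z. (case z of (x, y) \<Rightarrow> g x * A x y) \<partial>(tor \<Otimes>\<^sub>M tor))"
    unfolding S_def using tor_pair.integral_fst'[OF gA] by simp
  have gA': "integrable (tor \<Otimes>\<^sub>M tor) (\<lambda>(x, y). g y * A y x)"
    using tor_pair.integrable_product_swap[OF gA] by (simp add: case_prod_beta')
  \<comment> \<open>Renaming the bound variables gives the iterated integral in the opposite order.
    Fubini restores the order of integration and leaves the reflected integrand.\<close>
  have S2: "S = (\<integral>z. (case z of (x, y) \<Rightarrow> g y * A y x) \<partial>(tor \<Otimes>\<^sub>M tor))"
  proof -
    have "S = (\<integral>y. \<integral>x. g y * A y x \<partial>tor \<partial>tor)" unfolding S_def by simp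
    also have "\<dots> = (\<integral>x. \<integral>y. g y * A y x \<partial>tor \<partial>tor)"
      by (rule tor_pair.Fubini_integral) (use gA' in simp)
    also have "\<dots> = (\<integral>z. (case z of (x, y) \<Rightarrow> g y * A y x) \<partial>(tor \<Otimes>\<^sub>M tor))"
      using tor_pair.integral_fst'[OF gA'] by simp
    finally show ?thesis .
  qed
  have sym: "(\<lambda>z. (case z of (x, y) \<Rightarrow> g x * A x y) + (case z of (x, y) \<Rightarrow> g y * A y x)) = (\<lambda>(x, y). (g x - g y) * A x y)"
  proof
    fix z
    show "(case z of (x, y) \<Rightarrow> g x * A x y) + (case z of (x, y) \<Rightarrow> g y * A y x) = (case z of (x, y) \<Rightarrow> (g x - g y) * A x y)"
      using A_swap[of "snd z" "fst z"] by (simp add: case_prod_beta algebra_simps)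
  qed
  have "2 * S = (\<integral>z. (case z of (x, y) \<Rightarrow> g x * A x y) + (case z of (x, y) \<Rightarrow> g y * A y x) \<partial>(tor \<Otimes>\<^sub>M tor))"
    using S1 S2 gA gA' by simp
  also have "\<dots> = (\<integral>z. (case z of (x, y) \<Rightarrow> (g x - g y) * A x y) \<partial>(tor \<Otimes>\<^sub>M tor))"
    unfolding sym ..
  finally have S3: "2 * S = (\<integral>z. (case z of (x, y) \<Rightarrow> (g x - g y) * A x y) \<partial>(tor \<Otimes>\<^sub>M tor))" .
  have i3: "integrable (tor \<Otimes>\<^sub>M tor) (\<lambda>(x, y). (g x - g y) * A x y)"
    using Bochner_Integration.integrable_add[OF gA gA'] unfolding sym .
  have "ennreal \<bar>2 * S\<bar> \<le> (\<integral>\<^sup>+z. ennreal (norm (case z of (x, y) \<Rightarrow> (g x - g y) * A x y)) \<partial>(tor \<Otimes>\<^sub>M tor))"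
    unfolding S3 real_norm_def[symmetric] by (rule integral_norm_bound_ennreal[OF i3])
  also have "\<dots> = (\<integral>\<^sup>+x. \<integral>\<^sup>+y. ennreal \<bar>g x - g y\<bar> * ennreal \<bar>A x y\<bar> \<partial>tor \<partial>tor)"
    by (subst tor.nn_integral_fst[symmetric]) (auto simp: abs_mult ennreal_mult')
  also have "\<dots> \<le> ennreal (S_const TYPE('d) B \<xi> * G * (real CARD('d) * kk_const TYPE('d) * e powr ((2 * a + b) - 1)))"
    by (rule iterated_A_bound)
       (use a b G S_const_nonneg g_increment_integral g_periodic in \<open>auto simp: periodic_def\<close>)
  finally have "\<bar>2 * S\<bar> \<le> S_const TYPE('d) B \<xi> * G * (real CARD('d) * kk_const TYPE('d) * e powr (2 * a + b - 1))"
    using G S_const_nonneg by (subst (asm) ennreal_le_iff) (auto simp: kk_const_def intro!: mult_nonneg_nonneg add_nonneg_nonneg)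
  then have "\<bar>S\<bar> \<le> S_const TYPE('d) B \<xi> * G * (real CARD('d) * kk_const TYPE('d) * e powr (2 * a + b - 1))" by linarith
  then show ?thesis unfolding S_def by simp
qed

section \<open>The transport term and the estimate at a fixed time\<close>

lemma integrable_v_inner:
  assumes [measurable]: "V \<in> borel_measurable borel" and V: "\<And>x. norm (V x) \<le> M"
  shows "integrable tor (\<lambda>x. v x \<bullet> V x)"
proof (rule Bochner_Integration.integrable_bound[OF integrable_mult_left[OF integrable_norm[OF v_int], of M]])
  show "AE x in tor. norm (v x \<bullet> V x) \<le> norm (norm (v x) * M)"
  proof (rule AE_I2)
    fix x
    have "\<bar>v x \<bullet> V x\<bar> \<le> norm (v x) * norm (V x)" by (rule Cauchy_Schwarz_ineq2)
    also have "\<dots> \<le> norm (v x) * M" using V by (intro mult_left_mono) auto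
    finally show "norm (v x \<bullet> V x) \<le> norm (norm (v x) * M)" by simp
  qed
qed measurable

lemma sin_conv_error:
  assumes m [measurable]: "h \<in> borel_measurable borel" "F \<in> borel_measurable borel" and h: "\<And>x. h x \<ge> 0"
    and F: "\<And>x. \<bar>F x\<bar> \<le> B * h x"
    and H: "\<And>w. w \<in> torus_cell \<Longrightarrow> (\<integral>\<^sup>+x. ennreal (h x) * ennreal \<bar>f (x + w) - f x\<bar> \<partial>tor) \<le> ennreal (G * norm w powr a)"
    and i: "integrable tor F"
  shows "\<bar>\<integral>x. F x * (sin (\<xi> * f x + c) - sin (\<xi> * conv K f x + c)) \<partial>tor\<bar> \<le> B * \<bar>\<xi>\<bar> * (G * (kk_const TYPE('d) * e powr a))"
proof -
  let ?d = "\<lambda>x. sin (\<xi> * f x + c) - sin (\<xi> * conv K f x + c)"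
  have sin_lip: "\<bar>sin s - sin t\<bar> \<le> \<bar>s - t\<bar>" for s t :: real
  proof -
    have "\<bar>sin s - sin t\<bar> = 2 * \<bar>sin ((s - t) / 2)\<bar> * \<bar>cos ((s + t) / 2)\<bar>"
      by (simp add: sin_diff_sin abs_mult)
    also have "\<dots> \<le> 2 * \<bar>(s - t) / 2\<bar> * 1"
      by (intro mult_mono abs_cos_le_one abs_sin_x_le_abs_x) auto
    finally show ?thesis by simp
  qed
  have d: "\<bar>?d x\<bar> \<le> \<bar>\<xi>\<bar> * \<bar>conv K f x - f x\<bar>" for x
    using sin_lip[of "\<xi> * f x + c" "\<xi> * conv K f x + c"]
    by (simp add: abs_mult[symmetric] right_diff_distrib abs_minus_commute)
  have i': "integrable tor (\<lambda>x. F x * ?d x)"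
  proof (rule Bochner_Integration.integrable_bound[OF integrable_mult_left[OF i, of 2]])
    have "\<bar>?d x\<bar> \<le> 2" for x
      using abs_sin_le_one[of "\<xi> * f x + c"] abs_sin_le_one[of "\<xi> * conv K f x + c"] by linarith
    then show "AE x in tor. norm (F x * ?d x) \<le> norm (F x * 2)"
      by (intro AE_I2) (auto simp: abs_mult intro!: mult_left_mono)
  qed measurable
  have "ennreal \<bar>\<integral>x. F x * ?d x \<partial>tor\<bar> \<le> (\<integral>\<^sup>+x. ennreal (norm (F x * ?d x)) \<partial>tor)"
    unfolding real_norm_def[symmetric] by (rule integral_norm_bound_ennreal[OF i'])
  also have "\<dots> \<le> (\<integral>\<^sup>+x. ennreal (B * \<bar>\<xi>\<bar>) * (ennreal (h x) * ennreal \<bar>conv K f x - f x\<bar>) \<partial>tor)"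
  proof (rule nn_integral_mono)
    fix x
    have "norm (F x * ?d x) \<le> (B * h x) * (\<bar>\<xi>\<bar> * \<bar>conv K f x - f x\<bar>)"
      unfolding real_norm_def abs_mult[of "F x"] using B_nonneg h by (intro mult_mono F d) auto
    then have "ennreal (norm (F x * ?d x)) \<le> ennreal (B * \<bar>\<xi>\<bar> * (h x * \<bar>conv K f x - f x\<bar>))"
      by (intro ennreal_leI) (simp only: mult_ac)
    then show "ennreal (norm (F x * ?d x)) \<le> ennreal (B * \<bar>\<xi>\<bar>) * (ennreal (h x) * ennreal \<bar>conv K f x - f x\<bar>)"
      using B_nonneg h by (simp add: ennreal_mult')
  qed
  also have "\<dots> = ennreal (B * \<bar>\<xi>\<bar>) * (\<integral>\<^sup>+x. ennreal (h x) * ennreal \<bar>conv K f x - f x\<bar> \<partial>tor)"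
    by (rule nn_integral_cmult) measurable
  also have "\<dots> \<le> ennreal (B * \<bar>\<xi>\<bar>) * ennreal (G * (kk_const TYPE('d) * e powr a))"
    by (intro mult_left_mono weighted_conv_error h H) auto
  finally have "ennreal \<bar>\<integral>x. F x * ?d x \<partial>tor\<bar> \<le> ennreal (B * \<bar>\<xi>\<bar> * (G * (kk_const TYPE('d) * e powr a)))"
    using B_nonneg by (simp add: ennreal_mult')
  then show ?thesis
    using B_nonneg G by (subst (asm) ennreal_le_iff) (auto simp: kk_const_def intro!: mult_nonneg_nonneg add_nonneg_nonneg)
qed

lemma grad_conv_bounded: "\<exists>M. \<forall>x. norm (grad (conv K f) x) \<le> M"
proof -
  have "\<exists>B. \<forall>x. \<bar>grad (conv K f) x $ i\<bar> \<le> B" for i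
    using trig_bounded[OF trig_frechet[OF trig_conv[OF f_int]]] unfolding grad_def by simp
  then obtain B where B: "\<And>i x. \<bar>grad (conv K f) x $ i\<bar> \<le> B i" by metis
  have "norm (grad (conv K f) x) \<le> (\<Sum>i\<in>UNIV. B i)" for x
    by (rule order_trans[OF norm_le_l1_cart sum_mono]) (rule B)
  then show ?thesis by blast
qed

lemma integrable_g_grad_conv: "integrable tor (\<lambda>x. g x * (v x \<bullet> grad (conv K f) x))"
proof -
  obtain M where M: "\<And>x. norm (grad (conv K f) x) \<le> M" using grad_conv_bounded by blast
  have [measurable]: "grad (conv K f) \<in> borel_measurable borel" by (rule grad_measurable[OF smooth_conv_f])
  have "integrable tor (\<lambda>x. v x \<bullet> (g x *\<^sub>R grad (conv K f) x))"
  proof (rule integrable_v_inner[where M = "B * \<bar>\<xi>\<bar> * M"])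
    show "norm (g x *\<^sub>R grad (conv K f) x) \<le> B * \<bar>\<xi>\<bar> * M" for x
      using g_bounded[of x] M[of x] B_nonneg by (auto intro!: mult_mono)
  qed measurable
  then show ?thesis by simp
qed

text \<open>Integration by parts for \<open>v\<close>: its weak divergence is tested with
  \<open>\<phi> x * sin (\<xi> * conv K f x + c)\<close>, an admissible function because
  \<open>conv K f\<close> is a trigonometric polynomial. The product rule yields the two
  integrals.\<close>

lemma integral_g_grad_conv:
  "(\<integral>x. g x * (v x \<bullet> grad (conv K f) x) \<partial>tor) = - (\<integral>x. (v x \<bullet> grad \<phi> x) * sin (\<xi> * conv K f x + c) \<partial>tor)"
proof -
  have s: "smooth (\<lambda>x. sin (\<xi> * conv K f x + c))"
    by (rule smooth_comp[OF smooth_sin smooth_conv_f])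
  have \<psi>: "smooth (\<lambda>x. \<phi> x * sin (\<xi> * conv K f x + c))" by (rule smooth_mult[OF \<phi>(1) s])
  have gr: "v x \<bullet> grad (\<lambda>x. \<phi> x * sin (\<xi> * conv K f x + c)) x =
      (v x \<bullet> grad \<phi> x) * sin (\<xi> * conv K f x + c) + g x * (v x \<bullet> grad (conv K f) x)" for x
  proof -
    have "((\<lambda>x. \<phi> x * sin (\<xi> * conv K f x + c)) has_derivative
      (\<lambda>V. \<phi> x * ((\<xi> * frechet_derivative (conv K f) (at x) V) * cos (\<xi> * conv K f x + c)) + frechet_derivative \<phi> (at x) V * sin (\<xi> * conv K f x + c))) (at x)"
      by (auto intro!: derivative_eq_intros smooth_has_derivative[OF \<phi>(1)] smooth_has_derivative[OF smooth_conv_f] simp: mult_ac)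
    from fun_cong[OF frechet_derivative_at[OF this], of "v x"] show ?thesis
      unfolding frechet_eq_grad[OF \<psi>] frechet_eq_grad[OF \<phi>(1)] frechet_eq_grad[OF smooth_conv_f] g by (simp add: mult_ac)
  qed
  have [measurable]: "grad \<phi> \<in> borel_measurable borel" by (rule grad_measurable[OF \<phi>(1)])
  have i: "integrable tor (\<lambda>x. (v x \<bullet> grad \<phi> x) * sin (\<xi> * conv K f x + c))"
  proof -
    have "integrable tor (\<lambda>x. v x \<bullet> (sin (\<xi> * conv K f x + c) *\<^sub>R grad \<phi> x))"
    proof (rule integrable_v_inner[where M = B])
      show "norm (sin (\<xi> * conv K f x + c) *\<^sub>R grad \<phi> x) \<le> B" for x
        using B'[of x] mult_mono[OF abs_sin_le_one B'[of x], of "\<xi> * conv K f x + c"] by simp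
    qed measurable
    then show ?thesis by (simp add: mult.commute)
  qed
  have "(\<integral>x. v x \<bullet> grad (\<lambda>x. \<phi> x * sin (\<xi> * conv K f x + c)) x \<partial>tor) = 0"
    by (rule div_free[OF \<psi>]) (use \<phi>(2) conv_f_periodic in \<open>auto simp: periodic_def\<close>)
  then show ?thesis unfolding gr using i integrable_g_grad_conv by simp
qed

lemma integrable_g_div_conv: "integrable tor (\<lambda>x. g x * div_conv K (\<lambda>y. f y *\<^sub>R v y) x)"
  and integral_g_div_conv: "(\<integral>x. g x * div_conv K (\<lambda>y. f y *\<^sub>R v y) x \<partial>tor) =
    (\<integral>x. g x * (\<integral>y. A x y \<partial>tor) \<partial>tor) - (\<integral>x. (v x \<bullet> grad \<phi> x) * sin (\<xi> * conv K f x + c) \<partial>tor)"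
proof -
  have d: "g x * div_conv K (\<lambda>y. f y *\<^sub>R v y) x = g x * (\<integral>y. A x y \<partial>tor) + g x * (v x \<bullet> grad (conv K f) x)" for x
    unfolding div_conv_eq A_def by (simp add: distrib_left)
  have i: "integrable tor (\<lambda>x. g x * (\<integral>y. A x y \<partial>tor))"
    using tor_pair.integrable_fst'[OF integrable_g_A] by simp
  show "integrable tor (\<lambda>x. g x * div_conv K (\<lambda>y. f y *\<^sub>R v y) x)"
    unfolding d using i integrable_g_grad_conv by simp
  show "(\<integral>x. g x * div_conv K (\<lambda>y. f y *\<^sub>R v y) x \<partial>tor) =
    (\<integral>x. g x * (\<integral>y. A x y \<partial>tor) \<partial>tor) - (\<integral>x. (v x \<bullet> grad \<phi> x) * sin (\<xi> * conv K f x + c) \<partial>tor)"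
    unfolding d using i integrable_g_grad_conv integral_g_grad_conv by simp
qed

text \<open>The subtracted integral is the expression whose integral over time will vanish. The
  difference has three parts: the commutator, and the two errors of replacing \<open>f\<close> by
  its mollification inside the sine, tested with \<open>\<psi>\<close> and with
  \<open>v \<bullet> grad \<phi>\<close>.\<close>

lemma slice_estimate:
  assumes [measurable]: "\<psi> \<in> borel_measurable borel" and \<psi>: "\<And>x. \<bar>\<psi> x\<bar> \<le> B"
  shows "\<bar>(\<integral>x. (\<psi> x + v x \<bullet> grad \<phi> x) * sin (\<xi> * f x + c) \<partial>tor) -
      (\<integral>x. \<psi> x * sin (\<xi> * conv K f x + c) - g x * div_conv K (\<lambda>y. f y *\<^sub>R v y) x \<partial>tor)\<bar>
    \<le> G * (S_const TYPE('d) B \<xi> * (real CARD('d) * kk_const TYPE('d) * e powr (2 * a + b - 1)) + 2 * (B * \<bar>\<xi>\<bar> * (kk_const TYPE('d) * e powr a)))"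
proof -
  have [measurable]: "grad \<phi> \<in> borel_measurable borel" by (rule grad_measurable[OF \<phi>(1)])
  have i\<psi>: "integrable tor \<psi>"
    by (rule tor.integrable_const_bound[of _ B]) (use \<psi> in auto)
  have iv: "integrable tor (\<lambda>x. v x \<bullet> grad \<phi> x)"
    by (rule integrable_v_inner[OF _ B']) measurable
  have isin: "integrable tor (\<lambda>x. F x * sin (\<xi> * k x + c))"
    if "integrable tor F" and [measurable]: "k \<in> borel_measurable borel" for F k
  proof (rule Bochner_Integration.integrable_bound[OF that(1)])
    show "AE x in tor. norm (F x * sin (\<xi> * k x + c)) \<le> norm (F x)"
      by (auto simp: abs_mult intro!: mult_left_le)
  qed (use borel_measurable_integrable[OF that(1)] in measurable)
  have "\<bar>\<integral>x. \<psi> x * (sin (\<xi> * f x + c) - sin (\<xi> * conv K f x + c)) \<partial>tor\<bar> \<le> B * \<bar>\<xi>\<bar> * (G * (kk_const TYPE('d) * e powr a))"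
    by (rule sin_conv_error[where h = "\<lambda>x. 1"]) (use \<psi> H0 i\<psi> in auto)
  moreover have "\<bar>\<integral>x. (v x \<bullet> grad \<phi> x) * (sin (\<xi> * f x + c) - sin (\<xi> * conv K f x + c)) \<partial>tor\<bar> \<le> B * \<bar>\<xi>\<bar> * (G * (kk_const TYPE('d) * e powr a))"
  proof (rule sin_conv_error[where h = "\<lambda>x. norm (v x)"])
    show "\<bar>v x \<bullet> grad \<phi> x\<bar> \<le> B * norm (v x)" for x
      using Cauchy_Schwarz_ineq2[of "v x" "grad \<phi> x"] mult_left_mono[OF B'[of x], of "norm (v x)"] by (simp add: mult.commute)
  qed (use H1 iv in \<open>auto\<close>)
  moreover have "(\<integral>x. (\<psi> x + v x \<bullet> grad \<phi> x) * sin (\<xi> * f x + c) \<partial>tor) -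
      (\<integral>x. \<psi> x * sin (\<xi> * conv K f x + c) - g x * div_conv K (\<lambda>y. f y *\<^sub>R v y) x \<partial>tor) =
    (\<integral>x. \<psi> x * (sin (\<xi> * f x + c) - sin (\<xi> * conv K f x + c)) \<partial>tor) +
    (\<integral>x. (v x \<bullet> grad \<phi> x) * (sin (\<xi> * f x + c) - sin (\<xi> * conv K f x + c)) \<partial>tor) +
    (\<integral>x. g x * (\<integral>y. A x y \<partial>tor) \<partial>tor)"
    unfolding distrib_right right_diff_distrib
    using isin[OF i\<psi> f_measurable] isin[OF i\<psi> conv_f_measurable] isin[OF iv f_measurable] isin[OF iv conv_f_measurable]
      integrable_g_div_conv integral_g_div_conv by simp
  moreover note commutator_bound
  ultimately have "\<bar>(\<integral>x. (\<psi> x + v x \<bullet> grad \<phi> x) * sin (\<xi> * f x + c) \<partial>tor) -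
      (\<integral>x. \<psi> x * sin (\<xi> * conv K f x + c) - g x * div_conv K (\<lambda>y. f y *\<^sub>R v y) x \<partial>tor)\<bar>
    \<le> B * \<bar>\<xi>\<bar> * (G * (kk_const TYPE('d) * e powr a)) + B * \<bar>\<xi>\<bar> * (G * (kk_const TYPE('d) * e powr a))
      + S_const TYPE('d) B \<xi> * G * (real CARD('d) * kk_const TYPE('d) * e powr (2 * a + b - 1))"
    by linarith
  then show ?thesis by (simp add: algebra_simps)
qed

end

end

subsection \<open>Weak derivatives in time\<close>

definition primitive :: "(real \<Rightarrow> real) \<Rightarrow> real \<Rightarrow> real" where
  "primitive n t = (\<integral>s. indicator {..t} s * n s \<partial>lborel)"

lemma integrable_indicator_mult:
  fixes n :: "real \<Rightarrow> real"
  assumes "integrable lborel n" "S \<in> sets borel"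
  shows "integrable lborel (\<lambda>s. indicator S s * n s)"
  using integrable_mult_indicator[OF _ assms(1), of S] assms(2) by simp

lemma primitive_diff:
  assumes n: "integrable lborel n" and "t \<le> u"
  shows "primitive n u - primitive n t = (\<integral>s. indicator {t<..u} s * n s \<partial>lborel)"
proof -
  have "primitive n u - primitive n t = (\<integral>s. indicator {..u} s * n s - indicator {..t} s * n s \<partial>lborel)"
    unfolding primitive_def by (intro Bochner_Integration.integral_diff[symmetric] integrable_indicator_mult n) auto
  also have "\<dots> = (\<integral>s. indicator {t<..u} s * n s \<partial>lborel)"
    using assms(2) by (intro Bochner_Integration.integral_cong) (auto simp: indicator_def)
  finally show ?thesis .
qed

lemma primitive_bound:
  assumes "integrable lborel n"
  shows "\<bar>primitive n t\<bar> \<le> (\<integral>s. \<bar>n s\<bar> \<partial>lborel)"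
proof -
  have "\<bar>primitive n t\<bar> \<le> (\<integral>s. \<bar>indicator {..t} s * n s\<bar> \<partial>lborel)"
    unfolding primitive_def by (rule integral_abs_bound)
  also have "\<dots> \<le> (\<integral>s. \<bar>n s\<bar> \<partial>lborel)"
    by (rule integral_mono) (use assms integrable_indicator_mult[OF assms, of "{..t}"] in \<open>auto simp: indicator_def\<close>)
  finally show ?thesis .
qed

lemma primitive_measurable [measurable]:
  assumes [measurable]: "n \<in> borel_measurable borel"
  shows "primitive n \<in> borel_measurable borel"
proof -
  have "(\<lambda>t. \<integral>s. (if s \<le> t then 1 else 0) * n s \<partial>lborel) \<in> borel_measurable borel"
    by measurable
  then show ?thesis unfolding primitive_def[abs_def] by (simp add: indicator_def of_bool_def cong: if_cong)
qed

text \<open>Lebesgue's differentiation theorem along the steps \<open>1 / Suc k\<close> to the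
  right. A sequence of steps is the form in which dominated convergence consumes it.\<close>

lemma primitive_difference_quotient:
  assumes n: "integrable lborel n"
  shows "AE t in lborel. (\<lambda>k. real (Suc k) * (primitive n (t + 1 / real (Suc k)) - primitive n t)) \<longlonglongrightarrow> n t"
proof -
  have io: "n integrable_on cbox a b" for a b :: real
  proof -
    have "n integrable_on UNIV" using integrable_on_lborel[OF n] .
    then show ?thesis using integrable_on_subcbox by blast
  qed
  obtain Z where Z: "negligible Z" "\<And>x e. x \<notin> Z \<Longrightarrow> 0 < e \<Longrightarrow> \<exists>d>0. \<forall>h. 0 < h \<and> h < d \<longrightarrow>
      norm (integral (cbox x (x + h *\<^sub>R One)) n /\<^sub>R h ^ DIM(real) - n x) < e"
    using integrable_ccontinuous_explicit[of n] io by blast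
  have P: "primitive n (x + h) - primitive n x = integral (cbox x (x + h)) n" if "h > 0" for x h
  proof -
    have "primitive n (x + h) - primitive n x = (\<integral>s. indicator {x<..x + h} s * n s \<partial>lborel)"
      using that by (intro primitive_diff n) auto
    also have "\<dots> = (\<integral>s. indicator {x..x + h} s *\<^sub>R n s \<partial>lborel)"
      using AE_lborel_singleton[of x] borel_measurable_integrable[OF n]
      by (intro integral_cong_AE) (auto elim!: eventually_mono simp: indicator_def)
    also have "\<dots> = integral {x..x + h} n"
      using set_borel_integral_eq_integral(2)[of "{x..x + h}" n] integrable_mult_indicator[OF _ n, of "{x..x + h}"]
      by (simp add: set_integrable_def set_lebesgue_integral_def)
    finally show ?thesis by simp
  qed
  have "AE t in lborel. t \<notin> Z"
  proof -
    have "AE t in lebesgue. t \<notin> Z" using Z(1) by (intro AE_not_in) (simp add: negligible_iff_null_sets)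
    then show ?thesis by (simp add: AE_completion_iff)
  qed
  then show ?thesis
  proof eventually_elim
    case (elim t)
    show ?case
    proof (rule LIMSEQ_I)
      fix r :: real
      assume "0 < r"
      from Z(2)[OF elim this] obtain d where d: "d > 0" "\<And>h. 0 < h \<Longrightarrow> h < d \<Longrightarrow>
        norm (integral (cbox t (t + h *\<^sub>R One)) n /\<^sub>R h ^ DIM(real) - n t) < r" by blast
      obtain k0 where k0: "1 / real (Suc k0) < d" using d(1) nat_approx_posE by (metis inverse_eq_divide reals_Archimedean)
      have "norm (real (Suc k) * (primitive n (t + 1 / real (Suc k)) - primitive n t) - n t) < r" if "k \<ge> k0" for k
      proof -
        have "1 / real (Suc k) \<le> 1 / real (Suc k0)" using that by (intro divide_left_mono) auto
        then have "norm (integral (cbox t (t + (1 / real (Suc k)) *\<^sub>R One)) n /\<^sub>R (1 / real (Suc k)) ^ DIM(real) - n t) < r"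
          using k0 by (intro d) auto
        then show ?thesis using P[of "1 / real (Suc k)" t] by (simp add: mult.commute)
      qed
      then show "\<exists>k0. \<forall>k\<ge>k0. norm (real (Suc k) * (primitive n (t + 1 / real (Suc k)) - primitive n t) - n t) < r" by blast
    qed
  qed
qed

section \<open>Functions on an interval with vanishing weak derivative\<close>

lemma AE_const_if_interval_integrals:
  fixes g :: "real \<Rightarrow> real" and T c :: real
  assumes g: "integrable lborel g"
    and I: "\<And>a b. 0 < a \<Longrightarrow> a < b \<Longrightarrow> b < T \<Longrightarrow> (\<integral>s. indicator {a<..<b} s * g s \<partial>lborel) = c * (b - a)"
  shows "AE t in lborel. 0 < t \<longrightarrow> t < T \<longrightarrow> g t = c"
  using primitive_difference_quotient[OF g]
proof eventually_elim
  case (elim t)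
  show ?case
  proof (intro impI)
    assume t: "0 < t" "t < T"
    have "\<forall>\<^sub>F k in sequentially. 1 / real (Suc k) < T - t"
      using order_tendstoD(2)[OF LIMSEQ_inverse_real_of_nat, of "T - t"] t by (simp add: inverse_eq_divide)
    then have "\<forall>\<^sub>F k in sequentially. real (Suc k) * (primitive g (t + 1 / real (Suc k)) - primitive g t) = c"
    proof eventually_elim
      case (elim k)
      define h where "h = 1 / real (Suc k)"
      have h: "h > 0" "t + h < T" using elim unfolding h_def by auto
      have "primitive g (t + h) - primitive g t = (\<integral>s. indicator {t<..t + h} s * g s \<partial>lborel)"
        using h by (intro primitive_diff g) auto
      also have "\<dots> = (\<integral>s. indicator {t<..<t + h} s * g s \<partial>lborel)"
        using AE_lborel_singleton[of "t + h"] borel_measurable_integrable[OF g]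
        by (intro integral_cong_AE) (auto elim!: eventually_mono simp: indicator_def)
      also have "\<dots> = c * h" using I[of t "t + h"] t h by simp
      finally show ?case unfolding h_def by simp
    qed
    then have "(\<lambda>k. real (Suc k) * (primitive g (t + 1 / real (Suc k)) - primitive g t)) \<longlonglongrightarrow> c"
      by (rule tendsto_eventually)
    with elim show "g t = c" by (rule LIMSEQ_unique)
  qed
qed

text \<open>A primitive that starts from 0 at \<open>a\<close> is constant to the right of
  \<open>b\<close>, and that constant is the integral of \<rho>; mean zero is exactly what makes the
  primitive compactly supported.\<close>

lemma smooth_compact_primitive:
  fixes \<rho> :: "real \<Rightarrow> real"
  assumes \<rho>: "smooth \<rho>" and ab: "0 < a" "a \<le> b" and z: "\<And>t. t \<le> a \<or> b \<le> t \<Longrightarrow> \<rho> t = 0"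
    and I: "(\<integral>t. \<rho> t \<partial>lborel) = 0"
  obtains \<eta> where "\<And>t. (\<eta> has_real_derivative \<rho> t) (at t)" "smooth \<eta>" "\<And>t. t \<notin> {a..b} \<Longrightarrow> \<eta> t = 0"
proof -
  have c: "isCont \<rho> t" for t
    using smooth_real_DERIV[OF \<rho>] DERIV_isCont by blast
  have "\<exists>F. \<forall>x :: real. - \<infinity> < ereal x \<longrightarrow> ereal x < \<infinity> \<longrightarrow> (F has_vector_derivative \<rho> x) (at x)"
    by (rule einterval_antiderivative) (use c in auto)
  then obtain F where F: "\<And>x. (F has_real_derivative \<rho> x) (at x)"
    by (auto simp: has_real_derivative_iff_has_vector_derivative)
  have FTC: "(\<integral>x. \<rho> x * indicator {s..t} x \<partial>lborel) = F t - F s" if "s \<le> t" for s t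
    using that F c by (intro integral_FTC_Icc_real) auto
  define \<eta> where "\<eta> t = F t - F a" for t
  have d: "(\<eta> has_real_derivative \<rho> t) (at t)" for t
    unfolding \<eta>_def using F[of t] by (auto intro!: derivative_eq_intros)
  show ?thesis
  proof (rule that[OF d])
    show "smooth \<eta>" by (rule smooth_real_primitive[OF d \<rho>])
    fix t assume "t \<notin> {a..b}"
    then consider "t \<le> a" | "b \<le> t" by fastforce
    then show "\<eta> t = 0"
    proof cases
      case 1
      have "(\<integral>x. \<rho> x * indicator {t..a} x \<partial>lborel) = (\<integral>x. 0 \<partial>(lborel :: real measure))"
        using z by (intro Bochner_Integration.integral_cong) (auto simp: indicator_def)
      then show ?thesis using FTC[OF 1] by (simp add: \<eta>_def)
    next
      case 2
      have "\<rho> x * indicator {a..t} x = \<rho> x" for x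
        using z[of x] 2 by (cases "x \<in> {a..t}") auto
      then have "(\<integral>x. \<rho> x * indicator {a..t} x \<partial>lborel) = (\<integral>x. \<rho> x \<partial>lborel)"
        by (rule Bochner_Integration.integral_cong[OF refl])
      then show ?thesis using FTC[of a t] 2 ab I by (simp add: \<eta>_def)
    qed
  qed
qed

text \<open>The hypothesis concerns derivatives of test functions, that is, test functions of mean
  zero. Every bump becomes one of these after subtraction of a multiple of a fixed bump, and the
  constant is the mean of \<open>g\<close> weighted by that fixed bump.\<close>

lemma du_Bois_Reymond:
  fixes g :: "real \<Rightarrow> real"
  assumes T: "T > 0" and g: "integrable lborel g"
    and w: "\<And>\<eta> \<rho> a b. smooth \<eta> \<Longrightarrow> (\<And>t. (\<eta> has_real_derivative \<rho> t) (at t)) \<Longrightarrow> 0 < a \<Longrightarrow> b < T \<Longrightarrow>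
      (\<And>t. t \<notin> {a..b} \<Longrightarrow> \<eta> t = 0) \<Longrightarrow> (\<integral>t. \<rho> t * g t \<partial>lborel) = 0"
  shows "\<exists>c. AE t in lborel. 0 < t \<longrightarrow> t < T \<longrightarrow> g t = c"
proof -
  have [measurable]: "g \<in> borel_measurable borel" using borel_measurable_integrable[OF g] by simp
  have bm [measurable]: "bump k a b \<in> borel_measurable borel" for k a b
    by (rule smooth_measurable[OF smooth_bump])
  have bi: "integrable lborel (bump k a b)" if "a < b" "k > 0" for k a b
  proof -
    have "integrable lborel (\<lambda>x. indicator {a..b} x *\<^sub>R bump k a b x)"
      by (intro borel_integrable_compact smooth_imp_continuous_on smooth_bump) simp
    moreover have "(\<lambda>x. indicator {a..b} x *\<^sub>R bump k a b x) = bump k a b"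
    proof
      show "indicator {a..b} x *\<^sub>R bump k a b x = bump k a b x" for x
        using bump_zero[OF that(2), of a b x] that by (cases "x \<in> {a..b}") auto
    qed
    ultimately show ?thesis by simp
  qed
  have gi: "integrable lborel (\<lambda>t. bump k a b t * g t)" for k a b
    by (rule Bochner_Integration.integrable_bound[OF g])
       (auto simp: abs_mult bump_nonneg bump_le_1 intro!: mult_left_le_one_le)
  \<comment> \<open>The middle third is one choice of an interval strictly inside (0,T); its bump is
    the fixed reference of nonzero mean.\<close>
  define a0 b0 where "a0 = T / 3" and "b0 = 2 * T / 3"
  have ab0: "0 < a0" "a0 < b0" "b0 < T" using T by (auto simp: a0_def b0_def)
  define \<rho>0 where "\<rho>0 = bump 1 a0 b0"
  define I0 where "I0 = (\<integral>t. \<rho>0 t \<partial>lborel)"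
  have I0: "I0 > 0"
  proof (rule ccontr)
    assume "\<not> I0 > 0"
    moreover have "I0 \<ge> 0" unfolding I0_def \<rho>0_def by (intro integral_nonneg_AE) (auto simp: bump_nonneg)
    ultimately have "(\<integral>t. \<rho>0 t \<partial>lborel) = 0" unfolding I0_def by linarith
    then have "AE t in lborel. \<rho>0 t = 0"
      unfolding \<rho>0_def using bi[OF ab0(2)] by (subst (asm) integral_nonneg_eq_0_iff_AE) (auto simp: bump_nonneg)
    then have "AE t in lborel. t \<notin> {a0<..<b0}"
      by eventually_elim (use bump_pos[of 1 a0 _ b0] in \<open>fastforce simp: \<rho>0_def\<close>)
    then have "emeasure lborel {a0<..<b0} = 0"
      by (subst (asm) AE_iff_measurable[where N = "{a0<..<b0}"]) auto
    then show False using ab0 by simp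
  qed
  define c where "c = (\<integral>t. \<rho>0 t * g t \<partial>lborel) / I0"
  have key: "(\<integral>t. bump k a b t * g t \<partial>lborel) = c * (\<integral>t. bump k a b t \<partial>lborel)"
    if ab: "0 < a" "a < b" "b < T" and k: "k > 0" for k a b
  proof -
    \<comment> \<open>The ratio of the two means, chosen so that \<rho> has integral 0 and hence a
      compactly supported primitive.\<close>
    define l where "l = (\<integral>t. bump k a b t \<partial>lborel) / I0"
    define \<rho> where "\<rho> t = bump k a b t + (- l) * \<rho>0 t" for t
    have s: "smooth \<rho>" unfolding \<rho>_def \<rho>0_def by (intro smooth_add smooth_mult smooth_const smooth_bump)
    have "(\<integral>t. \<rho> t \<partial>lborel) = 0"
      unfolding \<rho>_def \<rho>0_def using bi[OF ab(2) k] bi[OF ab0(2), of 1] I0 by (simp add: l_def I0_def \<rho>0_def)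
    moreover have "\<rho> t = 0" if "t \<le> min a a0 \<or> max b b0 \<le> t" for t
      unfolding \<rho>_def \<rho>0_def using bump_zero[OF k, of a b t] bump_zero[of 1 a0 b0 t] ab ab0 that by auto
    ultimately obtain \<eta> where \<eta>: "\<And>t. (\<eta> has_real_derivative \<rho> t) (at t)" "smooth \<eta>" "\<And>t. t \<notin> {min a a0..max b b0} \<Longrightarrow> \<eta> t = 0"
      using smooth_compact_primitive[OF s, of "min a a0" "max b b0"] ab ab0 by (metis less_imp_le max.coboundedI1 min.coboundedI1 min_less_iff_conj)
    have "(\<integral>t. \<rho> t * g t \<partial>lborel) = 0"
      by (rule w[OF \<eta>(2,1) _ _ \<eta>(3)]) (use ab ab0 in auto)
    moreover have "(\<integral>t. \<rho> t * g t \<partial>lborel) = (\<integral>t. bump k a b t * g t - l * (\<rho>0 t * g t) \<partial>lborel)"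
      unfolding \<rho>_def by (intro Bochner_Integration.integral_cong) (auto simp: algebra_simps)
    moreover have "\<dots> = (\<integral>t. bump k a b t * g t \<partial>lborel) - l * (\<integral>t. \<rho>0 t * g t \<partial>lborel)"
      unfolding \<rho>0_def using gi by simp
    ultimately show ?thesis unfolding c_def l_def by simp
  qed
  have "(\<integral>s. indicator {a<..<b} s * g s \<partial>lborel) = c * (b - a)" if ab: "0 < a" "a < b" "b < T" for a b
  proof -
    \<comment> \<open>Steepening the bumps passes from smooth weights to the indicator of the
      interval, for which differentiation of the primitive of \<open>g\<close> applies.\<close>
    have "(\<lambda>n. \<integral>t. bump (real (Suc n)) a b t * g t \<partial>lborel) \<longlonglongrightarrow> (\<integral>s. indicator {a<..<b} s * g s \<partial>lborel)"
    proof (rule integral_dominated_convergence[where w = "\<lambda>t. \<bar>g t\<bar>"])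
      show "AE x in lborel. (\<lambda>n. bump (real (Suc n)) a b x * g x) \<longlonglongrightarrow> indicator {a<..<b} x * g x"
        using ab by (intro AE_I2 tendsto_intros bump_tendsto_indicator) auto
      show "AE x in lborel. norm (bump (real (Suc n)) a b x * g x) \<le> \<bar>g x\<bar>" for n
        by (auto simp: abs_mult bump_nonneg bump_le_1 intro!: mult_left_le_one_le)
    qed (use g in auto)
    moreover have "(\<lambda>n. \<integral>t. bump (real (Suc n)) a b t \<partial>lborel) \<longlonglongrightarrow> (\<integral>s. indicator {a<..<b} s \<partial>lborel)"
    proof (rule integral_dominated_convergence[where w = "indicator {a<..<b}"])
      show "AE x in lborel. (\<lambda>n. bump (real (Suc n)) a b x) \<longlonglongrightarrow> indicator {a<..<b} x"
        using ab by (intro AE_I2 bump_tendsto_indicator) auto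
      show "AE x in lborel. norm (bump (real (Suc n)) a b x) \<le> indicator {a<..<b} x" for n
        using bump_zero[of "real (Suc n)" a b] ab by (auto simp: bump_nonneg bump_le_1 indicator_def)
    qed (use ab in \<open>auto intro!: integrable_real_indicator\<close>)
    then have "(\<lambda>n. c * (\<integral>t. bump (real (Suc n)) a b t \<partial>lborel)) \<longlonglongrightarrow> c * (b - a)"
      using ab by (intro tendsto_mult tendsto_const) simp
    moreover have "(\<integral>t. bump (real (Suc n)) a b t * g t \<partial>lborel) = c * (\<integral>t. bump (real (Suc n)) a b t \<partial>lborel)" for n
      by (rule key[OF ab]) simp
    ultimately show ?thesis using LIMSEQ_unique by simp
  qed
  then show ?thesis using AE_const_if_interval_integrals[OF g] by blast
qed

subsection \<open>The chain rule for absolutely continuous functions\<close>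

lemma integrable_compact_bounded:
  fixes F :: "real \<Rightarrow> real"
  assumes [measurable]: "F \<in> borel_measurable borel" and "\<And>t. \<bar>F t\<bar> \<le> C" "\<And>t. t \<notin> {a..b} \<Longrightarrow> F t = 0"
  shows "integrable lborel F"
proof (rule Bochner_Integration.integrable_bound)
  have "integrable lborel (indicator {a..b} :: real \<Rightarrow> real)" by (cases "a \<le> b") auto
  then show "integrable lborel (\<lambda>t. C * indicator {a..b} t)" by simp
  show "AE t in lborel. norm (F t) \<le> norm (C * indicator {a..b} t)"
  proof (rule AE_I2)
    fix t show "norm (F t) \<le> norm (C * indicator {a..b} t)"
      using assms(2)[of t] assms(3)[of t] by (cases "t \<in> {a..b}") auto
  qed
qed measurable

locale C1_cutoff =
  fixes \<psi> \<psi>' :: "real \<Rightarrow> real" and a b :: real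
  assumes \<psi>: "(\<psi> has_real_derivative \<psi>' t) (at t)" and \<psi>'_cont: "continuous_on UNIV \<psi>'"
    and \<psi>_zero: "t \<notin> {a..b} \<Longrightarrow> \<psi> t = 0"
begin

lemma \<psi>_cont: "continuous_on UNIV \<psi>"
  by (meson DERIV_isCont \<psi> continuous_at_imp_continuous_on)

lemma \<psi>_measurable [measurable]: "\<psi> \<in> borel_measurable borel" "\<psi>' \<in> borel_measurable borel"
  using \<psi>_cont \<psi>'_cont by (auto intro: borel_measurable_continuous_onI)

lemma \<psi>'_zero: "t \<notin> {a..b} \<Longrightarrow> \<psi>' t = 0"
proof -
  assume t: "t \<notin> {a..b}"
  have "((\<lambda>s. 0) has_real_derivative 0) (at t)" by simp
  then have "(\<psi> has_real_derivative 0) (at t)"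
    by (rule has_field_derivative_transform_within_open[where S = "- {a..b}"]) (use t \<psi>_zero in auto)
  then show ?thesis using DERIV_unique[OF \<psi>] by simp
qed

lemma bounded: "\<exists>P \<ge> 0. \<forall>t. \<bar>\<psi> t\<bar> \<le> P \<and> \<bar>\<psi>' t\<bar> \<le> P"
proof -
  have "\<exists>C. \<forall>t. \<bar>f t\<bar> \<le> C" if "continuous_on UNIV f" "\<And>t. t \<notin> {a..b} \<Longrightarrow> f t = 0" for f :: "real \<Rightarrow> real"
  proof -
    have "bounded (f ` {a..b})"
      by (intro compact_imp_bounded compact_continuous_image continuous_on_subset[OF that(1)]) auto
    then obtain C where C: "\<And>t. t \<in> {a..b} \<Longrightarrow> \<bar>f t\<bar> \<le> C" unfolding bounded_iff real_norm_def by blast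
    have "\<bar>f t\<bar> \<le> max C 0" for t using C[of t] that(2)[of t] by (cases "t \<in> {a..b}") auto
    then show ?thesis by blast
  qed
  then obtain C D where "\<And>t. \<bar>\<psi> t\<bar> \<le> C" "\<And>t. \<bar>\<psi>' t\<bar> \<le> D"
    using \<psi>_cont \<psi>'_cont \<psi>_zero \<psi>'_zero by metis
  then have "\<bar>\<psi> t\<bar> \<le> max 0 (max C D) \<and> \<bar>\<psi>' t\<bar> \<le> max 0 (max C D)" for t
    by (meson max.coboundedI2 max.cobounded1 max.cobounded2 order_trans)
  then show ?thesis by (intro exI[of _ "max 0 (max C D)"]) auto
qed

end

locale C1_chain = C1_cutoff +
  fixes h h' :: "real \<Rightarrow> real" and H :: real
  assumes h: "(h has_real_derivative h' y) (at y)" and h'_cont: "continuous_on UNIV h'" and h'_bound: "\<bar>h' y\<bar> \<le> H"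
begin

lemma h_cont: "continuous_on UNIV h"
  by (meson DERIV_isCont h continuous_at_imp_continuous_on)

lemma h_measurable [measurable]: "h \<in> borel_measurable borel" "h' \<in> borel_measurable borel"
  using h_cont h'_cont by (auto intro: borel_measurable_continuous_onI)

lemma H_nonneg: "H \<ge> 0" using h'_bound[of 0] by linarith

lemma h_lipschitz: "\<bar>h x - h y\<bar> \<le> H * \<bar>x - y\<bar>"
  using field_differentiable_bound[of UNIV h h' H x y] h h'_bound by simp

lemma h_primitive_bounded:
  assumes "integrable lborel n"
  shows "\<bar>h (c - primitive n t)\<bar> \<le> \<bar>h c\<bar> + H * (\<integral>s. \<bar>n s\<bar> \<partial>lborel)"
proof -
  have "\<bar>h (c - primitive n t) - h c\<bar> \<le> H * \<bar>primitive n t\<bar>"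
    using h_lipschitz[of "c - primitive n t" c] by simp
  also have "\<dots> \<le> H * (\<integral>s. \<bar>n s\<bar> \<partial>lborel)"
    by (intro mult_left_mono primitive_bound assms H_nonneg)
  finally show ?thesis by linarith
qed

text \<open>A bounded \<open>n\<close> makes the primitive Lipschitz, so the difference quotients of
  \<open>h (c - primitive n t)\<close> are bounded. Translation invariance moves the quotient onto
  the cutoff, and dominated convergence applies on both sides: almost everywhere for the primitive,
  everywhere for the cutoff.\<close>

lemma chain_rule_bounded:
  assumes n: "integrable lborel n" and L: "\<And>t. \<bar>n t\<bar> \<le> L"
  shows "(\<integral>t. \<psi>' t * h (c - primitive n t) \<partial>lborel) = (\<integral>t. \<psi> t * (h' (c - primitive n t) * n t) \<partial>lborel)"
proof -
  have nm [measurable]: "n \<in> borel_measurable borel" using borel_measurable_integrable[OF n] by simp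
  define M where "M t = c - primitive n t" for t
  have Mm [measurable]: "M \<in> borel_measurable borel" unfolding M_def by measurable
  obtain P where P: "P \<ge> 0" "\<And>t. \<bar>\<psi> t\<bar> \<le> P" "\<And>t. \<bar>\<psi>' t\<bar> \<le> P" using bounded by blast
  define D where "D = \<bar>h c\<bar> + H * (\<integral>s. \<bar>n s\<bar> \<partial>lborel)"
  have D: "\<bar>h (M t)\<bar> \<le> D" for t unfolding M_def D_def by (rule h_primitive_bounded[OF n])
  have D0: "D \<ge> 0" using D[of 0] by linarith
  define d where "d k = 1 / real (Suc k)" for k
  have d: "d k > 0" "d k \<le> 1" "real (Suc k) * d k = 1" for k unfolding d_def by auto
  have d0: "d \<longlonglongrightarrow> 0" unfolding d_def using LIMSEQ_inverse_real_of_nat by (simp add: inverse_eq_divide)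
  define q where "q k t = real (Suc k) * (h (M (t + d k)) - h (M t))" for k t
  have qm [measurable]: "q k \<in> borel_measurable borel" for k unfolding q_def by measurable
  have M_lip: "\<bar>M (t + s) - M t\<bar> \<le> L * s" if "s > 0" for t s
  proof -
    have "\<bar>M (t + s) - M t\<bar> = \<bar>\<integral>r. indicator {t<..t + s} r * n r \<partial>lborel\<bar>"
      using primitive_diff[OF n, of t "t + s"] that by (simp add: M_def)
    also have "\<dots> \<le> (\<integral>r. \<bar>indicator {t<..t + s} r * n r\<bar> \<partial>lborel)" by (rule integral_abs_bound)
    also have "\<dots> \<le> (\<integral>r. indicator {t<..t + s} r * L \<partial>lborel)"
    proof (rule integral_mono)
      show "\<bar>indicator {t<..t + s} r * n r\<bar> \<le> indicator {t<..t + s} r * L" for r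
        using L[of r] by (auto simp: indicator_def)
    qed (use integrable_indicator_mult[OF n, of "{t<..t + s}"] that in auto)
    also have "\<dots> = L * s" using that by simp
    finally show ?thesis .
  qed
  have qb: "\<bar>q k t\<bar> \<le> H * L" for k t
  proof -
    have "\<bar>q k t\<bar> \<le> real (Suc k) * (H * (L * d k))"
      unfolding q_def abs_mult using h_lipschitz[of "M (t + d k)" "M t"] M_lip[OF d(1)[of k], of t] H_nonneg
      by (intro mult_mono) (auto intro: order_trans mult_left_mono)
    also have "\<dots> = H * L * (real (Suc k) * d k)" by (simp only: mult_ac)
    finally show ?thesis unfolding d(3) by simp
  qed
  have c1: "(\<lambda>k. \<integral>t. \<psi> t * q k t \<partial>lborel) \<longlonglongrightarrow> (\<integral>t. \<psi> t * (h' (M t) * - n t) \<partial>lborel)"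
  proof (rule integral_dominated_convergence[where w = "\<lambda>t. \<bar>\<psi> t\<bar> * (H * L)"])
    show "AE t in lborel. (\<lambda>k. \<psi> t * q k t) \<longlonglongrightarrow> \<psi> t * (h' (M t) * - n t)"
      using primitive_difference_quotient[OF n]
    proof eventually_elim
      case (elim t)
      have 1: "(\<lambda>k. real (Suc k) * (M (t + d k) - M t)) \<longlonglongrightarrow> - n t"
        using tendsto_minus[OF elim] unfolding M_def d_def by (simp add: algebra_simps)
      have 2: "(\<lambda>k. M (t + d k)) \<longlonglongrightarrow> M t"
      proof -
        have "(\<lambda>k. d k * (real (Suc k) * (M (t + d k) - M t)) + M t) \<longlonglongrightarrow> 0 * - n t + M t"
          by (intro tendsto_intros d0 1)
        moreover have "d k * (real (Suc k) * (M (t + d k) - M t)) + M t = M (t + d k)" for k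
          using d(3)[of k] by (simp add: mult.commute mult.left_commute flip: mult.assoc)
        ultimately show ?thesis by simp
      qed
      \<comment> \<open>Caratheodory's form of the derivative avoids division by the increment of
        \<open>M\<close>, which may be 0.\<close>
      obtain g where g: "\<And>z. h z - h (M t) = g z * (z - M t)" "isCont g (M t)" "g (M t) = h' (M t)"
        using h[of "M t"] unfolding CARAT_DERIV by blast
      have "(\<lambda>k. g (M (t + d k)) * (real (Suc k) * (M (t + d k) - M t))) \<longlonglongrightarrow> h' (M t) * - n t"
        unfolding g(3)[symmetric] by (intro tendsto_mult isCont_tendsto_compose[OF g(2)] 1 2)
      moreover have "g (M (t + d k)) * (real (Suc k) * (M (t + d k) - M t)) = q k t" for k
        unfolding q_def g(1) by (simp only: mult.left_commute)
      ultimately have "(\<lambda>k. q k t) \<longlonglongrightarrow> h' (M t) * - n t" by (simp only:)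
      then show ?case by (intro tendsto_mult tendsto_const)
    qed
    show "integrable lborel (\<lambda>t. \<bar>\<psi> t\<bar> * (H * L))"
      by (intro integrable_mult_left integrable_abs integrable_compact_bounded[of \<psi> P a b]) (use P \<psi>_zero in auto)
    show "AE t in lborel. norm (\<psi> t * q k t) \<le> \<bar>\<psi> t\<bar> * (H * L)" for k
      using qb by (auto simp: abs_mult intro!: mult_left_mono)
  qed measurable
  moreover have c2: "(\<integral>t. \<psi> t * q k t \<partial>lborel) = (\<integral>t. real (Suc k) * (\<psi> (t - d k) - \<psi> t) * h (M t) \<partial>lborel)" for k
  proof -
    have i1: "integrable lborel (\<lambda>t. \<psi> t * h (M (t + d k)))"
      by (rule integrable_compact_bounded[of _ "P * D" a b]) (use P D D0 \<psi>_zero in \<open>auto simp: abs_mult intro!: mult_mono\<close>)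
    have i2: "integrable lborel (\<lambda>t. \<psi> t * h (M t))"
      by (rule integrable_compact_bounded[of _ "P * D" a b]) (use P D D0 \<psi>_zero in \<open>auto simp: abs_mult intro!: mult_mono\<close>)
    have i3: "integrable lborel (\<lambda>t. \<psi> (t - d k) * h (M t))"
      by (rule integrable_compact_bounded[of _ "P * D" "a + d k" "b + d k"]) (use P D D0 \<psi>_zero in \<open>auto simp: abs_mult intro!: mult_mono\<close>)
    have "(\<integral>t. \<psi> t * h (M (t + d k)) \<partial>lborel) = (\<integral>t. \<psi> (t - d k) * h (M t) \<partial>lborel)"
      using lborel_integral_real_affine[of 1 "\<lambda>t. \<psi> t * h (M (t + d k))" "- d k"] by simp
    moreover have "(\<integral>t. \<psi> t * q k t \<partial>lborel) = (\<integral>t. real (Suc k) * (\<psi> t * h (M (t + d k))) - real (Suc k) * (\<psi> t * h (M t)) \<partial>lborel)"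
      by (rule Bochner_Integration.integral_cong[OF refl]) (simp only: q_def right_diff_distrib mult_ac)
    moreover have "(\<integral>t. real (Suc k) * (\<psi> (t - d k) - \<psi> t) * h (M t) \<partial>lborel) =
        (\<integral>t. real (Suc k) * (\<psi> (t - d k) * h (M t)) - real (Suc k) * (\<psi> t * h (M t)) \<partial>lborel)"
      by (rule Bochner_Integration.integral_cong[OF refl]) (simp only: right_diff_distrib left_diff_distrib mult_ac)
    ultimately show ?thesis using i1 i2 i3 by simp
  qed
  \<comment> \<open>The cutoff is shifted to the right by at most 1, because
    \<open>d k \<le> 1\<close>. This explains the interval \<open>{a..b + 1}\<close> in the
    dominating function.\<close>
  moreover have c3: "(\<lambda>k. \<integral>t. real (Suc k) * (\<psi> (t - d k) - \<psi> t) * h (M t) \<partial>lborel) \<longlonglongrightarrow> (\<integral>t. - \<psi>' t * h (M t) \<partial>lborel)"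
  proof (rule integral_dominated_convergence[where w = "\<lambda>t. P * D * indicator {a..b + 1} t"])
    show "AE t in lborel. (\<lambda>k. real (Suc k) * (\<psi> (t - d k) - \<psi> t) * h (M t)) \<longlonglongrightarrow> - \<psi>' t * h (M t)"
    proof (rule AE_I2)
      fix t
      have "filterlim (\<lambda>k. - d k) (at 0) sequentially"
        using tendsto_minus[OF d0] d(1) by (auto simp: filterlim_at less_imp_neq[THEN not_sym])
      from filterlim_compose[OF DERIV_D[OF \<psi>] this]
      have "(\<lambda>k. (\<psi> (t + - d k) - \<psi> t) / - d k) \<longlonglongrightarrow> \<psi>' t" .
      then have "(\<lambda>k. - ((\<psi> (t + - d k) - \<psi> t) / - d k)) \<longlonglongrightarrow> - \<psi>' t" by (rule tendsto_minus)
      moreover have "- ((\<psi> (t + - d k) - \<psi> t) / - d k) = real (Suc k) * (\<psi> (t - d k) - \<psi> t)" for k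
        unfolding d_def by (simp add: field_simps)
      ultimately show "(\<lambda>k. real (Suc k) * (\<psi> (t - d k) - \<psi> t) * h (M t)) \<longlonglongrightarrow> - \<psi>' t * h (M t)"
        by (intro tendsto_mult tendsto_const) simp
    qed
    have "integrable lborel (indicator {a..b + 1} :: real \<Rightarrow> real)" by (cases "a \<le> b + 1") auto
    then show "integrable lborel (\<lambda>t. P * D * indicator {a..b + 1} t)" by simp
    show "AE t in lborel. norm (real (Suc k) * (\<psi> (t - d k) - \<psi> t) * h (M t)) \<le> P * D * indicator {a..b + 1} t" for k
    proof (rule AE_I2)
      fix t
      show "norm (real (Suc k) * (\<psi> (t - d k) - \<psi> t) * h (M t)) \<le> P * D * indicator {a..b + 1} t"
      proof (cases "t \<in> {a..b + 1}")
        case True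
        have "\<bar>\<psi> (t - d k) - \<psi> t\<bar> \<le> P * d k"
          using field_differentiable_bound[of UNIV \<psi> \<psi>' P "t - d k" t] \<psi> P d(1)[of k] by simp
        then have "real (Suc k) * \<bar>\<psi> (t - d k) - \<psi> t\<bar> \<le> real (Suc k) * (P * d k)" by (intro mult_left_mono) auto
        also have "\<dots> = P * (real (Suc k) * d k)" by (simp only: mult_ac)
        finally have "real (Suc k) * \<bar>\<psi> (t - d k) - \<psi> t\<bar> \<le> P" unfolding d(3) by simp
        then have "real (Suc k) * \<bar>\<psi> (t - d k) - \<psi> t\<bar> * \<bar>h (M t)\<bar> \<le> P * D" using D P(1) by (intro mult_mono) auto
        then show ?thesis using True by (simp add: abs_mult)
      next
        case False
        then have "t \<notin> {a..b}" "t - d k \<notin> {a..b}" using d(1,2)[of k] by auto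
        then show ?thesis using False \<psi>_zero by simp
      qed
    qed
  qed measurable
  ultimately have "(\<integral>t. \<psi> t * (h' (M t) * - n t) \<partial>lborel) = (\<integral>t. - \<psi>' t * h (M t) \<partial>lborel)"
    by (intro LIMSEQ_unique[OF c1[unfolded c2] c3])
  then show ?thesis unfolding M_def by simp
qed

text \<open>Truncating \<open>n\<close> at height \<open>k\<close> gives bounded functions dominated
  by \<open>\<bar>n\<bar>\<close>. Their primitives converge at every point, and continuity of
  \<open>h\<close> and \<open>h'\<close> carries both sides to the limit.\<close>

lemma chain_rule:
  assumes n: "integrable lborel n"
  shows "(\<integral>t. \<psi>' t * h (c - primitive n t) \<partial>lborel) = (\<integral>t. \<psi> t * (h' (c - primitive n t) * n t) \<partial>lborel)"
proof -
  have [measurable]: "n \<in> borel_measurable borel" using borel_measurable_integrable[OF n] by simp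
  obtain P where P: "P \<ge> 0" "\<And>t. \<bar>\<psi> t\<bar> \<le> P" "\<And>t. \<bar>\<psi>' t\<bar> \<le> P" using bounded by blast
  define N where "N k t = max (- real k) (min (real k) (n t))" for k t
  have Nm [measurable]: "N k \<in> borel_measurable borel" for k unfolding N_def by measurable
  have Nle: "\<bar>N k t\<bar> \<le> \<bar>n t\<bar>" and Nk: "\<bar>N k t\<bar> \<le> real k" for k t unfolding N_def by auto
  have Ni: "integrable lborel (N k)" for k
    by (rule Bochner_Integration.integrable_bound[OF n]) (auto simp: Nle)
  have Nt: "(\<lambda>k. N k t) \<longlonglongrightarrow> n t" for t
  proof (rule tendsto_eventually)
    obtain k0 where k0: "\<bar>n t\<bar> \<le> real k0" using real_arch_simple by blast
    have "N k t = n t" if "k \<ge> k0" for k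
    proof -
      have "\<bar>n t\<bar> \<le> real k" using k0 that by linarith
      then show ?thesis unfolding N_def by linarith
    qed
    then show "\<forall>\<^sub>F k in sequentially. N k t = n t" using eventually_sequentially by blast
  qed
  have pt: "(\<lambda>k. primitive (N k) t) \<longlonglongrightarrow> primitive n t" for t
    unfolding primitive_def
  proof (rule integral_dominated_convergence[where w = "\<lambda>t. \<bar>n t\<bar>"])
    show "AE x in lborel. norm (indicator {..t} x * N k x) \<le> \<bar>n x\<bar>" for k
      using Nle by (auto simp: indicator_def)
  qed (use n Nt in \<open>auto intro!: tendsto_mult\<close>)
  define D where "D = \<bar>h c\<bar> + H * (\<integral>s. \<bar>n s\<bar> \<partial>lborel)"
  have D: "\<bar>h (c - primitive (N k) t)\<bar> \<le> D" for k t
  proof -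
    have "(\<integral>s. \<bar>N k s\<bar> \<partial>lborel) \<le> (\<integral>s. \<bar>n s\<bar> \<partial>lborel)"
      using Ni n Nle by (intro integral_mono) auto
    then have "H * (\<integral>s. \<bar>N k s\<bar> \<partial>lborel) \<le> H * (\<integral>s. \<bar>n s\<bar> \<partial>lborel)"
      by (rule mult_left_mono[OF _ H_nonneg])
    then show ?thesis using h_primitive_bounded[OF Ni, of c k t] unfolding D_def by linarith
  qed
  have D0: "D \<ge> 0" using D[of 0 0] by linarith
  have ch: "isCont h y" "isCont h' y" for y
    using h_cont h'_cont by (auto simp: continuous_on_eq_continuous_at)
  have "(\<lambda>k. \<integral>t. \<psi>' t * h (c - primitive (N k) t) \<partial>lborel) \<longlonglongrightarrow> (\<integral>t. \<psi>' t * h (c - primitive n t) \<partial>lborel)"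
  proof (rule integral_dominated_convergence[where w = "\<lambda>t. \<bar>\<psi>' t\<bar> * D"])
    show "AE t in lborel. (\<lambda>k. \<psi>' t * h (c - primitive (N k) t)) \<longlonglongrightarrow> \<psi>' t * h (c - primitive n t)"
      by (intro AE_I2 tendsto_intros isCont_tendsto_compose[OF ch(1)] pt)
    show "integrable lborel (\<lambda>t. \<bar>\<psi>' t\<bar> * D)"
      by (intro integrable_mult_left integrable_abs integrable_compact_bounded[of \<psi>' P a b]) (use P \<psi>'_zero in auto)
    show "AE t in lborel. norm (\<psi>' t * h (c - primitive (N k) t)) \<le> \<bar>\<psi>' t\<bar> * D" for k
      using D by (auto simp: abs_mult intro!: mult_left_mono)
  qed measurable
  moreover have "(\<lambda>k. \<integral>t. \<psi> t * (h' (c - primitive (N k) t) * N k t) \<partial>lborel) \<longlonglongrightarrow> (\<integral>t. \<psi> t * (h' (c - primitive n t) * n t) \<partial>lborel)"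
  proof (rule integral_dominated_convergence[where w = "\<lambda>t. P * (H * \<bar>n t\<bar>)"])
    show "AE t in lborel. (\<lambda>k. \<psi> t * (h' (c - primitive (N k) t) * N k t)) \<longlonglongrightarrow> \<psi> t * (h' (c - primitive n t) * n t)"
      by (intro AE_I2 tendsto_intros isCont_tendsto_compose[OF ch(2)] pt Nt)
    show "AE t in lborel. norm (\<psi> t * (h' (c - primitive (N k) t) * N k t)) \<le> P * (H * \<bar>n t\<bar>)" for k
      using P h'_bound Nle H_nonneg by (auto simp: abs_mult intro!: mult_mono)
  qed (use n in auto)
  moreover have "(\<integral>t. \<psi>' t * h (c - primitive (N k) t) \<partial>lborel) = (\<integral>t. \<psi> t * (h' (c - primitive (N k) t) * N k t) \<partial>lborel)" for k
    by (rule chain_rule_bounded[OF Ni Nk])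
  ultimately show ?thesis using LIMSEQ_unique by simp
qed

end

text \<open>A weak solution of \<open>m' = - n\<close> on \<open>(0,T)\<close> is \<open>c - \<integral> n\<close> almost everywhere, so the chain rule
  applies to it.\<close>

lemma weak_derivative_chain_rule:
  assumes T: "T > 0" and m: "integrable lborel m" and n: "integrable lborel n"
    and w: "\<And>\<eta> \<rho> a b. smooth \<eta> \<Longrightarrow> (\<And>t. (\<eta> has_real_derivative \<rho> t) (at t)) \<Longrightarrow> 0 < a \<Longrightarrow> b < T \<Longrightarrow>
      (\<And>t. t \<notin> {a..b} \<Longrightarrow> \<eta> t = 0) \<Longrightarrow> (\<integral>t. \<rho> t * m t \<partial>lborel) = (\<integral>t. \<eta> t * n t \<partial>lborel)"
    and C: "C1_chain \<psi> \<psi>' a b h h' H" and ab: "0 < a" "b < T"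
  shows "(\<integral>t. \<psi>' t * h (m t) \<partial>lborel) = (\<integral>t. \<psi> t * (h' (m t) * n t) \<partial>lborel)"
proof -
  interpret C1_chain \<psi> \<psi>' a b h h' H by (rule C)
  have [measurable]: "m \<in> borel_measurable borel" "n \<in> borel_measurable borel"
    using borel_measurable_integrable[OF m] borel_measurable_integrable[OF n] by auto
  \<comment> \<open>\<open>primitive n\<close> is bounded but in general not integrable over the
    line, hence the restriction to (0,T). The sum is constant there because the weak derivatives
    cancel.\<close>
  define g where "g t = indicator {0<..<T} t * (m t + primitive n t)" for t
  have ip: "integrable lborel (\<lambda>t. indicator {0<..<T} t * primitive n t)"
    by (rule integrable_compact_bounded[of _ "\<integral>s. \<bar>n s\<bar> \<partial>lborel" 0 T])
       (use primitive_bound[OF n] in \<open>auto simp: indicator_def\<close>)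
  have g: "integrable lborel g"
    unfolding g_def distrib_left using integrable_indicator_mult[OF m, of "{0<..<T}"] ip by simp
  have "\<exists>c. AE t in lborel. 0 < t \<longrightarrow> t < T \<longrightarrow> g t = c"
  proof (rule du_Bois_Reymond[OF T g])
    fix \<eta> \<rho> a b
    assume \<eta>: "smooth \<eta>" "\<And>t. (\<eta> has_real_derivative \<rho> t) (at t)" "0 < a" "b < T" "\<And>t. t \<notin> {a..b} \<Longrightarrow> \<eta> t = 0"
    have "deriv \<eta> = \<rho>" using \<eta>(2) DERIV_imp_deriv by blast
    then have c: "continuous_on UNIV \<rho>"
      using smooth_frechet[OF \<eta>(1), of 1] smooth_imp_continuous_on frechet_derivative_at[OF \<eta>(2)[unfolded has_field_derivative_def]]
      by (metis (no_types, lifting) continuous_on_cong mult_1_right)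
    \<comment> \<open>With the identity for \<open>h\<close>, the chain rule becomes integration by
      parts between the test function and \<open>primitive n\<close>.\<close>
    interpret e: C1_chain \<eta> \<rho> a b "\<lambda>y. y" "\<lambda>y. 1" 1
      by standard (use \<eta> c in auto)
    obtain P where P: "P \<ge> 0" "\<And>t. \<bar>\<eta> t\<bar> \<le> P" "\<And>t. \<bar>\<rho> t\<bar> \<le> P" using e.bounded by blast
    have i1: "integrable lborel (\<lambda>t. \<rho> t * m t)"
      by (rule Bochner_Integration.integrable_bound[OF integrable_mult_right[OF m, of P]])
         (use P in \<open>auto simp: abs_mult intro!: mult_right_mono\<close>)
    have i2: "integrable lborel (\<lambda>t. \<rho> t * primitive n t)"
      by (rule integrable_compact_bounded[of _ "P * (\<integral>s. \<bar>n s\<bar> \<partial>lborel)" a b])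
         (use primitive_bound[OF n] P e.\<psi>'_zero in \<open>auto simp: abs_mult intro!: mult_mono\<close>)
    have "(\<integral>t. \<rho> t * g t \<partial>lborel) = (\<integral>t. \<rho> t * m t + \<rho> t * primitive n t \<partial>lborel)"
    proof (rule Bochner_Integration.integral_cong[OF refl])
      fix t
      show "\<rho> t * g t = \<rho> t * m t + \<rho> t * primitive n t"
        using e.\<psi>'_zero[of t] \<eta>(3,4) by (cases "t \<in> {a..b}") (auto simp: g_def distrib_left)
    qed
    also have "\<dots> = (\<integral>t. \<rho> t * m t \<partial>lborel) + (\<integral>t. \<rho> t * primitive n t \<partial>lborel)" using i1 i2 by simp
    also have "(\<integral>t. \<rho> t * m t \<partial>lborel) = (\<integral>t. \<eta> t * n t \<partial>lborel)" by (rule w[OF \<eta>])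
    also have "(\<integral>t. \<rho> t * primitive n t \<partial>lborel) = - (\<integral>t. \<eta> t * n t \<partial>lborel)"
      using e.chain_rule[OF n, of 0] by simp
    finally show "(\<integral>t. \<rho> t * g t \<partial>lborel) = 0" by simp
  qed
  then obtain c where c: "AE t in lborel. 0 < t \<longrightarrow> t < T \<longrightarrow> g t = c" by blast
  then have m_eq: "AE t in lborel. t \<in> {a..b} \<longrightarrow> m t = c - primitive n t"
    by eventually_elim (use ab in \<open>auto simp: g_def\<close>)
  have "(\<integral>t. \<psi>' t * h (m t) \<partial>lborel) = (\<integral>t. \<psi>' t * h (c - primitive n t) \<partial>lborel)"
  proof (rule integral_cong_AE)
    show "AE t in lborel. \<psi>' t * h (m t) = \<psi>' t * h (c - primitive n t)"
      using m_eq by eventually_elim (use \<psi>'_zero in force)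
  qed measurable
  also have "\<dots> = (\<integral>t. \<psi> t * (h' (c - primitive n t) * n t) \<partial>lborel)" by (rule chain_rule[OF n])
  also have "\<dots> = (\<integral>t. \<psi> t * (h' (m t) * n t) \<partial>lborel)"
  proof (rule integral_cong_AE)
    show "AE t in lborel. \<psi> t * (h' (c - primitive n t) * n t) = \<psi> t * (h' (m t) * n t)"
      using m_eq by eventually_elim (use \<psi>_zero in force)
  qed measurable
  finally show ?thesis .
qed

subsection \<open>Test functions\<close>

lemma smooth_affine:
  fixes L :: "'a::euclidean_space \<Rightarrow> 'b::euclidean_space"
  assumes "smooth f" and L: "bounded_linear L"
  shows "smooth (\<lambda>z. f (L z + k))"
proof (rule smooth_coinduct[of _ "{\<lambda>z. g (L z + k) | g. smooth g}"])
  fix h assume "h \<in> {\<lambda>z. g (L z + k) | g. smooth g}"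
  then obtain g where h: "h = (\<lambda>z. g (L z + k))" and g: "smooth g" by blast
  have "(h has_derivative (\<lambda>v. frechet_derivative g (at (L z + k)) (L v))) (at z)" for z
    unfolding h by (rule has_derivative_compose[OF _ smooth_has_derivative[OF g], of "\<lambda>z. L z + k" L z UNIV])
      (auto intro!: derivative_eq_intros bounded_linear_imp_has_derivative[OF L])
  moreover have "(\<lambda>z. frechet_derivative g (at (L z + k)) (L v)) \<in> {\<lambda>z. g (L z + k) | g. smooth g}" for v
    by (intro CollectI exI[of _ "\<lambda>x. frechet_derivative g (at x) (L v)"] conjI refl smooth_frechet g)
  ultimately show "\<exists>D. (\<forall>x. (h has_derivative (\<lambda>v. D v x)) (at x)) \<and> (\<forall>v. D v \<in> {\<lambda>z. g (L z + k) | g. smooth g})"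
    by (intro exI[of _ "\<lambda>v z. frechet_derivative g (at (L z + k)) (L v)"]) blast
qed (use assms in blast)

text \<open>The lattice representative of \<open>x\<close> with coordinates in the half-open
  interval from \<open>- pi\<close> to \<open>pi\<close>. It reduces a bound on all of space to one
  on a compact cell, and later makes representatives periodic everywhere.\<close>

definition wrap :: "real ^ 'd \<Rightarrow> real ^ 'd" where
  "wrap x = (\<chi> i. x $ i - 2 * pi * of_int \<lfloor>(x $ i + pi) / (2 * pi)\<rfloor>)"

lemma wrap_cell: "wrap x \<in> torus_cell"
proof -
  have "\<bar>x $ i - 2 * pi * of_int \<lfloor>(x $ i + pi) / (2 * pi)\<rfloor>\<bar> \<le> pi" for i
  proof -
    let ?k = "of_int \<lfloor>(x $ i + pi) / (2 * pi)\<rfloor> :: real"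
    have p: "2 * pi > 0" by simp
    have "?k \<le> (x $ i + pi) / (2 * pi)" "(x $ i + pi) / (2 * pi) \<le> ?k + 1" by linarith+
    then have "?k * (2 * pi) \<le> x $ i + pi" "x $ i + pi \<le> (?k + 1) * (2 * pi)"
      by (simp_all only: pos_le_divide_eq[OF p] pos_divide_le_eq[OF p])
    then show ?thesis by (simp add: abs_le_iff algebra_simps)
  qed
  then show ?thesis by (simp add: torus_cell_iff wrap_def)
qed

lemma periodic_add_lattice:
  fixes x :: "real ^ 'd"
  assumes p: "periodic f"
  shows "f (x + (\<Sum>i\<in>UNIV. axis i (2 * pi * of_int (k i)))) = f x"
proof -
  have "f (x + (\<Sum>i\<in>S. axis i (2 * pi * of_int (k i)))) = f x" if "finite S" for S
    using that
  proof induction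
    case (insert i S)
    then have "f (x + (\<Sum>i\<in>insert i S. axis i (2 * pi * of_int (k i)))) =
        f ((x + (\<Sum>i\<in>S. axis i (2 * pi * of_int (k i)))) + axis i (2 * pi * of_int (k i)))"
      by (simp add: add_ac)
    then show ?case using insert periodic_axis_int[OF p] by simp
  qed simp
  then show ?thesis by simp
qed

lemma periodic_wrap:
  fixes x :: "real ^ 'd"
  assumes "periodic f"
  shows "f (wrap x) = f x"
proof -
  define k where "k i = - \<lfloor>(x $ i + pi) / (2 * pi)\<rfloor>" for i
  have "wrap x = x + (\<Sum>i\<in>UNIV. axis i (2 * pi * of_int (k i)))"
    unfolding wrap_def k_def by (simp add: vec_eq_iff axis_def sum.delta)
  then show ?thesis using periodic_add_lattice[OF assms, of x k] by simp
qed

lemma periodic_frechet: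
  assumes "smooth f" "periodic f"
  shows "periodic (\<lambda>x. frechet_derivative f (at x) v)"
  unfolding periodic_def
proof (intro allI)
  fix x i
  have "(\<lambda>x. f (x - - axis i (2 * pi))) = f" using assms(2) by (simp add: periodic_def)
  then show "frechet_derivative f (at (x + axis i (2 * pi))) v = frechet_derivative f (at x) v"
    using frechet_translate[OF assms(1), of "- axis i (2 * pi)" x] by simp
qed

locale test_function =
  fixes T :: real and \<phi> :: "real \<Rightarrow> real ^ 'd \<Rightarrow> real"
  assumes test: "test_fun T \<phi>"
begin

definition \<Phi> :: "real \<times> (real ^ 'd) \<Rightarrow> real" where "\<Phi> = (\<lambda>(t, x). \<phi> t x)"

definition \<phi>\<^sub>t :: "real \<Rightarrow> real ^ 'd \<Rightarrow> real" where "\<phi>\<^sub>t t x = deriv (\<lambda>s. \<phi> s x) t"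

lemma smooth_\<Phi>: "smooth \<Phi>"
  using test unfolding test_fun_def \<Phi>_def by simp

lemma periodic_\<phi>: "periodic (\<phi> t)"
  using test unfolding test_fun_def by simp

lemma smooth_space: "smooth (\<phi> t)"
proof -
  have "bounded_linear (\<lambda>x :: real ^ 'd. (0 :: real, x))" by (intro bounded_linear_Pair bounded_linear_zero bounded_linear_ident)
  from smooth_affine[OF smooth_\<Phi> this, of "(t, 0)"] show ?thesis by (simp add: \<Phi>_def)
qed

lemma smooth_time: "smooth (\<lambda>t. \<phi> t x)"
proof -
  have "bounded_linear (\<lambda>t :: real. (t, 0 :: real ^ 'd))" by (intro bounded_linear_Pair bounded_linear_zero bounded_linear_ident)
  from smooth_affine[OF smooth_\<Phi> this, of "(0, x)"] show ?thesis by (simp add: \<Phi>_def)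
qed

lemma \<phi>_DERIV: "((\<lambda>s. \<phi> s x) has_real_derivative \<phi>\<^sub>t t x) (at t)"
  unfolding \<phi>\<^sub>t_def by (rule smooth_real_DERIV[OF smooth_time])

text \<open>As a directional derivative of the joint function \<open>\<Phi>\<close>, the time
  derivative is jointly continuous; this supplies its measurability and its bound.\<close>

lemma \<phi>\<^sub>t_eq: "\<phi>\<^sub>t t x = frechet_derivative \<Phi> (at (t, x)) (1, 0)"
proof (rule frechet_directional[OF smooth_\<Phi>, symmetric])
  have "((\<lambda>s. t + s) has_real_derivative 1) (at 0)" by (auto intro!: derivative_eq_intros)
  then have "((\<lambda>s. \<phi> (t + s) x) has_real_derivative \<phi>\<^sub>t t x) (at 0)"
    using DERIV_chain2[of "\<lambda>s. \<phi> s x" "\<phi>\<^sub>t t x" "\<lambda>s. t + s" 0 1 UNIV] \<phi>_DERIV[of x t] by simp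
  then show "((\<lambda>s. \<Phi> ((t, x) + s *\<^sub>R (1, 0))) has_real_derivative \<phi>\<^sub>t t x) (at 0)"
    by (simp add: \<Phi>_def)
qed

lemma grad_eq: "grad (\<phi> t) x $ i = frechet_derivative \<Phi> (at (t, x)) (0, axis i 1)"
proof -
  have s: "((\<lambda>x. (t, x)) has_derivative (\<lambda>v. (0, v))) (at x)"
    by (auto intro!: derivative_eq_intros)
  have "((\<lambda>x. \<Phi> (t, x)) has_derivative (\<lambda>v. frechet_derivative \<Phi> (at (t, x)) (0, v))) (at x)"
    by (rule has_derivative_compose[OF s smooth_has_derivative[OF smooth_\<Phi>]])
  then have "(\<phi> t has_derivative (\<lambda>v. frechet_derivative \<Phi> (at (t, x)) (0, v))) (at x)" by (simp add: \<Phi>_def)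
  from frechet_derivative_at[OF this, symmetric] show ?thesis by (simp add: grad_def)
qed

lemma support: obtains a b where "0 < a" "b < T" "\<And>t x. t \<notin> {a..b} \<Longrightarrow> \<phi> t x = 0"
    "\<And>t x. t \<notin> {a..b} \<Longrightarrow> \<phi>\<^sub>t t x = 0" "\<And>t x. t \<notin> {a..b} \<Longrightarrow> grad (\<phi> t) x = 0"
proof -
  obtain a b where ab: "0 < a" "b < T" and z: "\<And>t x. t \<notin> {a..b} \<Longrightarrow> \<phi> t x = 0"
    using test unfolding test_fun_def by metis
  show ?thesis
  proof (rule that[OF ab z])
    fix t x assume t: "t \<notin> {a..b}"
    have "((\<lambda>s. 0) has_real_derivative 0) (at t)" by simp
    then have "((\<lambda>s. \<phi> s x) has_real_derivative 0) (at t)"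
      by (rule has_field_derivative_transform_within_open[where S = "- {a..b}"]) (use t z in auto)
    then show "\<phi>\<^sub>t t x = 0" using DERIV_unique[OF \<phi>_DERIV] by blast
    have "\<phi> t = (\<lambda>x. 0)" using z[OF t] by auto
    then show "grad (\<phi> t) x = 0" by (simp add: grad_def vec_eq_iff frechet_derivative_const)
  qed
qed

lemma measurable_\<phi> [measurable]:
  "(\<lambda>(t, x). \<phi> t x) \<in> borel_measurable (borel \<Otimes>\<^sub>M borel)"
  "(\<lambda>(t, x). \<phi>\<^sub>t t x) \<in> borel_measurable (borel \<Otimes>\<^sub>M borel)"
  "(\<lambda>(t, x). grad (\<phi> t) x) \<in> borel_measurable (borel \<Otimes>\<^sub>M borel)"
proof -
  have 1: "(\<lambda>(t, x). \<phi> t x) = \<Phi>" "(\<lambda>(t, x). \<phi>\<^sub>t t x) = (\<lambda>z. frechet_derivative \<Phi> (at z) (1, 0))"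
    by (auto simp: \<Phi>_def \<phi>\<^sub>t_eq)
  have 2: "(\<lambda>(t, x). grad (\<phi> t) x) = (\<lambda>z. \<chi> i. frechet_derivative \<Phi> (at z) (0, axis i 1))"
    by (auto simp: vec_eq_iff grad_eq)
  show "(\<lambda>(t, x). \<phi> t x) \<in> borel_measurable (borel \<Otimes>\<^sub>M borel)"
    "(\<lambda>(t, x). \<phi>\<^sub>t t x) \<in> borel_measurable (borel \<Otimes>\<^sub>M borel)"
    "(\<lambda>(t, x). grad (\<phi> t) x) \<in> borel_measurable (borel \<Otimes>\<^sub>M borel)"
    unfolding 1 2 borel_prod
    by (intro borel_measurable_continuous_onI continuous_on_vec_lambda smooth_imp_continuous_on smooth_frechet smooth_\<Phi>)+
qed

text \<open>Compactness of the support in time times the cell gives the bounds, periodicity extends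
  them to all of space, and the mean value inequality turns the bound on the gradient into the
  Lipschitz bound.\<close>

lemma bounds: obtains B where "B \<ge> 0" "\<And>t x. \<bar>\<phi> t x\<bar> \<le> B" "\<And>t x. \<bar>\<phi>\<^sub>t t x\<bar> \<le> B" "\<And>t x. norm (grad (\<phi> t) x) \<le> B"
  "\<And>t x w. \<bar>\<phi> t (x + w) - \<phi> t x\<bar> \<le> B * norm w"
proof -
  obtain a b where ab: "\<And>t x. t \<notin> {a..b} \<Longrightarrow> \<phi> t x = 0" "\<And>t x. t \<notin> {a..b} \<Longrightarrow> \<phi>\<^sub>t t x = 0"
    "\<And>t x. t \<notin> {a..b} \<Longrightarrow> grad (\<phi> t) x = 0" using support by metis
  have bd: "\<exists>C. \<forall>t x. \<bar>F (t, x)\<bar> \<le> C"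
    if c: "continuous_on UNIV F" and p: "\<And>t. periodic (\<lambda>x. F (t, x))" and z: "\<And>t x. t \<notin> {a..b} \<Longrightarrow> F (t, x) = 0"
    for F :: "real \<times> (real ^ 'd) \<Rightarrow> real"
  proof -
    have "bounded (F ` ({a..b} \<times> torus_cell))"
      unfolding torus_cell_def
      by (intro compact_imp_bounded compact_continuous_image continuous_on_subset[OF c] compact_Times) auto
    then obtain C where C: "\<And>t x. t \<in> {a..b} \<Longrightarrow> x \<in> torus_cell \<Longrightarrow> \<bar>F (t, x)\<bar> \<le> C"
      unfolding bounded_iff by (metis (no_types) SigmaI imageI real_norm_def)
    have "\<bar>F (t, x)\<bar> \<le> max C 0" for t x
    proof (cases "t \<in> {a..b}")
      case True
      have "F (t, x) = F (t, wrap x)" using periodic_wrap[OF p] by simp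
      then show ?thesis using C[OF True wrap_cell[of x]] by simp
    qed (use z in simp)
    then show ?thesis by blast
  qed
  have "\<exists>C. \<forall>t x. \<bar>\<Phi> (t, x)\<bar> \<le> C"
    by (rule bd) (use ab(1) periodic_\<phi> smooth_imp_continuous_on[OF smooth_\<Phi>] in \<open>auto simp: \<Phi>_def\<close>)
  then obtain C1 where C1: "\<And>t x. \<bar>\<phi> t x\<bar> \<le> C1" unfolding \<Phi>_def by auto
  have "\<exists>C. \<forall>t x. \<bar>frechet_derivative \<Phi> (at (t, x)) (1, 0)\<bar> \<le> C"
  proof (rule bd)
    have "\<phi>\<^sub>t t (x + axis i (2 * pi)) = \<phi>\<^sub>t t x" for t x i
      using periodic_\<phi> unfolding \<phi>\<^sub>t_def periodic_def by simp
    then show "periodic (\<lambda>x. frechet_derivative \<Phi> (at (t, x)) (1, 0))" for t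
      unfolding \<phi>\<^sub>t_eq[symmetric] periodic_def by simp
  qed (use ab(2) smooth_imp_continuous_on[OF smooth_frechet[OF smooth_\<Phi>]] in \<open>auto simp: \<phi>\<^sub>t_eq\<close>)
  then obtain C2 where C2: "\<And>t x. \<bar>\<phi>\<^sub>t t x\<bar> \<le> C2" unfolding \<phi>\<^sub>t_eq by blast
  have "\<exists>C. \<forall>t x. \<bar>frechet_derivative \<Phi> (at (t, x)) (0, axis i 1)\<bar> \<le> C" for i
  proof (rule bd)
    show "periodic (\<lambda>x. frechet_derivative \<Phi> (at (t, x)) (0, axis i 1))" for t
      using periodic_frechet[OF smooth_space periodic_\<phi>, of t "axis i 1"]
      unfolding grad_eq[symmetric] by (simp add: grad_def)
    show "frechet_derivative \<Phi> (at (t, x)) (0, axis i 1) = 0" if "t \<notin> {a..b}" for t x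
      using ab(3)[OF that, of x] unfolding grad_eq[symmetric] by simp
  qed (rule smooth_imp_continuous_on[OF smooth_frechet[OF smooth_\<Phi>]])
  then obtain C3 where C3: "\<And>i t x. \<bar>grad (\<phi> t) x $ i\<bar> \<le> C3 i" unfolding grad_eq by metis
  have C3': "norm (grad (\<phi> t) x) \<le> (\<Sum>i\<in>UNIV. C3 i)" for t x
    by (rule order_trans[OF norm_le_l1_cart sum_mono]) (rule C3)
  define B where "B = max 0 (max C1 (max C2 (\<Sum>i\<in>UNIV. C3 i)))"
  have B: "C1 \<le> B" "C2 \<le> B" "(\<Sum>i\<in>UNIV. C3 i) \<le> B" "0 \<le> B" unfolding B_def by auto
  have g: "norm (grad (\<phi> t) x) \<le> B" for t x using C3'[of t x] B by linarith
  have "\<bar>\<phi> t (x + w) - \<phi> t x\<bar> \<le> B * norm w" for t x w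
  proof -
    have "norm (\<phi> t (x + w) - \<phi> t x) \<le> B * norm ((x + w) - x)"
    proof (rule differentiable_bound[where S = UNIV and f' = "\<lambda>x. frechet_derivative (\<phi> t) (at x)"])
      show "onorm (frechet_derivative (\<phi> t) (at y)) \<le> B" for y
      proof (rule onorm_bound[OF B(4)])
        fix v
        have "\<bar>v \<bullet> grad (\<phi> t) y\<bar> \<le> norm v * norm (grad (\<phi> t) y)" by (rule Cauchy_Schwarz_ineq2)
        also have "\<dots> \<le> norm v * B" by (intro mult_left_mono g) auto
        finally show "norm (frechet_derivative (\<phi> t) (at y) v) \<le> B * norm v"
          by (simp add: frechet_eq_grad[OF smooth_space] mult.commute)
      qed
    qed (auto intro: smooth_has_derivative[OF smooth_space])
    then show ?thesis by simp
  qed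
  then show ?thesis using that[OF B(4) _ _ g] C1 C2 B by (meson order_trans)
qed

end

subsection \<open>Passing to the limit\<close>

definition tim :: "real \<Rightarrow> real measure" where
  "tim T = density lborel (indicator {0<..<T})"

lemma sets_tim [simp, measurable_cong]: "sets (tim T) = sets borel"
  by (simp add: tim_def)

lemma space_tim [simp]: "space (tim T) = UNIV"
  by (simp add: tim_def)

interpretation tim: finite_measure "tim T" for T
proof
  have "emeasure (tim T) UNIV = emeasure lborel {0<..<T}"
    unfolding tim_def by (subst emeasure_density) auto
  then show "emeasure (tim T) (space (tim T)) \<noteq> \<infinity>"
    by (cases "0 \<le> T") auto
qed

interpretation tim_tor: pair_sigma_finite "tim T" "tor :: (real ^ 'd) measure" for T
  by standard

lemma integral_tim:
  fixes f :: "real \<Rightarrow> real"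
  assumes "f \<in> borel_measurable borel"
  shows "(\<integral>t. f t \<partial>tim T) = (\<integral>t. indicator {0<..<T} t * f t \<partial>lborel)"
    and "integrable (tim T) f \<longleftrightarrow> integrable lborel (\<lambda>t. indicator {0<..<T} t * f t)"
  using integral_density[of f lborel "indicator {0<..<T}"] integrable_density[of f lborel "indicator {0<..<T}"] assms
  unfolding tim_def ennreal_indicator by simp_all

lemma integrable_bounded_mult:
  fixes F k :: "'a \<Rightarrow> real"
  assumes F: "integrable M F" and [measurable]: "k \<in> borel_measurable M" and k: "\<And>x. \<bar>k x\<bar> \<le> B"
  shows "integrable M (\<lambda>x. k x * F x)"
  by (rule Bochner_Integration.integrable_bound[OF integrable_mult_right[OF F, of B]])
     (use k borel_measurable_integrable[OF F] in \<open>auto simp: abs_mult intro!: AE_I2 mult_right_mono order_trans[OF k abs_ge_self]\<close>)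

text \<open>All data are Borel here. The Besov hypotheses have been condensed into
  \<open>slices\<close>, with one bound \<open>G\<close> per time; its integrability is where the
  exponents in time are spent.\<close>

locale transport =
  fixes T a b :: real and \<theta> :: "real \<Rightarrow> real ^ 'd \<Rightarrow> real" and u :: "real \<Rightarrow> real ^ 'd \<Rightarrow> real ^ 'd" and G :: "real \<Rightarrow> real"
  assumes T: "T > 0" and exponents: "0 < a" "2 * a + b > 1"
    and \<theta>_measurable [measurable]: "(\<lambda>(t, x). \<theta> t x) \<in> borel_measurable (borel \<Otimes>\<^sub>M borel)"
    and u_measurable [measurable]: "(\<lambda>(t, x). u t x) \<in> borel_measurable (borel \<Otimes>\<^sub>M borel)"
    and slices: "AE t in tim T. slice (\<theta> t) (u t) a b (G t)"
    and G_int: "integrable (tim T) G"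
    and \<theta>_int: "integrable (tim T \<Otimes>\<^sub>M tor) (\<lambda>(t, x). \<theta> t x)"
    and u_int: "integrable (tim T \<Otimes>\<^sub>M tor) (\<lambda>(t, x). u t x)"
    and \<theta>u_int: "integrable (tim T \<Otimes>\<^sub>M tor) (\<lambda>(t, x). \<theta> t x *\<^sub>R u t x)"
    and weak: "test_fun T \<phi> \<Longrightarrow>
      (\<integral>(t, x). (deriv (\<lambda>s. \<phi> s x) t + u t x \<bullet> grad (\<phi> t) x) * \<theta> t x \<partial>(tim T \<Otimes>\<^sub>M tor)) = 0"

locale transport_mollifier = transport T a b \<theta> u G + mollifier e K
  for T a b and \<theta> :: "real \<Rightarrow> real ^ 'd \<Rightarrow> real" and u G e and K :: "real ^ 'd \<Rightarrow> real"
begin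

definition m :: "real \<Rightarrow> real ^ 'd \<Rightarrow> real" where "m t x = conv K (\<theta> t) x"

definition N :: "real \<Rightarrow> real ^ 'd \<Rightarrow> real" where "N t x = div_conv K (\<lambda>y. \<theta> t y *\<^sub>R u t y) x"

lemma m_measurable [measurable]: "(\<lambda>(t, x). m t x) \<in> borel_measurable (borel \<Otimes>\<^sub>M borel)"
  unfolding m_def conv_def by measurable

lemma N_measurable [measurable]: "(\<lambda>(t, x). N t x) \<in> borel_measurable (borel \<Otimes>\<^sub>M borel)"
  unfolding N_def div_conv_def by measurable

lemma K\<theta>_int: "integrable (tim T \<Otimes>\<^sub>M tor) (\<lambda>(t, y). K (x - y) * \<theta> t y)"
proof -
  obtain B where B: "\<And>x. \<bar>K x\<bar> \<le> B" using trig_bounded[OF trig_K] by blast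
  have "integrable (tim T \<Otimes>\<^sub>M tor) (\<lambda>z. K (x - snd z) * (case z of (t, y) \<Rightarrow> \<theta> t y))"
    by (rule integrable_bounded_mult[OF \<theta>_int _ B]) measurable
  then show ?thesis by (simp add: case_prod_beta')
qed

lemma DK_le: obtains M where "M \<ge> 0" "\<And>t x y. \<bar>(\<theta> t y *\<^sub>R u t y) \<bullet> grad K (x - y)\<bar> \<le> M * norm (\<theta> t y *\<^sub>R u t y)"
proof -
  obtain M where M: "M \<ge> 0" "\<And>x. norm (grad K x) \<le> M" using grad_K_bounded by blast
  have "\<bar>(\<theta> t y *\<^sub>R u t y) \<bullet> grad K (x - y)\<bar> \<le> M * norm (\<theta> t y *\<^sub>R u t y)" for t x y
  proof -
    have "\<bar>(\<theta> t y *\<^sub>R u t y) \<bullet> grad K (x - y)\<bar> \<le> norm (\<theta> t y *\<^sub>R u t y) * norm (grad K (x - y))" by (rule Cauchy_Schwarz_ineq2)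
    also have "\<dots> \<le> norm (\<theta> t y *\<^sub>R u t y) * M" by (intro mult_left_mono M) auto
    finally show ?thesis by (simp only: mult.commute)
  qed
  then show ?thesis using that M(1) by blast
qed

lemma DK\<theta>u_int: "integrable (tim T \<Otimes>\<^sub>M tor) (\<lambda>(t, y). (\<theta> t y *\<^sub>R u t y) \<bullet> grad K (x - y))"
proof -
  obtain M where M: "M \<ge> 0" "\<And>t x y. \<bar>(\<theta> t y *\<^sub>R u t y) \<bullet> grad K (x - y)\<bar> \<le> M * norm (\<theta> t y *\<^sub>R u t y)" using DK_le by blast
  show ?thesis
  proof (rule Bochner_Integration.integrable_bound[OF integrable_mult_right[OF integrable_norm[OF \<theta>u_int], of M]])
    show "AE z in tim T \<Otimes>\<^sub>M tor. norm (case z of (t, y) \<Rightarrow> (\<theta> t y *\<^sub>R u t y) \<bullet> grad K (x - y)) \<le> norm (M * norm (case z of (t, x) \<Rightarrow> \<theta> t x *\<^sub>R u t x))"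
    proof (rule AE_I2)
      fix z
      show "norm (case z of (t, y) \<Rightarrow> (\<theta> t y *\<^sub>R u t y) \<bullet> grad K (x - y)) \<le> norm (M * norm (case z of (t, x) \<Rightarrow> \<theta> t x *\<^sub>R u t x))"
        using M(2)[where t = "fst z" and x = x and y = "snd z"] M(1) by (simp add: case_prod_beta' abs_mult)
    qed
  qed measurable
qed

lemma m_int: "integrable (tim T) (\<lambda>t. m t x)"
  using tim_tor.integrable_fst'[OF K\<theta>_int, of x] unfolding m_def conv_def by simp

lemma N_int: "integrable (tim T) (\<lambda>t. N t x)"
  using tim_tor.integrable_fst'[OF DK\<theta>u_int, of x] unfolding N_def div_conv_def by simp

text \<open>The equation is tested with the product of \<eta> and the kernel centred at
  \<open>x\<close>, a legitimate test function for every single \<open>x\<close>. Thus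
  \<open>m\<close> has weak time derivative \<open>- N\<close> at every point of space, without an
  exceptional set.\<close>

lemma weak_time:
  assumes \<eta>: "smooth \<eta>" "\<And>t. (\<eta> has_real_derivative \<rho> t) (at t)" "0 < c" "d < T" "\<And>t. t \<notin> {c..d} \<Longrightarrow> \<eta> t = 0"
  shows "(\<integral>t. \<rho> t * (indicator {0<..<T} t * m t x) \<partial>lborel) = (\<integral>t. \<eta> t * (indicator {0<..<T} t * N t x) \<partial>lborel)"
proof -
  define \<phi> where "\<phi> t y = \<eta> t * K (y - x)" for t y
  have sK: "smooth (\<lambda>y. K (y - x))" by (rule sep_smooth[OF trig_sep[OF trig_K]])
  have \<rho>: "\<rho> = (\<lambda>t. frechet_derivative \<eta> (at t) 1)"
    using frechet_derivative_at[OF \<eta>(2)[unfolded has_field_derivative_def]] by (metis mult_1_right)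
  have s\<rho>: "smooth \<rho>" unfolding \<rho> by (rule smooth_frechet[OF \<eta>(1)])
  have [measurable]: "\<eta> \<in> borel_measurable borel" "\<rho> \<in> borel_measurable borel"
    using smooth_measurable \<eta>(1) s\<rho> by auto
  have "test_fun T \<phi>"
    unfolding test_fun_def
  proof (intro conjI)
    have "smooth (\<lambda>z :: real \<times> (real ^ 'd). \<eta> (fst z + 0) * K (snd z + - x))"
      by (intro smooth_mult smooth_affine[OF \<eta>(1) bounded_linear_fst] smooth_affine[OF smooth_K bounded_linear_snd])
    then show "smooth (\<lambda>(t, x). \<phi> t x)" by (simp add: \<phi>_def case_prod_beta')
    show "\<forall>t. periodic (\<phi> t)"
      using periodic_shift[OF trig_periodic[OF trig_K], of "- x"] unfolding \<phi>_def periodic_def by simp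
    show "\<exists>a b. 0 < a \<and> b < T \<and> (\<forall>t x. t \<notin> {a..b} \<longrightarrow> \<phi> t x = 0)"
      using \<eta> unfolding \<phi>_def by (metis mult_zero_left)
  qed
  from weak[OF this]
  have w: "(\<integral>(t, y). (deriv (\<lambda>s. \<phi> s y) t + u t y \<bullet> grad (\<phi> t) y) * \<theta> t y \<partial>(tim T \<Otimes>\<^sub>M tor)) = 0" .
  have d: "deriv (\<lambda>s. \<phi> s y) t = \<rho> t * K (x - y)" for t y
  proof -
    have "((\<lambda>s. \<phi> s y) has_real_derivative \<rho> t * K (y - x)) (at t)"
      unfolding \<phi>_def by (rule DERIV_cmult_right[OF \<eta>(2)])
    then show ?thesis using DERIV_imp_deriv K_even[of "x - y"] by simp
  qed
  have g: "grad (\<phi> t) y = - \<eta> t *\<^sub>R grad K (x - y)" for t y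
  proof -
    have "((\<lambda>y. \<eta> t * K (y - x)) has_derivative (\<lambda>v. \<eta> t * frechet_derivative (\<lambda>y. K (y - x)) (at y) v)) (at y)"
      by (intro has_derivative_mult_right smooth_has_derivative sK)
    from frechet_derivative_at[OF this, symmetric]
    have "frechet_derivative (\<phi> t) (at y) = (\<lambda>v. \<eta> t * frechet_derivative K (at (y - x)) v)"
      unfolding \<phi>_def[abs_def] frechet_translate[OF smooth_K] .
    then have "grad (\<phi> t) y = \<eta> t *\<^sub>R grad K (y - x)" by (simp add: grad_def vec_eq_iff)
    then show ?thesis using grad_K_odd[of "x - y"] by simp
  qed
  obtain P where P: "\<And>t. \<bar>\<eta> t\<bar> \<le> P" "\<And>t. \<bar>\<rho> t\<bar> \<le> P"
  proof -
    interpret C1_cutoff \<eta> \<rho> c d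
      by standard (use \<eta> smooth_imp_continuous_on[OF s\<rho>] in auto)
    show ?thesis using bounded that by blast
  qed
  have i1: "integrable (tim T \<Otimes>\<^sub>M tor) (\<lambda>z. \<rho> (fst z) * (case z of (t, y) \<Rightarrow> K (x - y) * \<theta> t y))"
    by (rule integrable_bounded_mult[OF K\<theta>_int _ P(2)]) measurable
  have i2: "integrable (tim T \<Otimes>\<^sub>M tor) (\<lambda>z. \<eta> (fst z) * (case z of (t, y) \<Rightarrow> (\<theta> t y *\<^sub>R u t y) \<bullet> grad K (x - y)))"
    by (rule integrable_bounded_mult[OF DK\<theta>u_int _ P(1)]) measurable
  have "0 = (\<integral>z. \<rho> (fst z) * (case z of (t, y) \<Rightarrow> K (x - y) * \<theta> t y) -
      \<eta> (fst z) * (case z of (t, y) \<Rightarrow> (\<theta> t y *\<^sub>R u t y) \<bullet> grad K (x - y)) \<partial>(tim T \<Otimes>\<^sub>M tor))"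
    unfolding w[symmetric] d g by (intro Bochner_Integration.integral_cong) (auto simp: algebra_simps)
  also have "\<dots> = (\<integral>z. \<rho> (fst z) * (case z of (t, y) \<Rightarrow> K (x - y) * \<theta> t y) \<partial>(tim T \<Otimes>\<^sub>M tor)) -
      (\<integral>z. \<eta> (fst z) * (case z of (t, y) \<Rightarrow> (\<theta> t y *\<^sub>R u t y) \<bullet> grad K (x - y)) \<partial>(tim T \<Otimes>\<^sub>M tor))"
    by (rule Bochner_Integration.integral_diff[OF i1 i2])
  also have "(\<integral>z. \<rho> (fst z) * (case z of (t, y) \<Rightarrow> K (x - y) * \<theta> t y) \<partial>(tim T \<Otimes>\<^sub>M tor)) = (\<integral>t. \<rho> t * m t x \<partial>tim T)"
    using tim_tor.integral_fst'[OF i1] unfolding m_def conv_def by simp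
  also have "(\<integral>z. \<eta> (fst z) * (case z of (t, y) \<Rightarrow> (\<theta> t y *\<^sub>R u t y) \<bullet> grad K (x - y)) \<partial>(tim T \<Otimes>\<^sub>M tor)) = (\<integral>t. \<eta> t * N t x \<partial>tim T)"
    using tim_tor.integral_fst'[OF i2] unfolding N_def div_conv_def by simp
  finally show ?thesis
    by (simp add: integral_tim(1) mult.left_commute)
qed

context
  fixes \<phi> :: "real \<Rightarrow> real ^ 'd \<Rightarrow> real" and \<xi> c :: real
  assumes test: "test_fun T \<phi>"
begin

interpretation test_function T \<phi> by standard (rule test)

text \<open>Formally the time derivative of \<open>\<phi> t x * sin (\<xi> * m t x + c)\<close>,
  with \<open>- N\<close> inserted for the derivative of \<open>m\<close>; hence its integral over
  time vanishes at every \<open>x\<close>.\<close>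

definition Z :: "real \<Rightarrow> real ^ 'd \<Rightarrow> real" where
  "Z t x = deriv (\<lambda>s. \<phi> s x) t * sin (\<xi> * m t x + c) - \<phi> t x * (\<xi> * cos (\<xi> * m t x + c)) * N t x"

lemma Z_eq: "Z t x = \<phi>\<^sub>t t x * sin (\<xi> * m t x + c) - \<phi> t x * (\<xi> * cos (\<xi> * m t x + c)) * N t x"
  unfolding Z_def \<phi>\<^sub>t_def ..

lemma Z_measurable [measurable]: "(\<lambda>(t, x). Z t x) \<in> borel_measurable (borel \<Otimes>\<^sub>M borel)"
  unfolding Z_eq by measurable

lemma integral_Z_time: "(\<integral>t. Z t x \<partial>tim T) = 0"
proof -
  obtain d1 d2 where d: "0 < d1" "d2 < T" "\<And>t x. t \<notin> {d1..d2} \<Longrightarrow> \<phi> t x = 0" "\<And>t x. t \<notin> {d1..d2} \<Longrightarrow> \<phi>\<^sub>t t x = 0"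
    using support by metis
  obtain B where B: "B \<ge> 0" "\<And>t x. \<bar>\<phi> t x\<bar> \<le> B" "\<And>t x. \<bar>\<phi>\<^sub>t t x\<bar> \<le> B" using bounds by metis
  define m0 where "m0 t = indicator {0<..<T} t * m t x" for t
  define N0 where "N0 t = indicator {0<..<T} t * N t x" for t
  have i: "integrable lborel m0" "integrable lborel N0"
    using m_int[of x] N_int[of x] unfolding m0_def N0_def by (simp_all add: integral_tim(2))
  have mm [measurable]: "m0 \<in> borel_measurable borel" "N0 \<in> borel_measurable borel"
    using borel_measurable_integrable[OF i(1)] borel_measurable_integrable[OF i(2)] by auto
  have ch: "C1_chain (\<lambda>t. \<phi> t x) (\<lambda>t. \<phi>\<^sub>t t x) d1 d2 (\<lambda>y. sin (\<xi> * y + c)) (\<lambda>y. \<xi> * cos (\<xi> * y + c)) \<bar>\<xi>\<bar>"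
  proof
    show "((\<lambda>t. \<phi> t x) has_real_derivative \<phi>\<^sub>t t x) (at t)" for t by (rule \<phi>_DERIV)
    have "continuous_on UNIV (\<lambda>t. frechet_derivative \<Phi> (at (t, x)) (1, 0))"
      by (rule continuous_on_compose2[OF smooth_imp_continuous_on[OF smooth_frechet[OF smooth_\<Phi>], where S = UNIV]])
         (auto intro!: continuous_intros)
    then show "continuous_on UNIV (\<lambda>t. \<phi>\<^sub>t t x)" by (simp add: \<phi>\<^sub>t_eq)
    show "\<phi> t x = 0" if "t \<notin> {d1..d2}" for t by (rule d(3)[OF that])
    show "((\<lambda>y. sin (\<xi> * y + c)) has_real_derivative \<xi> * cos (\<xi> * y + c)) (at y)" for y
      by (auto intro!: derivative_eq_intros)
    show "continuous_on UNIV (\<lambda>y. \<xi> * cos (\<xi> * y + c))" by (intro continuous_intros)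
    show "\<bar>\<xi> * cos (\<xi> * y + c)\<bar> \<le> \<bar>\<xi>\<bar>" for y by (simp add: abs_mult mult_left_le)
  qed
  have ph [measurable]: "(\<lambda>t. \<phi> t x) \<in> borel_measurable borel" "(\<lambda>t. \<phi>\<^sub>t t x) \<in> borel_measurable borel"
    by measurable
  have "(\<integral>t. \<phi>\<^sub>t t x * sin (\<xi> * m0 t + c) \<partial>lborel) = (\<integral>t. \<phi> t x * (\<xi> * cos (\<xi> * m0 t + c) * N0 t) \<partial>lborel)"
    by (rule weak_derivative_chain_rule[OF T i _ ch d(1,2)]) (unfold m0_def N0_def, rule weak_time)
  moreover have "integrable lborel (\<lambda>t. \<phi>\<^sub>t t x * sin (\<xi> * m0 t + c))"
    by (rule integrable_compact_bounded[of _ B d1 d2])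
       (measurable, use B d in \<open>auto simp: abs_mult intro!: order_trans[OF mult_left_le]\<close>)
  moreover have "integrable lborel (\<lambda>t. \<phi> t x * (\<xi> * cos (\<xi> * m0 t + c)) * N0 t)"
  proof (rule integrable_bounded_mult[OF i(2)])
    fix t
    have "\<bar>\<xi> * cos (\<xi> * m0 t + c)\<bar> \<le> \<bar>\<xi>\<bar>" by (simp add: abs_mult mult_left_le)
    then show "\<bar>\<phi> t x * (\<xi> * cos (\<xi> * m0 t + c))\<bar> \<le> B * \<bar>\<xi>\<bar>"
      unfolding abs_mult[of "\<phi> t x"] using B by (intro mult_mono) auto
  qed measurable
  ultimately have "(\<integral>t. \<phi>\<^sub>t t x * sin (\<xi> * m0 t + c) - \<phi> t x * (\<xi> * cos (\<xi> * m0 t + c)) * N0 t \<partial>lborel) = 0"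
    by (simp add: mult.assoc)
  moreover have "indicator {0<..<T} t * Z t x = \<phi>\<^sub>t t x * sin (\<xi> * m0 t + c) - \<phi> t x * (\<xi> * cos (\<xi> * m0 t + c)) * N0 t" for t
  proof (cases "t \<in> {0<..<T}")
    case False
    then have "t \<notin> {d1..d2}" using d(1,2) by auto
    then show ?thesis using False d(3,4) by simp
  qed (simp add: Z_eq m0_def N0_def)
  ultimately show ?thesis by (simp add: integral_tim(1))
qed

text \<open>Needed for Fubini. Since \<open>grad K\<close> is bounded, \<open>N t x\<close> is
  bounded uniformly in \<open>x\<close> by a multiple of the spatial integral of
  \<open>norm (\<theta> t y *\<^sub>R u t y)\<close>, which is integrable in time.\<close>

lemma Z_int: "integrable (tim T \<Otimes>\<^sub>M tor) (\<lambda>(t, x). Z t x)"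
proof -
  obtain B where B: "B \<ge> 0" "\<And>t x. \<bar>\<phi> t x\<bar> \<le> B" "\<And>t x. \<bar>\<phi>\<^sub>t t x\<bar> \<le> B" using bounds by metis
  obtain M where M: "M \<ge> 0" "\<And>t x y. \<bar>(\<theta> t y *\<^sub>R u t y) \<bullet> grad K (x - y)\<bar> \<le> M * norm (\<theta> t y *\<^sub>R u t y)" using DK_le by blast
  define W where "W t = (\<integral>y. norm (\<theta> t y *\<^sub>R u t y) \<partial>tor)" for t
  have nint: "integrable (tim T \<Otimes>\<^sub>M tor) (\<lambda>(t, y). norm (\<theta> t y *\<^sub>R u t y))"
    using integrable_norm[OF \<theta>u_int] by (simp add: case_prod_beta')
  have Wi: "integrable (tim T) W" unfolding W_def using tim_tor.integrable_fst'[OF nint] by simp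
  have Wp: "integrable (tim T \<Otimes>\<^sub>M tor) (\<lambda>(t, x :: real ^ 'd). W t)"
  proof -
    have W0: "W t \<ge> 0" for t unfolding W_def by simp
    have [measurable]: "W \<in> borel_measurable borel" using borel_measurable_integrable[OF Wi] by simp
    have "(\<integral>\<^sup>+z. ennreal (norm (case z of (t, x :: real ^ 'd) \<Rightarrow> W t)) \<partial>(tim T \<Otimes>\<^sub>M tor)) = (\<integral>\<^sup>+t. \<integral>\<^sup>+(x :: real ^ 'd). ennreal (W t) \<partial>tor \<partial>tim T)"
      using W0 by (subst tor.nn_integral_fst[symmetric]) auto
    also have "\<dots> = (\<integral>\<^sup>+t. ennreal (W t) \<partial>tim T) * emeasure (tor :: (real ^ 'd) measure) UNIV"
      by (simp add: nn_integral_multc)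
    also have "\<dots> < \<infinity>"
      using Wi W0 unfolding integrable_iff_bounded emeasure_tor
      by (auto simp: ennreal_mult_less_top)
    finally show ?thesis by (intro integrableI_bounded) measurable
  qed
  have i: "integrable (tim T \<Otimes>\<^sub>M tor) (\<lambda>z. B + B * \<bar>\<xi>\<bar> * (M * (case z of (t, x :: real ^ 'd) \<Rightarrow> W t)))"
  proof (intro Bochner_Integration.integrable_add integrable_mult_right Wp)
    have "finite_measure (tim T \<Otimes>\<^sub>M (tor :: (real ^ 'd) measure))"
      by (rule finite_measure_pair_measure) (rule tim.finite_measure_axioms tor.finite_measure_axioms)+
    then show "integrable (tim T \<Otimes>\<^sub>M (tor :: (real ^ 'd) measure)) (\<lambda>z. B)" by (rule finite_measure.integrable_const)
  qed
  show ?thesis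
  proof (rule Bochner_Integration.integrable_bound[OF i])
    have "AE t in tim T. integrable tor (\<lambda>y. norm (\<theta> t y *\<^sub>R u t y))"
      using tim_tor.AE_integrable_fst'[OF nint] by simp
    then have "AE t in tim T. \<forall>x. \<bar>Z t x\<bar> \<le> B + B * \<bar>\<xi>\<bar> * (M * W t)"
    proof eventually_elim
      case (elim t)
      show ?case
      proof
        fix x
        have NW: "\<bar>N t x\<bar> \<le> M * W t"
        proof -
          have [measurable]: "(\<lambda>y. \<theta> t y *\<^sub>R u t y) \<in> borel_measurable borel" by measurable
          have "\<bar>N t x\<bar> \<le> (\<integral>y. \<bar>(\<theta> t y *\<^sub>R u t y) \<bullet> grad K (x - y)\<bar> \<partial>tor)"
            unfolding N_def div_conv_def by (rule integral_abs_bound)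
          also have "\<dots> \<le> (\<integral>y. M * norm (\<theta> t y *\<^sub>R u t y) \<partial>tor)"
          proof (rule integral_mono_AE')
            show "integrable tor (\<lambda>y. M * norm (\<theta> t y *\<^sub>R u t y))" using elim by simp
          qed (use M in auto)
          also have "\<dots> = M * W t" unfolding W_def using elim by simp
          finally show ?thesis .
        qed
        have W0: "W t \<ge> 0" unfolding W_def by simp
        have "\<bar>\<phi>\<^sub>t t x * sin (\<xi> * m t x + c)\<bar> \<le> B"
          unfolding abs_mult using B(3)[of t x] mult_mono[OF B(3)[of t x] abs_sin_le_one[of "\<xi> * m t x + c"]] B(1) by simp
        moreover have "\<bar>\<phi> t x * (\<xi> * cos (\<xi> * m t x + c)) * N t x\<bar> \<le> B * \<bar>\<xi>\<bar> * (M * W t)"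
        proof -
          have "\<bar>\<xi> * cos (\<xi> * m t x + c)\<bar> \<le> \<bar>\<xi>\<bar>" by (simp add: abs_mult mult_left_le)
          then show ?thesis unfolding abs_mult[of _ "N t x"] abs_mult[of "\<phi> t x"]
            using B NW M(1) W0 by (intro mult_mono mult_nonneg_nonneg) auto
        qed
        ultimately show "\<bar>Z t x\<bar> \<le> B + B * \<bar>\<xi>\<bar> * (M * W t)" unfolding Z_eq by linarith
      qed
    qed
    then have "AE t in tim T. AE x in (tor :: (real ^ 'd) measure). norm (case (t, x) of (t, x) \<Rightarrow> Z t x) \<le> norm (B + B * \<bar>\<xi>\<bar> * (M * (case (t, x) of (t, x) \<Rightarrow> W t)))"
      by eventually_elim (auto intro: order_trans[OF _ abs_ge_self])
    moreover have [measurable]: "W \<in> borel_measurable borel" using borel_measurable_integrable[OF Wi] by simp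
    ultimately show "AE z in tim T \<Otimes>\<^sub>M (tor :: (real ^ 'd) measure). norm (case z of (t, x) \<Rightarrow> Z t x) \<le> norm (B + B * \<bar>\<xi>\<bar> * (M * (case z of (t, x) \<Rightarrow> W t)))"
      by (intro tim_tor.AE_pair_measure) measurable
  qed measurable
qed

lemma integral_Z: "(\<integral>t. \<integral>x. Z t x \<partial>tor \<partial>tim T) = 0"
proof -
  have "(\<integral>x. \<integral>t. Z t x \<partial>tim T \<partial>tor) = (\<integral>t. \<integral>x. Z t x \<partial>tor \<partial>tim T)"
    by (rule tim_tor.Fubini_integral) (use Z_int in simp)
  then show ?thesis by (simp add: integral_Z_time)
qed

definition E :: "real \<Rightarrow> real ^ 'd \<Rightarrow> real" where
  "E t x = (deriv (\<lambda>s. \<phi> s x) t + u t x \<bullet> grad (\<phi> t) x) * sin (\<xi> * \<theta> t x + c)"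

lemma test_weight_int: "integrable (tim T \<Otimes>\<^sub>M tor) (\<lambda>(t, x). deriv (\<lambda>s. \<phi> s x) t + u t x \<bullet> grad (\<phi> t) x)"
proof -
  obtain B where B: "B \<ge> 0" "\<And>t x. \<bar>\<phi>\<^sub>t t x\<bar> \<le> B" "\<And>t x. norm (grad (\<phi> t) x) \<le> B" using bounds by metis
  have fin: "finite_measure (tim T \<Otimes>\<^sub>M (tor :: (real ^ 'd) measure))"
    by (rule finite_measure_pair_measure) (rule tim.finite_measure_axioms tor.finite_measure_axioms)+
  have i1: "integrable (tim T \<Otimes>\<^sub>M tor) (\<lambda>(t, x). \<phi>\<^sub>t t x)"
    by (rule finite_measure.integrable_const_bound[OF fin, of _ B]) (use B in auto)
  have i2: "integrable (tim T \<Otimes>\<^sub>M tor) (\<lambda>(t, x). u t x \<bullet> grad (\<phi> t) x)"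
  proof (rule Bochner_Integration.integrable_bound[OF integrable_mult_right[OF integrable_norm[OF u_int], of B]])
    show "AE z in tim T \<Otimes>\<^sub>M tor. norm (case z of (t, x) \<Rightarrow> u t x \<bullet> grad (\<phi> t) x) \<le> norm (B * norm (case z of (t, x) \<Rightarrow> u t x))"
    proof (rule AE_I2)
      fix z :: "real \<times> (real ^ 'd)"
      obtain t x where z: "z = (t, x)" by (cases z)
      have "\<bar>u t x \<bullet> grad (\<phi> t) x\<bar> \<le> norm (u t x) * norm (grad (\<phi> t) x)" by (rule Cauchy_Schwarz_ineq2)
      also have "\<dots> \<le> norm (u t x) * B" using B by (intro mult_left_mono) auto
      finally show "norm (case z of (t, x) \<Rightarrow> u t x \<bullet> grad (\<phi> t) x) \<le> norm (B * norm (case z of (t, x) \<Rightarrow> u t x))"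
        using B(1) by (simp add: z abs_mult mult.commute)
    qed
  qed measurable
  show ?thesis
    using Bochner_Integration.integrable_add[OF i1 i2] unfolding \<phi>\<^sub>t_def by (simp add: case_prod_beta')
qed

lemma E_int: "integrable (tim T \<Otimes>\<^sub>M tor) (\<lambda>(t, x). E t x)"
proof -
  have "integrable (tim T \<Otimes>\<^sub>M tor) (\<lambda>z. sin (\<xi> * \<theta> (fst z) (snd z) + c) * (case z of (t, x) \<Rightarrow> deriv (\<lambda>s. \<phi> s x) t + u t x \<bullet> grad (\<phi> t) x))"
  proof (rule integrable_bounded_mult[OF test_weight_int, of _ 1])
    have [measurable]: "(\<lambda>z. \<theta> (fst z) (snd z)) \<in> borel_measurable (tim T \<Otimes>\<^sub>M tor)"
      using borel_measurable_integrable[OF \<theta>_int] by (simp add: case_prod_beta')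
    show "(\<lambda>z. sin (\<xi> * \<theta> (fst z) (snd z) + c)) \<in> borel_measurable (tim T \<Otimes>\<^sub>M tor)"
      by measurable
  qed simp
  then show ?thesis by (simp add: E_def case_prod_beta' mult.commute)
qed

text \<open>The cancellation of \<open>Z\<close> takes place in time at each point, the slice
  estimate in space at each time. Fubini, in the form of \<open>integral_Z\<close>, allows the
  difference of \<open>E\<close> and \<open>Z\<close> to be estimated while \<open>Z\<close>
  contributes nothing.\<close>

lemma integral_E_le:
  assumes B: "\<And>t x. \<bar>\<phi> t x\<bar> \<le> B" "\<And>t x. \<bar>deriv (\<lambda>s. \<phi> s x) t\<bar> \<le> B" "\<And>t x. norm (grad (\<phi> t) x) \<le> B"
    "\<And>t x w. \<bar>\<phi> t (x + w) - \<phi> t x\<bar> \<le> B * norm w"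
  shows "\<bar>\<integral>(t, x). (deriv (\<lambda>s. \<phi> s x) t + u t x \<bullet> grad (\<phi> t) x) * sin (\<xi> * \<theta> t x + c) \<partial>(tim T \<Otimes>\<^sub>M tor)\<bar>
    \<le> (\<integral>t. G t \<partial>tim T) * (S_const TYPE('d) B \<xi> * (real CARD('d) * kk_const TYPE('d) * e powr (2 * a + b - 1)) + 2 * (B * \<bar>\<xi>\<bar> * (kk_const TYPE('d) * e powr a)))"
    (is "_ \<le> _ * ?R")
proof -
  have iE: "integrable (tim T) (\<lambda>t. \<integral>x. E t x \<partial>tor)" and iZ: "integrable (tim T) (\<lambda>t. \<integral>x. Z t x \<partial>tor)"
    using tim_tor.integrable_fst'[OF E_int] tim_tor.integrable_fst'[OF Z_int] by simp_all
  have "AE t in tim T. \<bar>(\<integral>x. E t x \<partial>tor) - (\<integral>x. Z t x \<partial>tor)\<bar> \<le> G t * ?R"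
    using slices
  proof eventually_elim
    case (elim t)
    interpret S: slice_mollifier "\<theta> t" "u t" a b "G t" e K
      by (rule slice_mollifier.intro[OF elim mollifier_axioms])
    have [measurable]: "\<phi>\<^sub>t t \<in> borel_measurable borel" by measurable
    have "\<bar>(\<integral>x. (\<phi>\<^sub>t t x + u t x \<bullet> grad (\<phi> t) x) * sin (\<xi> * \<theta> t x + c) \<partial>tor) -
      (\<integral>x. \<phi>\<^sub>t t x * sin (\<xi> * conv K (\<theta> t) x + c) - \<phi> t x * (\<xi> * cos (\<xi> * conv K (\<theta> t) x + c)) * div_conv K (\<lambda>y. \<theta> t y *\<^sub>R u t y) x \<partial>tor)\<bar> \<le> G t * ?R"
      by (rule S.slice_estimate[where \<phi> = "\<phi> t", OF smooth_space periodic_\<phi> B(1) B(4) B(3) refl])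
         (measurable, use B(2) in \<open>simp add: \<phi>\<^sub>t_def\<close>)
    then show ?case unfolding E_def Z_eq m_def N_def \<phi>\<^sub>t_def .
  qed
  then have "(\<integral>t. \<bar>(\<integral>x. E t x \<partial>tor) - (\<integral>x. Z t x \<partial>tor)\<bar> \<partial>tim T) \<le> (\<integral>t. G t * ?R \<partial>tim T)"
    by (intro integral_mono_AE) (use iE iZ G_int in auto)
  moreover have "\<bar>\<integral>t. ((\<integral>x. E t x \<partial>tor) - (\<integral>x. Z t x \<partial>tor)) \<partial>tim T\<bar> \<le> (\<integral>t. \<bar>(\<integral>x. E t x \<partial>tor) - (\<integral>x. Z t x \<partial>tor)\<bar> \<partial>tim T)"
    by (rule integral_abs_bound)
  moreover have "(\<integral>t. ((\<integral>x. E t x \<partial>tor) - (\<integral>x. Z t x \<partial>tor)) \<partial>tim T) = (\<integral>(t, x). E t x \<partial>(tim T \<Otimes>\<^sub>M tor))"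
    using iE iZ integral_Z tim_tor.integral_fst'[OF E_int] by simp
  ultimately show ?thesis unfolding E_def by simp
qed

end

end

context transport
begin

text \<open>The integral does not depend on the mollifier, and its bound tends to 0 with the scale
  because both exponents, \<open>a\<close> and \<open>2 * a + b - 1\<close>, are positive.\<close>

lemma integral_sin_eq_0:
  assumes test: "test_fun T \<phi>"
  shows "(\<integral>(t, x). (deriv (\<lambda>s. \<phi> s x) t + u t x \<bullet> grad (\<phi> t) x) * sin (\<xi> * \<theta> t x + c) \<partial>(tim T \<Otimes>\<^sub>M tor)) = 0"
    (is "?I = 0")
proof -
  interpret test_function T \<phi> by standard (rule test)
  obtain B where B: "\<And>t x. \<bar>\<phi> t x\<bar> \<le> B" "\<And>t x. \<bar>deriv (\<lambda>s. \<phi> s x) t\<bar> \<le> B" "\<And>t x. norm (grad (\<phi> t) x) \<le> B"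
    "\<And>t x w. \<bar>\<phi> t (x + w) - \<phi> t x\<bar> \<le> B * norm w" using bounds unfolding \<phi>\<^sub>t_def by metis
  define R where "R e = (\<integral>t. G t \<partial>tim T) * (S_const TYPE('d) B \<xi> * (real CARD('d) * kk_const TYPE('d) * e powr (2 * a + b - 1))
    + 2 * (B * \<bar>\<xi>\<bar> * (kk_const TYPE('d) * e powr a)))" for e
  have bd: "\<bar>?I\<bar> \<le> R (1 / sqrt (real n))" if n: "n \<ge> 2" for n
  proof -
    obtain K :: "real ^ 'd \<Rightarrow> real" where "mollifier (1 / sqrt (real n)) K" using mollifier_exists[OF n refl] by blast
    then interpret transport_mollifier T a b \<theta> u G "1 / sqrt (real n)" K
      by (intro transport_mollifier.intro transport_axioms)
    show ?thesis unfolding R_def by (rule integral_E_le[OF test B])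
  qed
  have e0: "(\<lambda>n. 1 / sqrt (real n)) \<longlonglongrightarrow> 0"
    by (intro tendsto_divide_0[OF tendsto_const] filterlim_at_top_imp_at_infinity
        filterlim_compose[OF sqrt_at_top filterlim_real_sequentially])
  have p0: "(\<lambda>n. (1 / sqrt (real n)) powr s) \<longlonglongrightarrow> 0" if "s > 0" for s :: real
    using tendsto_powr2[OF e0 tendsto_const[of s]] that by simp
  have "(\<lambda>n. R (1 / sqrt (real n))) \<longlonglongrightarrow> (\<integral>t. G t \<partial>tim T) * (S_const TYPE('d) B \<xi> * (real CARD('d) * kk_const TYPE('d) * 0)
    + 2 * (B * \<bar>\<xi>\<bar> * (kk_const TYPE('d) * 0)))"
    unfolding R_def using exponents by (intro tendsto_mult tendsto_add tendsto_const p0) auto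
  then have R0: "(\<lambda>n. R (1 / sqrt (real n))) \<longlonglongrightarrow> 0" by simp
  have "\<bar>?I\<bar> \<le> 0"
    by (rule tendsto_lowerbound[OF R0]) (use bd in \<open>auto intro!: eventually_sequentiallyI[of 2]\<close>)
  then show ?thesis by simp
qed

end

subsection \<open>From characters to arbitrary functions of the solution\<close>

lemma real_distribution_weighted:
  fixes w :: "'a \<Rightarrow> real"
  assumes w: "integrable M w" and w0: "\<And>x. w x \<ge> 0" and s: "(\<integral>x. w x \<partial>M) = 1"
    and [measurable]: "\<theta> \<in> borel_measurable M"
  shows "real_distribution (distr (density M w) borel \<theta>)"
proof -
  have [measurable]: "w \<in> borel_measurable M" using w by simp
  have "emeasure (density M w) (space M) = (\<integral>\<^sup>+x. ennreal (w x) \<partial>M)"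
    by (subst emeasure_density) (auto intro!: nn_integral_cong)
  also have "\<dots> = 1" using w w0 s by (simp add: nn_integral_eq_integral)
  finally have "prob_space (density M w)" by (intro prob_spaceI) simp
  then show ?thesis
    by (intro real_distribution.intro prob_space.prob_space_distr real_distribution_axioms.intro) auto
qed

lemma integral_weighted_distr:
  fixes w :: "'a \<Rightarrow> real" and g :: "real \<Rightarrow> 'b::{banach, second_countable_topology}"
  assumes [measurable]: "w \<in> borel_measurable M" "\<theta> \<in> borel_measurable M" "g \<in> borel_measurable borel" and w0: "\<And>x. w x \<ge> 0"
  shows "(\<integral>y. g y \<partial>(distr (density M w) borel \<theta>)) = (\<integral>x. w x *\<^sub>R g (\<theta> x) \<partial>M)"
proof -
  have "(\<integral>y. g y \<partial>(distr (density M w) borel \<theta>)) = (\<integral>x. g (\<theta> x) \<partial>density M w)"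
    by (rule integral_distr) auto
  also have "\<dots> = (\<integral>x. w x *\<^sub>R g (\<theta> x) \<partial>M)"
    by (rule integral_density) (use w0 in auto)
  finally show ?thesis .
qed

text \<open>No integrability of \<open>w \<cdot> g \<circ> \<theta>\<close> is needed: without it the Bochner integral is \<open>0\<close> by convention.\<close>

lemma integral_eq_0_of_characters:
  fixes w \<theta> :: "'a \<Rightarrow> real" and g :: "real \<Rightarrow> real"
  assumes w: "integrable M w" and \<theta> [measurable]: "\<theta> \<in> borel_measurable M" and g [measurable]: "g \<in> borel_measurable borel"
    and ch: "\<And>\<xi> c. (\<integral>x. w x * sin (\<xi> * \<theta> x + c) \<partial>M) = 0"
  shows "(\<integral>x. w x * g (\<theta> x) \<partial>M) = 0"
proof (cases "integrable M (\<lambda>x. w x * g (\<theta> x)) \<and> (\<integral>x. max 0 (w x) \<partial>M) \<noteq> 0")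
  \<comment> \<open>Without integrability the integral is 0 by convention. Otherwise the positive
    part of \<open>w\<close> has integral 0; since \<open>w\<close> itself has integral 0, by the
    character with \<open>\<xi> = 0\<close> and \<open>c = pi / 2\<close>, it vanishes almost
    everywhere.\<close>
  case False
  show ?thesis
  proof (cases "integrable M (\<lambda>x. w x * g (\<theta> x))")
    case True
    then have p: "(\<integral>x. max 0 (w x) \<partial>M) = 0" using False by simp
    have ip: "integrable M (\<lambda>x. max 0 (w x))" using w by simp
    have "(\<integral>x. w x \<partial>M) = 0" using ch[of 0 "pi / 2"] by simp
    then have "(\<integral>x. max 0 (w x) - w x \<partial>M) = 0" using p w ip by simp
    then have "AE x in M. max 0 (w x) - w x = 0"
      using ip w by (subst (asm) integral_nonneg_eq_0_iff_AE) auto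
    moreover have "AE x in M. max 0 (w x) = 0"
      using p ip by (subst (asm) integral_nonneg_eq_0_iff_AE) auto
    ultimately have "AE x in M. w x * g (\<theta> x) = 0" by eventually_elim auto
    then show ?thesis by (rule integral_eq_zero_AE)
  qed (simp add: not_integrable_integral_eq)
next
  case True
  have [measurable]: "w \<in> borel_measurable M" using w by simp
  define s where "s = (\<integral>x. max 0 (w x) \<partial>M)"
  \<comment> \<open>Positive and negative part have the same mass \<open>s\<close>, because
    \<open>w\<close> has integral 0. Division by \<open>s\<close> makes both of them probability
    densities, to which Levy's uniqueness theorem applies.\<close>
  define P where "P x = max 0 (w x) / s" for x
  define N where "N x = max 0 (- w x) / s" for x
  have PN: "w x = s * (P x - N x)" for x using True by (auto simp: P_def N_def s_def max_def field_simps)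
  have ip: "integrable M (\<lambda>x. max 0 (w x))" "integrable M (\<lambda>x. max 0 (- w x))" using w by auto
  have s: "s > 0" 
  proof -
    have "s \<ge> 0" unfolding s_def by (intro integral_nonneg_AE) auto
    then show ?thesis using True by (simp add: s_def less_le)
  qed
  have w00: "(\<integral>x. w x \<partial>M) = 0" using ch[of 0 "pi / 2"] by simp
  have "(\<integral>x. max 0 (- w x) \<partial>M) = (\<integral>x. max 0 (w x) - w x \<partial>M)"
    by (intro Bochner_Integration.integral_cong) auto
  then have sN: "(\<integral>x. max 0 (- w x) \<partial>M) = s" using ip w w00 by (simp add: s_def)
  have i: "integrable M P" "integrable M N" unfolding P_def N_def using ip by auto
  have [measurable]: "P \<in> borel_measurable M" "N \<in> borel_measurable M" using i by auto
  have nn: "P x \<ge> 0" "N x \<ge> 0" for x using s by (auto simp: P_def N_def)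
  have m1: "(\<integral>x. P x \<partial>M) = 1" "(\<integral>x. N x \<partial>M) = 1" unfolding P_def N_def using sN s by (auto simp: s_def)
  let ?P = "distr (density M P) borel \<theta>" and ?N = "distr (density M N) borel \<theta>"
  have bi: "integrable M (\<lambda>x. P x * k (\<theta> x))" "integrable M (\<lambda>x. N x * k (\<theta> x))"
    if [measurable]: "k \<in> borel_measurable borel" and "\<And>x. \<bar>k x\<bar> \<le> 1" for k :: "real \<Rightarrow> real"
    using integrable_bounded_mult[OF i(1), of "\<lambda>x. k (\<theta> x)" 1] integrable_bounded_mult[OF i(2), of "\<lambda>x. k (\<theta> x)" 1] that
    by (simp_all add: mult.commute)
  have eq: "(\<integral>x. P x * sin (\<xi> * \<theta> x + c) \<partial>M) = (\<integral>x. N x * sin (\<xi> * \<theta> x + c) \<partial>M)" for \<xi> c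
  proof -
    have b: "integrable M (\<lambda>x. P x * sin (\<xi> * \<theta> x + c))" "integrable M (\<lambda>x. N x * sin (\<xi> * \<theta> x + c))"
      using bi[of "\<lambda>y. sin (\<xi> * y + c)"] by auto
    have "0 = (\<integral>x. s * (P x * sin (\<xi> * \<theta> x + c)) - s * (N x * sin (\<xi> * \<theta> x + c)) \<partial>M)"
      unfolding ch[symmetric, of \<xi> c] PN by (intro Bochner_Integration.integral_cong) (auto simp: algebra_simps)
    then show ?thesis using b s by simp
  qed
  \<comment> \<open>The phases \<open>pi / 2\<close> and 0 provide the real and the imaginary part
    of the characteristic function.\<close>
  have chr: "char (distr (density M W) borel \<theta>) t =
      complex_of_real (\<integral>x. W x * sin (t * \<theta> x + pi / 2) \<partial>M) + \<i> * complex_of_real (\<integral>x. W x * sin (t * \<theta> x + 0) \<partial>M)"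
    if [measurable]: "W \<in> borel_measurable M" and "\<And>x. W x \<ge> 0" and W: "\<And>c. integrable M (\<lambda>x. W x * sin (t * \<theta> x + c))" for W t
  proof -
    have "char (distr (density M W) borel \<theta>) t = (\<integral>x. W x *\<^sub>R iexp (t * \<theta> x) \<partial>M)"
      unfolding char_def by (rule integral_weighted_distr) (use that in auto)
    also have "\<dots> = (\<integral>x. complex_of_real (W x * sin (t * \<theta> x + pi / 2)) + \<i> * complex_of_real (W x * sin (t * \<theta> x + 0)) \<partial>M)"
    proof (rule Bochner_Integration.integral_cong[OF refl])
      fix x
      have "iexp (t * \<theta> x) = complex_of_real (cos (t * \<theta> x)) + \<i> * complex_of_real (sin (t * \<theta> x))"
        using cis_conv_exp[of "t * \<theta> x"] by (simp add: complex_eq_iff)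
      moreover have "sin (t * \<theta> x + pi / 2) = cos (t * \<theta> x)" by (simp add: sin_add)
      ultimately show "W x *\<^sub>R iexp (t * \<theta> x) = complex_of_real (W x * sin (t * \<theta> x + pi / 2)) + \<i> * complex_of_real (W x * sin (t * \<theta> x + 0))"
        by (simp add: scaleR_conv_of_real algebra_simps)
    qed
    also have "\<dots> = complex_of_real (\<integral>x. W x * sin (t * \<theta> x + pi / 2) \<partial>M) + \<i> * complex_of_real (\<integral>x. W x * sin (t * \<theta> x + 0) \<partial>M)"
      by (subst Bochner_Integration.integral_add)
         (use W[of "pi / 2"] W[of 0] in \<open>auto intro!: integrable_of_real simp del: of_real_mult\<close>)
    finally show ?thesis .
  qed
  have "char ?P = char ?N"
  proof
    fix t
    show "char ?P t = char ?N t"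
      using chr[of P t] chr[of N t] bi[of "\<lambda>y. sin (t * y + _)"] nn eq[of t "pi / 2"] eq[of t 0] by simp
  qed
  then have PNeq: "?P = ?N"
    by (intro Levy_uniqueness real_distribution_weighted i nn m1) auto
  have gi: "integrable M (\<lambda>x. P x * g (\<theta> x))" "integrable M (\<lambda>x. N x * g (\<theta> x))"
  proof -
    have "integrable M (\<lambda>x. w x * g (\<theta> x) / s)" using True by simp
    moreover have "\<bar>P x\<bar> \<le> \<bar>w x / s\<bar>" "\<bar>N x\<bar> \<le> \<bar>w x / s\<bar>" for x
      using s by (auto simp: P_def N_def divide_right_mono)
    then have "\<bar>P x * g (\<theta> x)\<bar> \<le> \<bar>w x * g (\<theta> x) / s\<bar>" "\<bar>N x * g (\<theta> x)\<bar> \<le> \<bar>w x * g (\<theta> x) / s\<bar>" for x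
      using mult_right_mono[of "\<bar>P x\<bar>" "\<bar>w x / s\<bar>" "\<bar>g (\<theta> x)\<bar>"] mult_right_mono[of "\<bar>N x\<bar>" "\<bar>w x / s\<bar>" "\<bar>g (\<theta> x)\<bar>"]
      by (simp_all add: abs_mult)
    ultimately show "integrable M (\<lambda>x. P x * g (\<theta> x))" "integrable M (\<lambda>x. N x * g (\<theta> x))"
      by (auto intro: Bochner_Integration.integrable_bound)
  qed
  have "(\<integral>x. P x * g (\<theta> x) \<partial>M) = (\<integral>x. N x * g (\<theta> x) \<partial>M)"
    using integral_weighted_distr[of P M \<theta> g] integral_weighted_distr[of N M \<theta> g] nn PNeq by simp
  moreover have "(\<integral>x. w x * g (\<theta> x) \<partial>M) = (\<integral>x. s * (P x * g (\<theta> x)) - s * (N x * g (\<theta> x)) \<partial>M)"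
    unfolding PN by (intro Bochner_Integration.integral_cong) (auto simp: algebra_simps)
  ultimately show ?thesis using gi by simp
qed

lemma (in transport) integral_comp_eq_0:
  assumes test: "test_fun T \<phi>" and [measurable]: "g \<in> borel_measurable borel"
  shows "(\<integral>(t, x). (deriv (\<lambda>s. \<phi> s x) t + u t x \<bullet> grad (\<phi> t) x) * g (\<theta> t x) \<partial>(tim T \<Otimes>\<^sub>M tor)) = 0"
proof -
  \<comment> \<open>Any single kernel gives access to \<open>test_weight_int\<close>; the index 2 is
    the least that \<open>mollifier_exists\<close> admits.\<close>
  obtain K :: "real ^ 'd \<Rightarrow> real" where "mollifier (1 / sqrt (real 2)) K" using mollifier_exists[of 2] by blast
  then interpret transport_mollifier T a b \<theta> u G "1 / sqrt (real 2)" K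
    by (intro transport_mollifier.intro transport_axioms)
  have "(\<integral>z. (case z of (t, x) \<Rightarrow> deriv (\<lambda>s. \<phi> s x) t + u t x \<bullet> grad (\<phi> t) x) * g (case z of (t, x) \<Rightarrow> \<theta> t x) \<partial>(tim T \<Otimes>\<^sub>M tor)) = 0"
  proof (rule integral_eq_0_of_characters[where \<theta> = "\<lambda>z. case z of (t, x) \<Rightarrow> \<theta> t x", OF test_weight_int[OF test]])
    show "(\<integral>z. (case z of (t, x) \<Rightarrow> deriv (\<lambda>s. \<phi> s x) t + u t x \<bullet> grad (\<phi> t) x) * sin (\<xi> * (case z of (t, x) \<Rightarrow> \<theta> t x) + c) \<partial>(tim T \<Otimes>\<^sub>M tor)) = 0" for \<xi> c
      using integral_sin_eq_0[OF test, of \<xi> c] by (simp add: case_prod_beta')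
  qed (use borel_measurable_integrable[OF \<theta>_int] in auto)
  then show ?thesis by (simp add: case_prod_beta')
qed

subsection \<open>Hoelder's inequality and Besov increments\<close>

text \<open>For an infinite exponent \<open>p\<close> the condition \<open>x \<le> 1\<close> replaces the \<open>p\<close>-th power.\<close>

definition pw :: "ereal \<Rightarrow> real \<Rightarrow> real" where
  "pw p x = (if p = \<infinity> then 0 else x powr real_of_ereal p)"

lemma pw_nonneg: "pw p x \<ge> 0"
  by (simp add: pw_def)

text \<open>Let \<open>m\<close> be the right side. It dominates each power, so each factor is at
  most \<open>m\<close> to its reciprocal exponent, and the reciprocals sum to at most 1 while
  \<open>m \<ge> 1\<close>. The constant is crude, but it covers infinite exponents and strict
  inequality alike, so the same lemma serves in space and in time.\<close>

lemma young3:
  assumes nn: "0 \<le> x" "0 \<le> y" "0 \<le> z" and p: "1 \<le> p" "1 \<le> q" and pq: "2 / p + 1 / q \<le> (1 :: ereal)"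
    and inf: "p = \<infinity> \<Longrightarrow> x \<le> 1" "p = \<infinity> \<Longrightarrow> y \<le> 1" "q = \<infinity> \<Longrightarrow> z \<le> 1"
  shows "x * y * z \<le> 1 + pw p x + pw p y + pw q z"
proof -
  define r where "r s = (if s = \<infinity> then 0 else 1 / real_of_ereal s)" for s :: ereal
  have r: "r s \<ge> 0" if "1 \<le> s" for s using that by (cases s) (auto simp: r_def)
  have two: "(2 :: ereal) = ereal 2" by simp
  have "2 * r p + r q \<le> 1"
    using pq p unfolding two one_ereal_def by (cases p; cases q) (auto simp: r_def)
  define m where "m = 1 + pw p x + pw p y + pw q z"
  have m: "m \<ge> 1" unfolding m_def using pw_nonneg[of p x] pw_nonneg[of p y] pw_nonneg[of q z] by linarith
  have le: "w \<le> m powr r s" if w: "0 \<le> w" "1 \<le> s" "s = \<infinity> \<Longrightarrow> w \<le> 1" "pw s w \<le> m" for w s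
  proof (cases "s = \<infinity>")
    case True
    then show ?thesis using w m by (simp add: r_def)
  next
    case False
    then obtain P where P: "s = ereal P" "P \<ge> 1" using w(2) by (cases s) auto
    have "w = (w powr P) powr (1 / P)" using P w(1) by (simp add: powr_powr)
    also have "\<dots> \<le> m powr (1 / P)" using w(4) P by (intro powr_mono2) (auto simp: pw_def)
    finally show ?thesis using P by (simp add: r_def)
  qed
  have "x \<le> m powr r p" "y \<le> m powr r p" "z \<le> m powr r q"
    using le[OF nn(1) p(1) inf(1)] le[OF nn(2) p(1) inf(2)] le[OF nn(3) p(2) inf(3)]
      pw_nonneg[of p x] pw_nonneg[of p y] pw_nonneg[of q z] by (auto simp: m_def)
  then have "x * y * z \<le> m powr r p * m powr r p * m powr r q"
    using nn by (intro mult_mono mult_nonneg_nonneg) auto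
  also have "\<dots> = m powr (2 * r p + r q)" by (simp add: powr_add[symmetric])
  also have "\<dots> \<le> m powr 1" using m \<open>2 * r p + r q \<le> 1\<close> by (intro powr_mono) auto
  finally show ?thesis using m by (simp add: m_def)
qed

text \<open>States that the L^p norm of \<open>g\<close> is at most \<open>A\<close>, for
  \<open>A > 0\<close>. Dividing by \<open>A\<close> inside the integral avoids roots and leaves
  powers of unit mass, as suits \<open>young3\<close>.\<close>

definition Lb :: "ereal \<Rightarrow> 'a measure \<Rightarrow> real \<Rightarrow> ('a \<Rightarrow> real) \<Rightarrow> bool" where
  "Lb p M A g \<longleftrightarrow> (if p = \<infinity> then AE x in M. \<bar>g x\<bar> \<le> A
     else (\<integral>\<^sup>+x. ennreal ((\<bar>g x\<bar> / A) powr real_of_ereal p) \<partial>M) \<le> 1)"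

lemma Lb_pw:
  assumes "Lb p M A g" "A > 0"
  shows "(\<integral>\<^sup>+x. ennreal (pw p (\<bar>g x\<bar> / A)) \<partial>M) \<le> 1" "p = \<infinity> \<Longrightarrow> AE x in M. \<bar>g x\<bar> / A \<le> 1"
  using assms by (auto simp: Lb_def pw_def split: if_splits)

lemma pw_measurable [measurable]:
  assumes [measurable]: "g \<in> borel_measurable M"
  shows "(\<lambda>x. pw p (g x)) \<in> borel_measurable M"
  unfolding pw_def by (cases "p = \<infinity>") simp_all

text \<open>After division by the three bounds, \<open>young3\<close> is integrated: its 1 gives the
  total mass, and each of its three powers at most 1.\<close>

lemma Hoelder3:
  assumes [measurable]: "g1 \<in> borel_measurable M" "g2 \<in> borel_measurable M" "g3 \<in> borel_measurable M"
    and L: "Lb p M A g1" "Lb p M B g2" "Lb q M C g3" and pos: "A > 0" "B > 0" "C > 0"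
    and p: "1 \<le> p" "1 \<le> q" "2 / p + 1 / q \<le> (1 :: ereal)"
  shows "(\<integral>\<^sup>+x. ennreal (\<bar>g1 x\<bar> * \<bar>g2 x\<bar> * \<bar>g3 x\<bar>) \<partial>M) \<le> ennreal (A * B * C) * (emeasure M (space M) + 3)"
proof -
  let ?x = "\<lambda>x. \<bar>g1 x\<bar> / A" and ?y = "\<lambda>x. \<bar>g2 x\<bar> / B" and ?z = "\<lambda>x. \<bar>g3 x\<bar> / C"
  have "AE x in M. p = \<infinity> \<longrightarrow> ?x x \<le> 1" "AE x in M. p = \<infinity> \<longrightarrow> ?y x \<le> 1" "AE x in M. q = \<infinity> \<longrightarrow> ?z x \<le> 1"
    using Lb_pw(2)[OF L(1) pos(1)] Lb_pw(2)[OF L(2) pos(2)] Lb_pw(2)[OF L(3) pos(3)] by auto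
  then have "AE x in M. ennreal (\<bar>g1 x\<bar> * \<bar>g2 x\<bar> * \<bar>g3 x\<bar>) \<le>
      ennreal (A * B * C) * (1 + ennreal (pw p (?x x)) + ennreal (pw p (?y x)) + ennreal (pw q (?z x)))"
  proof eventually_elim
    case (elim x)
    have "?x x * ?y x * ?z x \<le> 1 + pw p (?x x) + pw p (?y x) + pw q (?z x)"
      by (rule young3) (use elim pos p in auto)
    then have "A * B * C * (?x x * ?y x * ?z x) \<le> A * B * C * (1 + pw p (?x x) + pw p (?y x) + pw q (?z x))"
      using pos by (intro mult_left_mono) auto
    moreover have "A * B * C * (?x x * ?y x * ?z x) = \<bar>g1 x\<bar> * \<bar>g2 x\<bar> * \<bar>g3 x\<bar>" using pos by simp
    ultimately have "ennreal (\<bar>g1 x\<bar> * \<bar>g2 x\<bar> * \<bar>g3 x\<bar>) \<le> ennreal (A * B * C * (1 + pw p (?x x) + pw p (?y x) + pw q (?z x)))"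
      by (intro ennreal_leI) simp
    also have "\<dots> = ennreal (A * B * C) * (1 + ennreal (pw p (?x x)) + ennreal (pw p (?y x)) + ennreal (pw q (?z x)))"
      using pos by (simp add: ennreal_mult' ennreal_plus[symmetric] pw_nonneg add_nonneg_nonneg ennreal_1[symmetric] del: ennreal_plus ennreal_1)
    finally show ?case .
  qed
  then have "(\<integral>\<^sup>+x. ennreal (\<bar>g1 x\<bar> * \<bar>g2 x\<bar> * \<bar>g3 x\<bar>) \<partial>M) \<le>
      (\<integral>\<^sup>+x. ennreal (A * B * C) * (1 + ennreal (pw p (?x x)) + ennreal (pw p (?y x)) + ennreal (pw q (?z x))) \<partial>M)"
    by (rule nn_integral_mono_AE)
  also have "\<dots> = ennreal (A * B * C) * (emeasure M (space M) + (\<integral>\<^sup>+x. ennreal (pw p (?x x)) \<partial>M) + (\<integral>\<^sup>+x. ennreal (pw p (?y x)) \<partial>M) + (\<integral>\<^sup>+x. ennreal (pw q (?z x)) \<partial>M))"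
    by (simp add: nn_integral_cmult nn_integral_add)
  also have "\<dots> \<le> ennreal (A * B * C) * (emeasure M (space M) + 1 + 1 + 1)"
    by (intro mult_left_mono add_mono Lb_pw(1) L pos) auto
  finally show ?thesis by (simp add: add.assoc numeral_eq_Suc)
qed

section \<open>Hoelder's inequality on the torus and mean-zero functions\<close>

definition tor_const :: "'d itself \<Rightarrow> real" where
  "tor_const _ = (2 * pi) ^ CARD('d) + 3"

lemma Hoelder3_tor:
  fixes g1 g2 g3 :: "real ^ 'd \<Rightarrow> real"
  assumes "g1 \<in> borel_measurable borel" "g2 \<in> borel_measurable borel" "g3 \<in> borel_measurable borel"
    and "Lb p tor A g1" "Lb p tor B g2" "Lb q tor C g3" and "A > 0" "B > 0" "C > 0"
    and "1 \<le> p" "1 \<le> q" "2 / p + 1 / q \<le> (1 :: ereal)"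
  shows "(\<integral>\<^sup>+x. ennreal (\<bar>g1 x\<bar> * \<bar>g2 x\<bar> * \<bar>g3 x\<bar>) \<partial>tor) \<le> ennreal (tor_const TYPE('d) * (A * B * C))"
proof -
  have "(\<integral>\<^sup>+x. ennreal (\<bar>g1 x\<bar> * \<bar>g2 x\<bar> * \<bar>g3 x\<bar>) \<partial>tor) \<le> ennreal (A * B * C) * (emeasure (tor :: (real ^ 'd) measure) (space tor) + 3)"
    by (rule Hoelder3) (use assms in auto)
  also have "emeasure (tor :: (real ^ 'd) measure) (space tor) + 3 = ennreal (tor_const TYPE('d))"
    unfolding tor_const_def by (simp add: emeasure_tor)
  also have "ennreal (A * B * C) * ennreal (tor_const TYPE('d)) = ennreal (A * B * C * tor_const TYPE('d))"
    by (rule ennreal_mult'[symmetric]) (use assms(7-9) in simp)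
  finally show ?thesis by (simp only: mult.commute)
qed

lemma tor_const_ge_1: "tor_const TYPE('d::finite) \<ge> 1"
  unfolding tor_const_def by (simp add: add_increasing)

lemma Lb_shift:
  fixes g :: "real ^ 'd \<Rightarrow> real"
  assumes [measurable]: "g \<in> borel_measurable borel" and p: "periodic g" and L: "Lb p tor A g"
  shows "Lb p tor A (\<lambda>x. g (x + z))"
proof (cases "p = \<infinity>")
  case True
  have "AE x in tor. \<bar>g (x + z)\<bar> \<le> A"
    by (rule AE_tor_shift[of "\<lambda>x. \<bar>g x\<bar> \<le> A"]) (use L True p in \<open>auto simp: Lb_def periodic_def\<close>)
  then show ?thesis using True by (simp add: Lb_def)
next
  case False
  have "(\<integral>\<^sup>+x. ennreal ((\<bar>g (x + z)\<bar> / A) powr real_of_ereal p) \<partial>tor) = (\<integral>\<^sup>+x. ennreal ((\<bar>g x\<bar> / A) powr real_of_ereal p) \<partial>tor)"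
    by (rule nn_integral_tor_shift) (measurable, use p in \<open>auto simp: periodic_def\<close>)
  then show ?thesis using L False by (simp add: Lb_def)
qed

text \<open>Lets \<open>Hoelder3_tor\<close> handle fewer than three genuine factors by filling up
  with the constant 1. One bound serves for all exponents because \<open>tor_const\<close> is at
  least 1 and at least the volume.\<close>

lemma Lb_1:
  assumes "1 \<le> p"
  shows "Lb p (tor :: (real ^ 'd) measure) (tor_const TYPE('d)) (\<lambda>x. 1)"
proof (cases "p = \<infinity>")
  case False
  then obtain P where P: "p = ereal P" "P \<ge> 1" using assms by (cases p) auto
  let ?D = "tor_const TYPE('d)"
  have D: "?D \<ge> 1" by (rule tor_const_ge_1)
  have "(1 / ?D) powr P \<le> (1 / ?D) powr 1" using D P by (intro powr_mono') auto
  then have "ennreal ((1 / ?D) powr P) * emeasure (tor :: (real ^ 'd) measure) UNIV \<le> ennreal (1 / ?D) * ennreal ?D"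
    using D by (intro mult_mono ennreal_leI) (auto simp: emeasure_tor tor_const_def)
  also have "\<dots> = 1" using D by (subst ennreal_mult'[symmetric]) auto
  finally show ?thesis using P D by (simp add: Lb_def)
qed (use tor_const_ge_1[where 'd = 'd] in \<open>simp add: Lb_def\<close>)

text \<open>A Poincare inequality. As \<open>g\<close> has mean zero, averaging
  \<open>g (x + y) - g x\<close> over \<open>y\<close> leaves \<open>- g x\<close> times the volume,
  and the volume is at least 1. Only seminorms are integrable in time, so this is how values of the
  solution and the velocity become controlled.\<close>

lemma mean_zero_average:
  fixes g :: "real ^ 'd \<Rightarrow> real"
  assumes g: "integrable tor g" and p: "periodic g" and z: "(\<integral>x. g x \<partial>tor) = 0"
  shows "ennreal \<bar>g x\<bar> \<le> (\<integral>\<^sup>+y. ennreal \<bar>g (x + y) - g x\<bar> \<partial>tor)"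
proof -
  have [measurable]: "g \<in> borel_measurable borel" using borel_measurable_integrable[OF g] by simp
  have i: "integrable tor (\<lambda>y. g (x + y))" and e: "(\<integral>y. g (x + y) \<partial>tor) = 0"
    using integral_tor_shift[of g x] g p z by (simp_all add: add.commute)
  have m: "measure (tor :: (real ^ 'd) measure) UNIV = (2 * pi) ^ CARD('d)"
    unfolding measure_def by (simp add: emeasure_tor)
  have "(\<integral>y. g (x + y) - g x \<partial>tor) = - (g x * (2 * pi) ^ CARD('d))"
    using i e m by simp
  then have "ennreal (\<bar>g x\<bar> * (2 * pi) ^ CARD('d)) = ennreal (norm (\<integral>y. g (x + y) - g x \<partial>tor))"
    by (simp add: abs_mult)
  also have "\<dots> \<le> (\<integral>\<^sup>+y. ennreal (norm (g (x + y) - g x)) \<partial>tor)"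
    by (rule integral_norm_bound_ennreal) (use i in auto)
  finally have "ennreal (\<bar>g x\<bar> * (2 * pi) ^ CARD('d)) \<le> (\<integral>\<^sup>+y. ennreal \<bar>g (x + y) - g x\<bar> \<partial>tor)" by simp
  moreover have "\<bar>g x\<bar> \<le> \<bar>g x\<bar> * (2 * pi) ^ CARD('d)"
    using mult_left_mono[OF one_le_power[of "2 * pi" "CARD('d)"], of "\<bar>g x\<bar>"] pi_ge_two by simp
  ultimately show ?thesis by (meson ennreal_leI order_trans)
qed

text \<open>Replaces a factor \<open>g\<close> in a weighted integral by its increments, at the cost
  of one factor \<open>tor_const\<close> and a uniform bound over the displacements.\<close>

lemma weighted_average:
  fixes g :: "real ^ 'd \<Rightarrow> real"
  assumes g: "integrable tor g" "periodic g" "(\<integral>x. g x \<partial>tor) = 0"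
    and h [measurable]: "h \<in> borel_measurable borel"
    and H: "\<And>y. y \<in> torus_cell \<Longrightarrow> (\<integral>\<^sup>+x. h x * ennreal \<bar>g (x + y) - g x\<bar> \<partial>tor) \<le> ennreal c" and c: "c \<ge> 0"
  shows "(\<integral>\<^sup>+x. h x * ennreal \<bar>g x\<bar> \<partial>tor) \<le> ennreal (tor_const TYPE('d) * c)"
proof -
  have [measurable]: "g \<in> borel_measurable borel" using borel_measurable_integrable[OF g(1)] by simp
  have "(\<integral>\<^sup>+x. h x * ennreal \<bar>g x\<bar> \<partial>tor) \<le> (\<integral>\<^sup>+x. h x * (\<integral>\<^sup>+y. ennreal \<bar>g (x + y) - g x\<bar> \<partial>tor) \<partial>tor)"
    by (intro nn_integral_mono mult_left_mono mean_zero_average g) auto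
  also have "\<dots> = (\<integral>\<^sup>+x. \<integral>\<^sup>+y. h x * ennreal \<bar>g (x + y) - g x\<bar> \<partial>tor \<partial>tor)"
    by (intro nn_integral_cong nn_integral_cmult[symmetric]) measurable
  also have "\<dots> = (\<integral>\<^sup>+y. \<integral>\<^sup>+x. h x * ennreal \<bar>g (x + y) - g x\<bar> \<partial>tor \<partial>tor)"
    by (rule tor_pair.Fubini'[symmetric]) measurable
  also have "\<dots> \<le> (\<integral>\<^sup>+y. ennreal c \<partial>(tor :: (real ^ 'd) measure))"
    by (intro nn_integral_mono_AE eventually_mono[OF AE_tor_cell] H)
  also have "\<dots> = ennreal c * ennreal ((2 * pi) ^ CARD('d))" by (simp add: emeasure_tor)
  also have "\<dots> \<le> ennreal c * ennreal (tor_const TYPE('d))"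
    by (intro mult_left_mono ennreal_leI) (auto simp: tor_const_def)
  finally show ?thesis using c by (simp add: ennreal_mult'[symmetric] mult.commute)
qed

text \<open>The bounds \<open>A\<close> and \<open>U i\<close> are taken at least 1, so that the one
  quantity \<open>A * A * U i\<close> also dominates all products with fewer factors.\<close>

locale besov_data =
  fixes f :: "real ^ 'd \<Rightarrow> real" and v :: "real ^ 'd \<Rightarrow> real ^ 'd" and a b :: real and p q :: ereal and A :: real and U :: "'d \<Rightarrow> real"
  assumes f_int: "integrable tor f" and v_int: "integrable tor v"
    and f_per: "periodic f" and v_per: "periodic v"
    and f_mean: "(\<integral>x. f x \<partial>tor) = 0" and v_mean: "(\<integral>x. v x $ i \<partial>tor) = 0"
    and a: "0 < a" "a < 1" and b: "0 < b" "b < 1"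
    and p: "1 \<le> p" "1 \<le> q" "2 / p + 1 / q \<le> (1 :: ereal)"
    and A: "A \<ge> 1" and U: "U i \<ge> 1"
    and f_Lb: "w \<in> torus_cell \<Longrightarrow> w \<noteq> 0 \<Longrightarrow> Lb p tor (A * norm w powr a) (\<lambda>x. f (x + w) - f x)"
    and v_Lb: "w \<in> torus_cell \<Longrightarrow> w \<noteq> 0 \<Longrightarrow> Lb q tor (U i * norm w powr b) (\<lambda>x. v (x + w) $ i - v x $ i)"
    and div_free: "smooth \<psi> \<Longrightarrow> periodic \<psi> \<Longrightarrow> (\<integral>x. v x \<bullet> grad \<psi> x \<partial>tor) = 0"
begin

lemma f_measurable [measurable]: "f \<in> borel_measurable borel"
  using borel_measurable_integrable[OF f_int] by simp

lemma v_measurable [measurable]: "v \<in> borel_measurable borel"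
  using borel_measurable_integrable[OF v_int] by simp

lemma v_nth_measurable [measurable]: "(\<lambda>x. v x $ i) \<in> borel_measurable borel"
proof -
  have "(\<lambda>x. v x \<bullet> axis i 1) \<in> borel_measurable borel" by measurable
  then show ?thesis by (simp add: inner_axis)
qed

lemma v_nth_int: "integrable tor (\<lambda>x. v x $ i)"
proof -
  have "integrable tor (\<lambda>x. v x \<bullet> axis i 1)" using v_int by simp
  then show ?thesis by (simp add: inner_axis)
qed

lemma v_nth_per: "periodic (\<lambda>x. v x $ i)"
  using v_per by (simp add: periodic_def)

definition D :: real where "D = tor_const TYPE('d)"

lemma D: "D \<ge> 1"
  unfolding D_def by (rule tor_const_ge_1)

lemma increments3:
  assumes "w \<in> torus_cell"
  shows "(\<integral>\<^sup>+x. ennreal (\<bar>f (x + w) - f x\<bar> * \<bar>f (x + w + z) - f (x + z)\<bar> * \<bar>v (x + w) $ i - v x $ i\<bar>) \<partial>tor)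
    \<le> ennreal (D * (A * A * U i) * norm w powr (2 * a + b))"
proof (cases "w = 0")
  case False
  have pd: "periodic (\<lambda>x. f (x + w) - f x)" using periodic_shift[OF f_per, of w] f_per by (simp add: periodic_def)
  have L: "Lb p tor (A * norm w powr a) (\<lambda>x. f (x + w + z) - f (x + z))"
    using Lb_shift[OF _ pd f_Lb[OF assms False], of z] by (simp add: add_ac)
  have "(\<integral>\<^sup>+x. ennreal (\<bar>f (x + w) - f x\<bar> * \<bar>f (x + w + z) - f (x + z)\<bar> * \<bar>v (x + w) $ i - v x $ i\<bar>) \<partial>tor)
    \<le> ennreal (tor_const TYPE('d) * ((A * norm w powr a) * (A * norm w powr a) * (U i * norm w powr b)))"
    by (rule Hoelder3_tor[OF _ _ _ f_Lb[OF assms False] L v_Lb[OF assms False] _ _ _ p])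
       (measurable, use A U[of i] False in auto)
  also have "tor_const TYPE('d) * ((A * norm w powr a) * (A * norm w powr a) * (U i * norm w powr b)) = D * (A * A * U i) * norm w powr (2 * a + b)"
  proof -
    have "norm w powr (2 * a + b) = norm w powr a * norm w powr a * norm w powr b"
      by (simp add: powr_add[symmetric])
    then show ?thesis by (simp add: D_def mult_ac)
  qed
  finally show ?thesis .
qed simp

text \<open>The two shifts are independent: when \<open>v\<close> itself is replaced by an average
  of its increments, their displacement \<open>y\<close> has nothing to do with the displacement
  \<open>w\<close> of \<open>f\<close>.\<close>

lemma increments2:
  assumes "w \<in> torus_cell" "y \<in> torus_cell"
  shows "(\<integral>\<^sup>+x. ennreal (\<bar>f (x + w) - f x\<bar> * \<bar>v (x + y) $ i - v x $ i\<bar>) \<partial>tor) \<le> ennreal (D ^ 2 * (A * U i) * (norm w powr a * norm y powr b))"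
proof (cases "w = 0 \<or> y = 0")
  case False
  then have wy: "w \<noteq> 0" "y \<noteq> 0" by auto
  have "(\<integral>\<^sup>+x. ennreal (\<bar>f (x + w) - f x\<bar> * \<bar>1\<bar> * \<bar>v (x + y) $ i - v x $ i\<bar>) \<partial>tor)
    \<le> ennreal (tor_const TYPE('d) * ((A * norm w powr a) * tor_const TYPE('d) * (U i * norm y powr b)))"
    by (rule Hoelder3_tor[OF _ _ _ f_Lb[OF assms(1) wy(1)] Lb_1[OF p(1)] v_Lb[OF assms(2) wy(2)] _ _ _ p])
       (measurable, use A U[of i] wy D in \<open>auto simp: D_def\<close>)
  then show ?thesis by (simp add: D_def power2_eq_square mult_ac)
qed auto

lemma increments1:
  assumes "w \<in> torus_cell"
  shows "(\<integral>\<^sup>+x. ennreal \<bar>f (x + w) - f x\<bar> \<partial>tor) \<le> ennreal (D ^ 3 * A * norm w powr a)"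
proof (cases "w = 0")
  case False
  have "(\<integral>\<^sup>+x. ennreal (\<bar>f (x + w) - f x\<bar> * \<bar>1\<bar> * \<bar>1\<bar>) \<partial>tor)
    \<le> ennreal (tor_const TYPE('d) * ((A * norm w powr a) * tor_const TYPE('d) * tor_const TYPE('d)))"
    by (rule Hoelder3_tor[OF _ _ _ f_Lb[OF assms False] Lb_1[OF p(1)] Lb_1[OF p(2)] _ _ _ p])
       (measurable, use A False D in \<open>auto simp: D_def\<close>)
  then show ?thesis by (simp add: D_def power3_eq_cube mult_ac)
qed auto

lemma v_increments1:
  assumes "w \<in> torus_cell"
  shows "(\<integral>\<^sup>+x. ennreal \<bar>v (x + w) $ i - v x $ i\<bar> \<partial>tor) \<le> ennreal (D ^ 3 * U i * norm w powr b)"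
proof (cases "w = 0")
  case False
  have "(\<integral>\<^sup>+x. ennreal (\<bar>1\<bar> * \<bar>1\<bar> * \<bar>v (x + w) $ i - v x $ i\<bar>) \<partial>tor)
    \<le> ennreal (tor_const TYPE('d) * (tor_const TYPE('d) * tor_const TYPE('d) * (U i * norm w powr b)))"
    by (rule Hoelder3_tor[OF _ _ _ Lb_1[OF p(1)] Lb_1[OF p(1)] v_Lb[OF assms False] _ _ _ p])
       (measurable, use U[of i] False D in \<open>auto simp: D_def\<close>)
  then show ?thesis by (simp add: D_def power3_eq_cube mult_ac)
qed auto

definition R :: real where "R = real CARD('d) * pi"

lemma R: "R \<ge> 1"
proof -
  have "1 * 1 \<le> real CARD('d) * pi" using pi_ge_two by (intro mult_mono) (auto simp: Suc_leI)
  then show ?thesis by (simp add: R_def)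
qed

lemma cell_powr_le:
  fixes w :: "real ^ 'd"
  assumes "w \<in> torus_cell" "0 < s" "s < 1"
  shows "norm w powr s \<le> R"
proof -
  have "norm w powr s \<le> R powr s" using norm_torus_cell[OF assms(1)] assms by (intro powr_mono2) (auto simp: R_def)
  also have "\<dots> \<le> R powr 1" using R assms by (intro powr_mono) auto
  finally show ?thesis using R by simp
qed

text \<open>One constant above all that occur below. The largest of them is
  \<open>D ^ 4 * R ^ 2\<close>, in \<open>fv_bound\<close>, where two successive averages each cost
  a factor \<open>D\<close> and a factor \<open>R\<close>.\<close>

definition C :: real where "C = D ^ 5 * R ^ 2"

lemma C: "C \<ge> D * R * D ^ 2" "C \<ge> D" "C \<ge> D ^ 2" "C \<ge> D ^ 3" "C \<ge> D * (D ^ 3 * R)" "C \<ge> D * (D * R * D ^ 2 * R)" "C \<ge> 1"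
proof -
  have m: "D ^ i * R ^ j \<le> C" if "i \<le> 5" "j \<le> 2" for i j
    unfolding C_def using D R that by (intro mult_mono power_increasing) auto
  show "C \<ge> D * R * D ^ 2" using m[of 3 1] by (simp add: power_numeral_reduce mult_ac)
  show "C \<ge> D" "C \<ge> D ^ 2" "C \<ge> D ^ 3" "C \<ge> 1" using m[of 1 0] m[of 2 0] m[of 3 0] m[of 0 0] by auto
  show "C \<ge> D * (D ^ 3 * R)" using m[of 4 1] by (simp add: power_numeral_reduce mult_ac)
  show "C \<ge> D * (D * R * D ^ 2 * R)" using m[of 4 2] by (simp add: power_numeral_reduce mult_ac)
qed

lemma AU: "A \<le> A * A * U i" "A * U i \<le> A * A * U i" "U i \<le> A * A * U i" "1 \<le> A * A * U i"
proof -
  have 1: "1 \<le> A * U i" using A U[of i] mult_mono[of 1 A 1 "U i"] by simp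
  show 2: "A \<le> A * A * U i" using mult_left_mono[OF 1, of A] A by simp
  show "A * U i \<le> A * A * U i" using mult_right_mono[of 1 A "A * U i"] A 1 by simp
  have "1 \<le> A * A" using A mult_mono[of 1 A 1 A] by simp
  then show "U i \<le> A * A * U i" using mult_right_mono[of 1 "A * A" "U i"] U[of i] by simp
  show "1 \<le> A * A * U i" using 2 A by linarith
qed

lemma v_weighted_increment:
  assumes "w \<in> torus_cell"
  shows "(\<integral>\<^sup>+x. ennreal \<bar>f (x + w) - f x\<bar> * ennreal \<bar>v x $ i\<bar> \<partial>tor) \<le> ennreal (D * R * D ^ 2 * (A * U i) * norm w powr a)"
proof -
  have "(\<integral>\<^sup>+x. ennreal \<bar>f (x + w) - f x\<bar> * ennreal \<bar>v x $ i\<bar> \<partial>tor) \<le> ennreal (tor_const TYPE('d) * (D ^ 2 * (A * U i) * (norm w powr a * R)))"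
  proof (rule weighted_average[OF v_nth_int v_nth_per v_mean])
    fix y :: "real ^ 'd" assume y: "y \<in> torus_cell"
    have "(\<integral>\<^sup>+x. ennreal \<bar>f (x + w) - f x\<bar> * ennreal \<bar>v (x + y) $ i - v x $ i\<bar> \<partial>tor) \<le> ennreal (D ^ 2 * (A * U i) * (norm w powr a * norm y powr b))"
      using increments2[OF assms y, of i] by (simp add: ennreal_mult')
    also have "\<dots> \<le> ennreal (D ^ 2 * (A * U i) * (norm w powr a * R))"
      using cell_powr_le[OF y b] A U[of i] by (intro ennreal_leI mult_left_mono) auto
    finally show "(\<integral>\<^sup>+x. ennreal \<bar>f (x + w) - f x\<bar> * ennreal \<bar>v (x + y) $ i - v x $ i\<bar> \<partial>tor) \<le> ennreal (D ^ 2 * (A * U i) * (norm w powr a * R))" .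
  qed (use A U[of i] R in auto)
  then show ?thesis by (simp add: D_def mult_ac)
qed

lemma fv_bound: "(\<integral>\<^sup>+x. ennreal \<bar>f x\<bar> * ennreal \<bar>v x $ i\<bar> \<partial>tor) \<le> ennreal (C * (A * A * U i))"
proof -
  have "(\<integral>\<^sup>+x. ennreal \<bar>v x $ i\<bar> * ennreal \<bar>f x\<bar> \<partial>tor) \<le> ennreal (tor_const TYPE('d) * (D * R * D ^ 2 * (A * U i) * R))"
  proof (rule weighted_average[OF f_int f_per f_mean])
    fix w :: "real ^ 'd" assume w: "w \<in> torus_cell"
    have "(\<integral>\<^sup>+x. ennreal \<bar>v x $ i\<bar> * ennreal \<bar>f (x + w) - f x\<bar> \<partial>tor) \<le> ennreal (D * R * D ^ 2 * (A * U i) * norm w powr a)"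
      using v_weighted_increment[OF w, of i] by (simp only: mult.commute)
    also have "\<dots> \<le> ennreal (D * R * D ^ 2 * (A * U i) * R)"
      using cell_powr_le[OF w a] A U[of i] D R by (intro ennreal_leI mult_left_mono) auto
    finally show "(\<integral>\<^sup>+x. ennreal \<bar>v x $ i\<bar> * ennreal \<bar>f (x + w) - f x\<bar> \<partial>tor) \<le> ennreal (D * R * D ^ 2 * (A * U i) * R)" .
  qed (use A U[of i] D R in auto)
  also have "tor_const TYPE('d) * (D * R * D ^ 2 * (A * U i) * R) = (D * (D * R * D ^ 2 * R)) * (A * U i)"
    by (simp only: D_def mult_ac)
  also have "ennreal \<dots> \<le> ennreal (C * (A * A * U i))"
    using A U[of i] D R C(7) by (intro ennreal_leI mult_mono C AU) auto
  finally show ?thesis by (simp only: mult.commute)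
qed

lemma f_bound: "(\<integral>\<^sup>+x. ennreal \<bar>f x\<bar> \<partial>tor) \<le> ennreal (C * (A * A * U i))"
proof -
  have "(\<integral>\<^sup>+x. 1 * ennreal \<bar>f x\<bar> \<partial>tor) \<le> ennreal (tor_const TYPE('d) * (D ^ 3 * A * R))"
  proof (rule weighted_average[OF f_int f_per f_mean])
    fix w :: "real ^ 'd" assume w: "w \<in> torus_cell"
    have "(\<integral>\<^sup>+x. 1 * ennreal \<bar>f (x + w) - f x\<bar> \<partial>tor) \<le> ennreal (D ^ 3 * A * norm w powr a)"
      using increments1[OF w] by simp
    also have "\<dots> \<le> ennreal (D ^ 3 * A * R)"
      using cell_powr_le[OF w a] A D by (intro ennreal_leI mult_left_mono) auto
    finally show "(\<integral>\<^sup>+x. 1 * ennreal \<bar>f (x + w) - f x\<bar> \<partial>tor) \<le> ennreal (D ^ 3 * A * R)" .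
  qed (use A D R in auto)
  also have "tor_const TYPE('d) * (D ^ 3 * A * R) = (D * (D ^ 3 * R)) * A" by (simp only: D_def mult_ac)
  also have "ennreal \<dots> \<le> ennreal (C * (A * A * U i))"
    using A D R C(7) by (intro ennreal_leI mult_mono C AU) auto
  finally show ?thesis by simp
qed

lemma v_bound: "(\<integral>\<^sup>+x. ennreal \<bar>v x $ i\<bar> \<partial>tor) \<le> ennreal (C * (A * A * U i))"
proof -
  have "(\<integral>\<^sup>+x. 1 * ennreal \<bar>v x $ i\<bar> \<partial>tor) \<le> ennreal (tor_const TYPE('d) * (D ^ 3 * U i * R))"
  proof (rule weighted_average[OF v_nth_int v_nth_per v_mean])
    fix w :: "real ^ 'd" assume w: "w \<in> torus_cell"
    have "(\<integral>\<^sup>+x. 1 * ennreal \<bar>v (x + w) $ i - v x $ i\<bar> \<partial>tor) \<le> ennreal (D ^ 3 * U i * norm w powr b)"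
      using v_increments1[OF w] by simp
    also have "\<dots> \<le> ennreal (D ^ 3 * U i * R)"
      using cell_powr_le[OF w b] U[of i] D by (intro ennreal_leI mult_left_mono) auto
    finally show "(\<integral>\<^sup>+x. 1 * ennreal \<bar>v (x + w) $ i - v x $ i\<bar> \<partial>tor) \<le> ennreal (D ^ 3 * U i * R)" .
  qed (use U[of i] D R in auto)
  also have "tor_const TYPE('d) * (D ^ 3 * U i * R) = (D * (D ^ 3 * R)) * U i" by (simp only: D_def mult_ac)
  also have "ennreal \<dots> \<le> ennreal (C * (A * A * U i))"
    using U[of i] D R C(7) by (intro ennreal_leI mult_mono C AU) auto
  finally show ?thesis by simp
qed

definition G :: real where "G = (\<Sum>i\<in>UNIV. C * (A * A * U i))"

lemma term_nonneg: "0 \<le> C * (A * A * U i)"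
  using A U[of i] C(7) by simp

lemma G_nonneg: "G \<ge> 0"
  unfolding G_def by (intro sum_nonneg term_nonneg)

lemma sum_components:
  fixes V :: "real ^ 'd \<Rightarrow> real ^ 'd"
  assumes [measurable]: "\<And>i. (\<lambda>x. V x $ i) \<in> borel_measurable borel" "h \<in> borel_measurable borel"
    and "\<And>i. (\<integral>\<^sup>+x. h x * ennreal \<bar>V x $ i\<bar> \<partial>tor) \<le> ennreal (C * (A * A * U i) * r)" and r: "r \<ge> 0"
  shows "(\<integral>\<^sup>+x. h x * ennreal (norm (V x)) \<partial>tor) \<le> ennreal (G * r)"
proof -
  have "(\<integral>\<^sup>+x. h x * ennreal (norm (V x)) \<partial>tor) \<le> (\<integral>\<^sup>+x. (\<Sum>i\<in>UNIV. h x * ennreal \<bar>V x $ i\<bar>) \<partial>tor)"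
  proof (rule nn_integral_mono)
    fix x
    have "ennreal (norm (V x)) \<le> (\<Sum>i\<in>UNIV. ennreal \<bar>V x $ i\<bar>)"
      using norm_le_l1_cart[of "V x"] by (simp add: sum_ennreal ennreal_leI)
    then show "h x * ennreal (norm (V x)) \<le> (\<Sum>i\<in>UNIV. h x * ennreal \<bar>V x $ i\<bar>)"
      unfolding sum_distrib_left[symmetric] by (rule mult_left_mono) auto
  qed
  also have "\<dots> = (\<Sum>i\<in>UNIV. \<integral>\<^sup>+x. h x * ennreal \<bar>V x $ i\<bar> \<partial>tor)"
    by (rule nn_integral_sum) measurable
  also have "\<dots> \<le> (\<Sum>i\<in>UNIV. ennreal (C * (A * A * U i) * r))"
    by (intro sum_mono assms)
  also have "\<dots> = ennreal (G * r)"
    unfolding G_def sum_distrib_right using r by (intro sum_ennreal mult_nonneg_nonneg term_nonneg)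
  finally show ?thesis .
qed

lemma le_G: "C * (A * A * U i) \<le> G"
  unfolding G_def by (intro member_le_sum term_nonneg) auto

lemma f_norm_bound: "(\<integral>\<^sup>+x. ennreal \<bar>f x\<bar> \<partial>tor) \<le> ennreal G"
  using f_bound[of undefined] le_G[of undefined] by (meson ennreal_leI order_trans)

lemma v_norm_bound: "(\<integral>\<^sup>+x. ennreal (norm (v x)) \<partial>tor) \<le> ennreal G"
  using sum_components[of v "\<lambda>x. 1" 1] v_bound by simp

lemma fv_norm_bound: "(\<integral>\<^sup>+x. ennreal (norm (f x *\<^sub>R v x)) \<partial>tor) \<le> ennreal G"
  using sum_components[of v "\<lambda>x. ennreal \<bar>f x\<bar>" 1] fv_bound by (simp add: ennreal_mult')

lemma slice: "slice f v a b G"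
proof
  show "integrable tor (\<lambda>x. f x *\<^sub>R v x)"
    by (rule integrableI_bounded) (measurable, use fv_norm_bound in \<open>auto simp: order_le_less_trans\<close>)
  fix w :: "real ^ 'd" assume w: "w \<in> torus_cell"
  have vn: "(\<lambda>x. v (x + w) $ i) \<in> borel_measurable borel" for i by measurable
  show "(\<integral>\<^sup>+x. ennreal (norm (v (x + w) - v x) * \<bar>f (x + w) - f x\<bar>) * ennreal \<bar>f (x + w + z) - f (x + z)\<bar> \<partial>tor)
        \<le> ennreal (G * norm w powr (2 * a + b))" for z
  proof -
    have "(\<integral>\<^sup>+x. ennreal (\<bar>f (x + w) - f x\<bar> * \<bar>f (x + w + z) - f (x + z)\<bar>) * ennreal (norm (v (x + w) - v x)) \<partial>tor) \<le> ennreal (G * norm w powr (2 * a + b))"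
    proof (rule sum_components)
      fix i
      have "(\<integral>\<^sup>+x. ennreal (\<bar>f (x + w) - f x\<bar> * \<bar>f (x + w + z) - f (x + z)\<bar>) * ennreal \<bar>(v (x + w) - v x) $ i\<bar> \<partial>tor)
        \<le> ennreal (D * (A * A * U i) * norm w powr (2 * a + b))"
        using increments3[OF w, of z i] by (simp add: ennreal_mult')
      also have "\<dots> \<le> ennreal (C * (A * A * U i) * norm w powr (2 * a + b))"
        using A U[of i] by (intro ennreal_leI mult_right_mono C) auto
      finally show "(\<integral>\<^sup>+x. ennreal (\<bar>f (x + w) - f x\<bar> * \<bar>f (x + w + z) - f (x + z)\<bar>) * ennreal \<bar>(v (x + w) - v x) $ i\<bar> \<partial>tor)
        \<le> ennreal (C * (A * A * U i) * norm w powr (2 * a + b))" .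
    qed (measurable, simp_all, measurable)
    then show ?thesis by (simp add: ennreal_mult' mult_ac)
  qed
  show "(\<integral>\<^sup>+x. ennreal (norm (v (x + w) - v x) * \<bar>f (x + w) - f x\<bar>) \<partial>tor) \<le> ennreal (G * norm w powr (a + b))"
  proof -
    have "(\<integral>\<^sup>+x. ennreal \<bar>f (x + w) - f x\<bar> * ennreal (norm (v (x + w) - v x)) \<partial>tor) \<le> ennreal (G * norm w powr (a + b))"
    proof (rule sum_components)
      fix i
      have "(\<integral>\<^sup>+x. ennreal \<bar>f (x + w) - f x\<bar> * ennreal \<bar>(v (x + w) - v x) $ i\<bar> \<partial>tor) \<le> ennreal (D ^ 2 * (A * U i) * (norm w powr a * norm w powr b))"
        using increments2[OF w w, of i] by (simp add: ennreal_mult')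
      also have "norm w powr a * norm w powr b = norm w powr (a + b)" by (simp add: powr_add[symmetric])
      also have "ennreal (D ^ 2 * (A * U i) * norm w powr (a + b)) \<le> ennreal (C * (A * A * U i) * norm w powr (a + b))"
        using A U[of i] C(7) D by (intro ennreal_leI mult_right_mono mult_mono C AU) auto
      finally show "(\<integral>\<^sup>+x. ennreal \<bar>f (x + w) - f x\<bar> * ennreal \<bar>(v (x + w) - v x) $ i\<bar> \<partial>tor) \<le> ennreal (C * (A * A * U i) * norm w powr (a + b))" .
    qed (measurable, simp_all, measurable)
    then show ?thesis by (simp add: ennreal_mult' mult_ac)
  qed
  show "(\<integral>\<^sup>+x. ennreal (norm (v x)) * ennreal \<bar>f (x + w) - f x\<bar> \<partial>tor) \<le> ennreal (G * norm w powr a)"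
  proof -
    have "(\<integral>\<^sup>+x. ennreal \<bar>f (x + w) - f x\<bar> * ennreal (norm (v x)) \<partial>tor) \<le> ennreal (G * norm w powr a)"
    proof (rule sum_components)
      fix i
      have "(\<integral>\<^sup>+x. ennreal \<bar>f (x + w) - f x\<bar> * ennreal \<bar>v x $ i\<bar> \<partial>tor) \<le> ennreal (D * R * D ^ 2 * (A * U i) * norm w powr a)"
        by (rule v_weighted_increment[OF w])
      also have "\<dots> \<le> ennreal (C * (A * A * U i) * norm w powr a)"
        using A U[of i] C(7) D R by (intro ennreal_leI mult_right_mono mult_mono C AU) auto
      finally show "(\<integral>\<^sup>+x. ennreal \<bar>f (x + w) - f x\<bar> * ennreal \<bar>v x $ i\<bar> \<partial>tor) \<le> ennreal (C * (A * A * U i) * norm w powr a)" .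
    next
      show "(\<lambda>x. v x $ i) \<in> borel_measurable borel" for i by (rule v_nth_measurable)
      show "(\<lambda>x. ennreal \<bar>f (x + w) - f x\<bar>) \<in> borel_measurable borel" by measurable
      show "0 \<le> norm w powr a" by simp
    qed
    then show ?thesis by (simp add: mult.commute)
  qed
  show "(\<integral>\<^sup>+x. ennreal \<bar>f (x + w) - f x\<bar> \<partial>tor) \<le> ennreal (G * norm w powr a)"
  proof -
    \<comment> \<open>\<open>undefined\<close> stands for an arbitrary coordinate: a bound that
      involves \<open>f\<close> alone is already dominated by a single summand of
      \<open>G\<close>.\<close>
    have "D ^ 3 * A \<le> C * (A * A * U undefined)"
      using A U[of undefined] C(7) D by (intro mult_mono C AU) auto
    also have "\<dots> \<le> G" by (rule le_G)
    finally show ?thesis using increments1[OF w] by (meson ennreal_leI mult_right_mono order_trans powr_ge_zero)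
  qed
qed (rule f_int v_int f_per v_per a b G_nonneg div_free; assumption?)+

end

subsection \<open>From Lebesgue to Borel data\<close>

lemma AE_lebesgue_on:
  fixes S :: "'a::euclidean_space set"
  assumes "S \<in> sets borel"
  shows "(AE x in lebesgue_on S. P x) \<longleftrightarrow> (AE x in lborel. x \<in> S \<longrightarrow> P x)"
  using assms by (subst AE_restrict_space_iff) (auto simp: AE_completion_iff)

lemma nn_integral_lebesgue_on:
  fixes S :: "'a::euclidean_space set"
  assumes S: "S \<in> sets borel" and e: "AE x in lborel. x \<in> S \<longrightarrow> f x = F x"
  shows "(\<integral>\<^sup>+x. f x \<partial>lebesgue_on S) = (\<integral>\<^sup>+x. F x * indicator S x \<partial>lborel)"
proof -
  have "(\<integral>\<^sup>+x. f x \<partial>lebesgue_on S) = (\<integral>\<^sup>+x. f x * indicator S x \<partial>lborel)"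
    using S by (subst nn_integral_restrict_space) (auto simp: nn_integral_completion)
  also have "\<dots> = (\<integral>\<^sup>+x. F x * indicator S x \<partial>lborel)"
    using e by (intro nn_integral_cong_AE) (auto elim!: eventually_mono simp: indicator_def)
  finally show ?thesis .
qed

text \<open>Measurability of \<open>f\<close> on \<open>S\<close> is not presupposed: agreement
  almost everywhere with a Borel function provides it, by completeness of Lebesgue measure.\<close>

lemma integral_lebesgue_on:
  fixes S :: "'a::euclidean_space set" and f F :: "'a \<Rightarrow> real"
  assumes S: "S \<in> sets borel" and F [measurable]: "F \<in> borel_measurable borel" and e: "AE x in lborel. x \<in> S \<longrightarrow> f x = F x"
  shows "(LINT x|lebesgue_on S. f x) = (\<integral>x. F x \<partial>density lborel (indicator S))"
proof -
  have [measurable]: "S \<in> sets lborel" using S by simp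
  let ?F = "\<lambda>x. indicator S x *\<^sub>R F x" and ?f = "\<lambda>x. indicator S x *\<^sub>R f x"
  have m: "?F \<in> borel_measurable lborel" by measurable
  have ae: "AE x in lebesgue. ?F x = ?f x"
    unfolding AE_completion_iff using e by eventually_elim (auto simp: indicator_def)
  have "?f \<in> borel_measurable lebesgue"
    by (rule borel_measurable_AE[OF measurable_completion[OF m] ae])
  then have "(LINT x|lebesgue. ?f x) = (LINT x|lebesgue. ?F x)"
    using ae measurable_completion[OF m] by (intro integral_cong_AE) (auto elim!: eventually_mono)
  also have "\<dots> = (\<integral>x. ?F x \<partial>lborel)" by (rule integral_completion[OF m])
  also have "\<dots> = (\<integral>x. F x \<partial>density lborel (indicator S))"
    using integral_density[of F lborel "indicator S"] unfolding ennreal_indicator by simp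
  finally show ?thesis using S by (subst integral_restrict_space) auto
qed

lemma lebesgue_on_borel_version:
  fixes f :: "'a::euclidean_space \<Rightarrow> real"
  assumes S: "S \<in> sets borel" and f: "f \<in> borel_measurable (lebesgue_on S)"
  obtains F where "F \<in> borel_measurable borel" "AE x in lborel. x \<in> S \<longrightarrow> f x = F x"
proof -
  have "(\<lambda>x. indicator S x *\<^sub>R f x) \<in> borel_measurable lebesgue"
    using f S by (subst (asm) borel_measurable_restrict_space_iff) auto
  from completion_ex_borel_measurable_real[OF this] obtain F where
    "F \<in> borel_measurable lborel" "AE x in lborel. indicator S x *\<^sub>R f x = F x" by blast
  then show ?thesis by (intro that[of F]) (auto elim!: eventually_mono)
qed

lemma AE_lborel_shift:
  fixes P :: "'a::euclidean_space \<Rightarrow> bool"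
  assumes "AE x in lborel. P x"
  shows "AE x in lborel. P (x + a)"
proof -
  obtain Z where Z: "{x \<in> space lborel. \<not> P x} \<subseteq> Z" "emeasure lborel Z = 0" "Z \<in> sets lborel"
    using AE_E[OF assms] by blast
  then have [measurable]: "Z \<in> sets borel" by simp
  have "(\<integral>\<^sup>+x. indicator Z (x + a) \<partial>lborel) = (\<integral>\<^sup>+x. indicator Z x \<partial>lborel)"
    by (rule nn_integral_lborel_shift) measurable
  also have "\<dots> = 0" using Z(2) by simp
  finally have "AE x in lborel. indicator Z (x + a) = (0 :: ennreal)"
    by (subst (asm) nn_integral_0_iff_AE) auto
  then show ?thesis by eventually_elim (use Z(1) in \<open>auto simp: indicator_def split: if_splits\<close>)
qed

text \<open>\<open>wrap\<close> is no translation, but at each point it coincides with one of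
  countably many lattice translations, and countably many exceptional null sets can be discarded
  together.\<close>

lemma AE_lborel_wrap:
  fixes P :: "real ^ 'd \<Rightarrow> bool"
  assumes "AE x in lborel. P x"
  shows "AE x in lborel. P (wrap x)"
proof -
  have "AE x in lborel. \<forall>k :: 'd \<Rightarrow> int. P (x + (\<Sum>i\<in>UNIV. axis i (2 * pi * of_int (k i))))"
    unfolding AE_all_countable by (intro allI AE_lborel_shift assms)
  then show ?thesis
  proof eventually_elim
    case (elim x)
    have "x + (\<Sum>i\<in>UNIV. axis i (2 * pi * of_int (- \<lfloor>(x $ i + pi) / (2 * pi)\<rfloor>))) = wrap x"
      unfolding wrap_def by (simp add: vec_eq_iff axis_def sum.delta)
    then show ?case using elim[THEN spec, of "\<lambda>i. - \<lfloor>(x $ i + pi) / (2 * pi)\<rfloor>"] by (simp only:)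
  qed
qed

lemma wrap_measurable [measurable]: "wrap \<in> borel_measurable (borel :: (real ^ 'd) measure)"
proof -
  have c: "(\<lambda>x :: real ^ 'd. x $ i) \<in> borel_measurable borel" for i
    by (intro borel_measurable_continuous_onI continuous_intros)
  have "(\<lambda>x :: real ^ 'd. wrap x \<bullet> b) \<in> borel_measurable borel" if "b \<in> Basis" for b
  proof -
    obtain i where b: "b = axis i 1" using \<open>b \<in> Basis\<close> by (auto simp: Basis_vec_def)
    have [measurable]: "(\<lambda>x :: real ^ 'd. x $ i) \<in> borel_measurable borel" by (rule c)
    show ?thesis unfolding b by (simp add: inner_axis wrap_def)
  qed
  then show ?thesis by (subst borel_measurable_euclidean_space) blast
qed

lemma wrap_periodic: "wrap (x + axis i (2 * pi)) = wrap x"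
proof -
  have "(x $ i + 2 * pi + pi) / (2 * pi) = (x $ i + pi) / (2 * pi) + 1" by (simp add: field_simps)
  then have "\<lfloor>(x $ i + 2 * pi + pi) / (2 * pi)\<rfloor> = \<lfloor>(x $ i + pi) / (2 * pi)\<rfloor> + 1" by simp
  then show ?thesis by (auto simp: wrap_def vec_eq_iff axis_def algebra_simps)
qed

lemma wrap_hcell: "x \<in> hcell \<Longrightarrow> wrap x = x"
proof -
  assume x: "x \<in> hcell"
  have "\<lfloor>(x $ i + pi) / (2 * pi)\<rfloor> = 0" for i
  proof -
    have "- pi \<le> x $ i" "x $ i < pi" using x unfolding hcell_def by auto
    then show ?thesis by (intro floor_unique) (auto simp: field_simps)
  qed
  then show ?thesis by (simp add: wrap_def vec_eq_iff)
qed

text \<open>A Borel representative need not be periodic; composing it with \<open>wrap\<close> makes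
  it so at every point. Fubini gives agreement on almost every slice, and
  \<open>AE_lborel_wrap\<close> together with the periodicity of \<open>f\<close> preserves it under
  the composition.\<close>

lemma periodic_borel_version:
  fixes f :: "real \<Rightarrow> real ^ 'd \<Rightarrow> real"
  assumes f: "(\<lambda>(t, x). f t x) \<in> borel_measurable (lebesgue_on ({0..T} \<times> UNIV))" and p: "\<And>t. t \<in> {0..T} \<Longrightarrow> periodic (f t)"
  obtains F where "(\<lambda>(t, x). F t x) \<in> borel_measurable (borel \<Otimes>\<^sub>M borel)" "\<And>t. periodic (F t)"
    "AE t in lborel. t \<in> {0..T} \<longrightarrow> (AE x in lborel. f t x = F t x)"
    "AE z in lborel. z \<in> {0<..<T} \<times> torus_cell \<longrightarrow> f (fst z) (snd z) = F (fst z) (snd z)"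
proof -
  obtain h where h: "h \<in> borel_measurable borel" "AE z in lborel. z \<in> {0..T} \<times> UNIV \<longrightarrow> (case z of (t, x) \<Rightarrow> f t x) = h z"
    using lebesgue_on_borel_version[OF borel_closed[OF closed_Times[OF closed_atLeastAtMost closed_UNIV]] f] by blast
  have h' [measurable]: "h \<in> borel_measurable (borel \<Otimes>\<^sub>M borel)" using h(1) by (simp add: borel_prod)
  define F where "F t x = h (t, wrap x)" for t x
  have Fm: "(\<lambda>(t, x). F t x) \<in> borel_measurable (borel \<Otimes>\<^sub>M borel)" unfolding F_def by measurable
  have Fp: "periodic (F t)" for t unfolding F_def periodic_def by (simp add: wrap_periodic)
  have ae: "AE t in lborel. AE x in lborel. t \<in> {0..T} \<longrightarrow> f t x = h (t, x)"
  proof -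
    have "AE z in lborel \<Otimes>\<^sub>M lborel. fst z \<in> {0..T} \<longrightarrow> f (fst z) (snd z) = h z"
      using h(2) unfolding lborel_prod by eventually_elim auto
    from lborel_pair.AE_pair[OF this] show ?thesis by simp
  qed
  have 1: "AE t in lborel. t \<in> {0..T} \<longrightarrow> (AE x in lborel. f t x = F t x)"
    using ae
  proof eventually_elim
    case (elim t)
    show ?case
    proof
      assume t: "t \<in> {0..T}"
      from AE_lborel_wrap[OF elim] show "AE x in lborel. f t x = F t x"
        by eventually_elim (use t periodic_wrap[OF p[OF t]] in \<open>simp add: F_def\<close>)
    qed
  qed
  \<comment> \<open>\<open>wrap\<close> fixes the points of the half-open cell only; the faces of
    the closed cell have to be discarded as a null set, here in space-time.\<close>
  have hc: "AE z in (lborel :: (real \<times> (real ^ 'd)) measure). snd z \<in> torus_cell \<longrightarrow> snd z \<in> hcell"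
  proof -
    have "AE x in (lborel :: (real ^ 'd) measure). \<forall>i\<in>UNIV. x $ i \<noteq> pi"
      by (rule AE_finite_allI) (auto intro: AE_lborel_coord)
    then have a: "AE x in (lborel :: (real ^ 'd) measure). x \<in> torus_cell \<longrightarrow> x \<in> hcell"
      by eventually_elim (auto simp: hcell_def torus_cell_iff abs_le_iff minus_le_iff less_le)
    have "AE z in (lborel :: real measure) \<Otimes>\<^sub>M (lborel :: (real ^ 'd) measure). snd z \<in> torus_cell \<longrightarrow> snd z \<in> hcell"
    proof (rule lborel_pair.AE_pair_measure)
      show "{z \<in> space ((lborel :: real measure) \<Otimes>\<^sub>M (lborel :: (real ^ 'd) measure)). snd z \<in> torus_cell \<longrightarrow> snd z \<in> hcell} \<in> sets (lborel \<Otimes>\<^sub>M lborel)"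
        by measurable
      show "AE t in (lborel :: real measure). AE x in (lborel :: (real ^ 'd) measure). snd (t, x) \<in> torus_cell \<longrightarrow> snd (t, x) \<in> hcell"
        using a by simp
    qed
    then show ?thesis unfolding lborel_prod .
  qed
  have 2: "AE z in lborel. z \<in> {0<..<T} \<times> torus_cell \<longrightarrow> f (fst z) (snd z) = F (fst z) (snd z)"
    using h(2) hc by eventually_elim (auto simp: F_def wrap_hcell split: prod.splits)
  show ?thesis by (rule that[OF Fm Fp 1 2])
qed

lemma tim_tor_density: "tim T \<Otimes>\<^sub>M tor = density lborel (indicator ({0<..<T} \<times> (torus_cell :: (real ^ 'd) set)))"
proof -
  have "tim T \<Otimes>\<^sub>M (tor :: (real ^ 'd) measure) = density (lborel \<Otimes>\<^sub>M lborel) (\<lambda>(t, x). indicator {0<..<T} t * indicator torus_cell x)"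
    unfolding tim_def tor_def
    by (rule pair_measure_density) (auto intro: lborel.sigma_finite_measure_axioms tor.sigma_finite_measure_axioms[unfolded tor_def])
  also have "(\<lambda>(t, x). indicator {0<..<T} t * indicator torus_cell x) = (indicator ({0<..<T} \<times> (torus_cell :: (real ^ 'd) set)) :: _ \<Rightarrow> ennreal)"
    by (auto simp: indicator_def)
  finally show ?thesis by (simp add: lborel_prod)
qed

lemma AE_tim: "(AE t in tim T. P t) \<longleftrightarrow> (AE t in lborel. t \<in> {0<..<T} \<longrightarrow> P t)"
  unfolding tim_def by (subst AE_density) (auto simp: indicator_def)

subsection \<open>Besov data\<close>

lemma nn_integral_torus:
  assumes "AE x in lborel. f x = F x" and [measurable]: "F \<in> borel_measurable borel"
  shows "(\<integral>\<^sup>+x. f x \<partial>torus) = (\<integral>\<^sup>+x. F x \<partial>tor)"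
proof -
  have "AE x in lborel. x \<in> torus_cell \<longrightarrow> f x = F x" using assms(1) by eventually_elim simp
  then show ?thesis using nn_integral_lebesgue_on[of torus_cell f F] by (simp add: nn_integral_tor)
qed

lemma Lp_norm_finite_exponent:
  assumes "P \<ge> 1" and c: "c \<ge> 0" and le: "Lp_norm (ereal P) M (\<lambda>x. ennreal \<bar>g x\<bar>) \<le> ennreal c"
  shows "(\<integral>\<^sup>+x. ennreal (\<bar>g x\<bar> powr P) \<partial>M) \<le> ennreal (c powr P)"
proof -
  let ?I = "\<integral>\<^sup>+x. ennreal (\<bar>g x\<bar> powr P) \<partial>M"
  have "Lp_norm (ereal P) M (\<lambda>x. ennreal \<bar>g x\<bar>) = ennreal_pow ?I (1 / P)"
    by (simp add: Lp_norm_def ennreal_pow_def)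
  then have l: "ennreal_pow ?I (1 / P) \<le> ennreal c" using le by simp
  then have fin: "?I \<noteq> \<infinity>" by (auto simp: ennreal_pow_def top_unique)
  then have "ennreal (enn2real ?I powr (1 / P)) \<le> ennreal c" using l by (simp add: ennreal_pow_def)
  then have "enn2real ?I powr (1 / P) \<le> c" using c by simp
  then have "(enn2real ?I powr (1 / P)) powr P \<le> c powr P" using assms(1) by (intro powr_mono2) auto
  then have "enn2real ?I \<le> c powr P" using assms(1) by (simp add: powr_powr)
  then show ?thesis using fin by (metis ennreal_enn2real_if ennreal_leI infinity_ennreal_def)
qed

lemma Lp_norm_imp_Lb:
  fixes g F :: "real ^ 'd \<Rightarrow> real"
  assumes p: "1 \<le> p" and c: "c > 0" and le: "Lp_norm p torus (\<lambda>x. ennreal \<bar>g x\<bar>) \<le> ennreal c"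
    and ae: "AE x in lborel. g x = F x" and [measurable]: "F \<in> borel_measurable borel"
  shows "Lb p tor c F"
proof (cases "p = \<infinity>")
  case True
  have "AE x in torus. ennreal \<bar>g x\<bar> \<le> Lp_norm p torus (\<lambda>x. ennreal \<bar>g x\<bar>)"
    unfolding Lp_norm_def using True esssup_AE by simp
  then have "AE x in lborel. x \<in> torus_cell \<longrightarrow> ennreal \<bar>g x\<bar> \<le> Lp_norm p torus (\<lambda>x. ennreal \<bar>g x\<bar>)"
    by (subst (asm) AE_lebesgue_on) auto
  with ae have "AE x in tor. \<bar>F x\<bar> \<le> c"
    unfolding AE_tor
  proof eventually_elim
    case (elim x)
    show ?case
    proof
      assume "x \<in> torus_cell"
      then have "ennreal \<bar>F x\<bar> \<le> ennreal c" using elim le by (auto intro: order_trans)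
      then show "\<bar>F x\<bar> \<le> c" using c by simp
    qed
  qed
  then show ?thesis using True by (simp add: Lb_def)
next
  case False
  then obtain P where P: "p = ereal P" "P \<ge> 1" using p by (cases p) auto
  have "(\<integral>\<^sup>+x. ennreal (\<bar>g x\<bar> powr P) \<partial>torus) = (\<integral>\<^sup>+x. ennreal (\<bar>F x\<bar> powr P) \<partial>tor)"
    by (rule nn_integral_torus) (use ae in \<open>auto elim!: eventually_mono\<close>)
  then have I: "(\<integral>\<^sup>+x. ennreal (\<bar>F x\<bar> powr P) \<partial>tor) \<le> ennreal (c powr P)"
    using Lp_norm_finite_exponent[OF P(2) less_imp_le[OF c] le[unfolded P(1)]] by simp
  have "(\<integral>\<^sup>+x. ennreal ((\<bar>F x\<bar> / c) powr P) \<partial>tor) = (\<integral>\<^sup>+x. ennreal (1 / c powr P) * ennreal (\<bar>F x\<bar> powr P) \<partial>tor)"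
    using c by (intro nn_integral_cong) (simp add: powr_divide ennreal_mult'[symmetric])
  also have "\<dots> = ennreal (1 / c powr P) * (\<integral>\<^sup>+x. ennreal (\<bar>F x\<bar> powr P) \<partial>tor)"
    by (rule nn_integral_cmult) measurable
  also have "\<dots> \<le> ennreal (1 / c powr P) * ennreal (c powr P)" by (intro mult_left_mono I) auto
  also have "\<dots> = 1" using c by (subst ennreal_mult'[symmetric]) auto
  finally show ?thesis using P by (simp add: Lb_def)
qed

lemma Lp_norm_imp_integrable:
  fixes g F :: "real ^ 'd \<Rightarrow> real"
  assumes p: "1 \<le> p" and le: "Lp_norm p torus (\<lambda>x. ennreal \<bar>g x\<bar>) < \<infinity>"
    and ae: "AE x in lborel. g x = F x" and F [measurable]: "F \<in> borel_measurable borel"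
  shows "integrable tor F"
proof -
  obtain c0 where "Lp_norm p torus (\<lambda>x. ennreal \<bar>g x\<bar>) \<le> ennreal c0"
    using le by (cases "Lp_norm p torus (\<lambda>x. ennreal \<bar>g x\<bar>)") auto
  then have "Lp_norm p torus (\<lambda>x. ennreal \<bar>g x\<bar>) \<le> ennreal (max 1 c0)"
    by (meson ennreal_leI max.cobounded2 order_trans)
  then have L: "Lb p tor (max 1 c0) F" by (intro Lp_norm_imp_Lb[OF p _ _ ae F]) auto
  show ?thesis
  proof (cases "p = \<infinity>")
    case True
    then show ?thesis using L by (intro tor.integrable_const_bound[of _ "max 1 c0"]) (auto simp: Lb_def)
  next
    case False
    then obtain P where P: "p = ereal P" "P \<ge> 1" using p by (cases p) auto
    have le1: "r \<le> 1 + r powr P" if "r \<ge> 0" for r :: real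
    proof (cases "r \<le> 1")
      case False
      then have "r powr 1 \<le> r powr P" using P by (intro powr_mono) auto
      then show ?thesis using False by simp
    qed (simp add: add_increasing2)
    let ?c = "max 1 c0"
    have "(\<integral>\<^sup>+x. ennreal (norm (F x)) \<partial>tor) \<le> (\<integral>\<^sup>+x. ennreal ?c * (1 + ennreal ((\<bar>F x\<bar> / ?c) powr P)) \<partial>tor)"
    proof (rule nn_integral_mono)
      fix x
      have "\<bar>F x\<bar> / ?c \<le> 1 + (\<bar>F x\<bar> / ?c) powr P" by (rule le1) simp
      then have "?c * (\<bar>F x\<bar> / ?c) \<le> ?c * (1 + (\<bar>F x\<bar> / ?c) powr P)" by (rule mult_left_mono) simp
      moreover have "?c \<noteq> 0" by (simp add: max_def)
      ultimately have "norm (F x) \<le> ?c * (1 + (\<bar>F x\<bar> / ?c) powr P)" by simp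
      then have "ennreal (norm (F x)) \<le> ennreal (?c * (1 + (\<bar>F x\<bar> / ?c) powr P))" by (rule ennreal_leI)
      also have "\<dots> = ennreal ?c * (1 + ennreal ((\<bar>F x\<bar> / ?c) powr P))"
        by (subst ennreal_mult') (auto simp: ennreal_plus)
      finally show "ennreal (norm (F x)) \<le> ennreal ?c * (1 + ennreal ((\<bar>F x\<bar> / ?c) powr P))" .
    qed
    also have "\<dots> = ennreal ?c * (emeasure (tor :: (real ^ 'd) measure) UNIV + (\<integral>\<^sup>+x. ennreal ((\<bar>F x\<bar> / ?c) powr P) \<partial>tor))"
      by (simp add: nn_integral_cmult nn_integral_add)
    also have "\<dots> \<le> ennreal ?c * (emeasure (tor :: (real ^ 'd) measure) UNIV + 1)"
      using L P by (intro mult_left_mono add_left_mono) (auto simp: Lb_def)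
    also have "\<dots> < \<infinity>" by (simp add: emeasure_tor ennreal_mult_less_top)
    finally show ?thesis by (intro integrableI_bounded) auto
  qed
qed

text \<open>Multiplying the quotient in the seminorm by \<open>norm w powr \<alpha>\<close> requires
  a nonzero displacement. Both values in the increment are replaced by those of the representative,
  since null sets are translation invariant.\<close>

lemma besov_increment_Lb:
  fixes g F :: "real ^ 'd \<Rightarrow> real"
  assumes p: "1 \<le> p" and N: "besov_norm \<alpha> p g < \<infinity>" and A: "A \<ge> enn2real (besov_norm \<alpha> p g)" "A > 0"
    and w: "w \<in> torus_cell" "w \<noteq> 0"
    and ae: "AE x in lborel. g x = F x" and F [measurable]: "F \<in> borel_measurable borel"
  shows "Lb p tor (A * norm w powr \<alpha>) (\<lambda>x. F (x + w) - F x)"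
proof (rule Lp_norm_imp_Lb[OF p])
  let ?L = "Lp_norm p torus (\<lambda>x. ennreal \<bar>g (x + w) - g x\<bar>)"
  have n: "norm w powr \<alpha> > 0" using w by simp
  have "?L / ennreal (norm w powr \<alpha>) \<le> besov_norm \<alpha> p g"
    unfolding besov_norm_def by (rule SUP_upper) (use w in auto)
  also have "\<dots> \<le> ennreal A" using N A(1) by (metis ennreal_enn2real ennreal_leI infinity_ennreal_def)
  finally have "?L / ennreal (norm w powr \<alpha>) * ennreal (norm w powr \<alpha>) \<le> ennreal A * ennreal (norm w powr \<alpha>)"
    by (rule mult_right_mono) auto
  also have "?L / ennreal (norm w powr \<alpha>) * ennreal (norm w powr \<alpha>) = ?L"
    using n by (simp add: ennreal_divide_times)
  finally show "?L \<le> ennreal (A * norm w powr \<alpha>)" using A(2) by (simp add: ennreal_mult')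
  show "0 < A * norm w powr \<alpha>" using A(2) n by simp
  show "AE x in lborel. g (x + w) - g x = F (x + w) - F x"
    using ae AE_lborel_shift[OF ae, of w] by eventually_elim simp
qed measurable

lemma integral_torus:
  fixes g F :: "real ^ 'd \<Rightarrow> real"
  assumes "AE x in lborel. g x = F x" and [measurable]: "F \<in> borel_measurable borel"
  shows "(LINT x|torus. g x) = (\<integral>x. F x \<partial>tor)"
  unfolding tor_def using assms by (intro integral_lebesgue_on) (auto elim!: eventually_mono)

text \<open>In time only the finiteness of the powers matters; \<open>c\<close> is \<open>1\<close> unless the exponent is infinite.\<close>

lemma time_norm_pw:
  fixes n :: "real \<Rightarrow> ennreal" and \<nu> :: "real \<Rightarrow> real"
  assumes s: "1 \<le> s" and le: "Lp_norm s (lebesgue_on {0<..<T}) n < \<infinity>"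
    and ae: "AE t in lborel. t \<in> {0<..<T} \<longrightarrow> n t < \<infinity> \<and> enn2real (n t) = \<nu> t" and [measurable]: "\<nu> \<in> borel_measurable borel"
  obtains c where "c \<ge> 1" "s = \<infinity> \<Longrightarrow> AE t in tim T. max 1 \<bar>\<nu> t\<bar> / c \<le> 1"
    "(\<integral>\<^sup>+t. ennreal (pw s (max 1 \<bar>\<nu> t\<bar> / c)) \<partial>tim T) < \<infinity>"
proof (cases "s = \<infinity>")
  case True
  obtain c0 where c0: "Lp_norm s (lebesgue_on {0<..<T}) n \<le> ennreal c0" "c0 \<ge> 0"
    using le by (cases "Lp_norm s (lebesgue_on {0<..<T}) n") auto
  have "AE t in lebesgue_on {0<..<T}. n t \<le> Lp_norm s (lebesgue_on {0<..<T}) n"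
    unfolding Lp_norm_def using True esssup_AE by simp
  then have "AE t in lborel. t \<in> {0<..<T} \<longrightarrow> n t \<le> Lp_norm s (lebesgue_on {0<..<T}) n"
    by (subst (asm) AE_lebesgue_on) auto
  with ae have "AE t in tim T. max 1 \<bar>\<nu> t\<bar> / max 1 c0 \<le> 1"
    unfolding AE_tim
  proof eventually_elim
    case (elim t)
    show ?case
    proof
      assume t: "t \<in> {0<..<T}"
      then have "n t \<le> ennreal c0" using elim c0(1) by (auto intro: order_trans)
      then have "enn2real (n t) \<le> c0" using c0(2) by (rule enn2real_leI[rotated])
      then have "\<bar>\<nu> t\<bar> \<le> c0" using elim t enn2real_nonneg[of "n t"] by auto
      then show "max 1 \<bar>\<nu> t\<bar> / max 1 c0 \<le> 1" by (subst divide_le_eq_1_pos) (auto simp: max_def)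
    qed
  qed
  then show ?thesis using True by (intro that[of "max 1 c0"]) (auto simp: pw_def)
next
  case False
  then obtain P where P: "s = ereal P" "P \<ge> 1" using s by (cases s) auto
  have I: "(\<integral>\<^sup>+t. ennreal_pow (n t) P \<partial>lebesgue_on {0<..<T}) < \<infinity>"
    using le P by (auto simp: Lp_norm_def ennreal_pow_def less_top[symmetric])
  have "(\<integral>\<^sup>+t. ennreal_pow (n t) P \<partial>lebesgue_on {0<..<T}) = (\<integral>\<^sup>+t. ennreal (\<bar>\<nu> t\<bar> powr P) * indicator {0<..<T} t \<partial>lborel)"
  proof (rule nn_integral_lebesgue_on)
    show "AE t in lborel. t \<in> {0<..<T} \<longrightarrow> ennreal_pow (n t) P = ennreal (\<bar>\<nu> t\<bar> powr P)"
      using ae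
    proof eventually_elim
      case (elim t)
      show ?case
      proof
        assume "t \<in> {0<..<T}"
        then have "n t < \<infinity>" "\<nu> t = enn2real (n t)" using elim by auto
        then show "ennreal_pow (n t) P = ennreal (\<bar>\<nu> t\<bar> powr P)" by (auto simp: ennreal_pow_def enn2real_nonneg)
      qed
    qed
  qed simp
  also have "\<dots> = (\<integral>\<^sup>+t. ennreal (\<bar>\<nu> t\<bar> powr P) \<partial>tim T)"
    unfolding tim_def by (subst nn_integral_density) (auto simp: mult.commute)
  finally have J: "(\<integral>\<^sup>+t. ennreal (\<bar>\<nu> t\<bar> powr P) \<partial>tim T) < \<infinity>" using I by simp
  have "(\<integral>\<^sup>+t. ennreal (pw s (max 1 \<bar>\<nu> t\<bar> / 1)) \<partial>tim T) \<le> (\<integral>\<^sup>+t. 1 + ennreal (\<bar>\<nu> t\<bar> powr P) \<partial>tim T)"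
  proof (rule nn_integral_mono)
    fix t
    have "pw s (max 1 \<bar>\<nu> t\<bar> / 1) \<le> 1 + \<bar>\<nu> t\<bar> powr P" using P by (auto simp: pw_def max_def)
    then have "ennreal (pw s (max 1 \<bar>\<nu> t\<bar> / 1)) \<le> ennreal (1 + \<bar>\<nu> t\<bar> powr P)" by (rule ennreal_leI)
    then show "ennreal (pw s (max 1 \<bar>\<nu> t\<bar> / 1)) \<le> 1 + ennreal (\<bar>\<nu> t\<bar> powr P)" by simp
  qed
  also have "\<dots> = emeasure (tim T) UNIV + (\<integral>\<^sup>+t. ennreal (\<bar>\<nu> t\<bar> powr P) \<partial>tim T)"
    by (simp add: nn_integral_add)
  also have "\<dots> < \<infinity>"
  proof -
    have "emeasure (tim T) UNIV < \<infinity>" using tim.emeasure_finite[of T UNIV] by (simp add: less_top[symmetric])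
    then show ?thesis using J by simp
  qed
  finally show ?thesis using P by (intro that[of 1]) auto
qed

text \<open>Hoelder's inequality in time, again in the pointwise form of \<open>young3\<close>. The
  solution enters twice and the velocity once, as in the commutator, which dictates the condition on
  \<open>s\<close> and \<open>r\<close>.\<close>

lemma integrable_time_product:
  fixes \<nu> \<mu> :: "real \<Rightarrow> real"
  assumes [measurable]: "\<nu> \<in> borel_measurable borel" "\<mu> \<in> borel_measurable borel" and s: "1 \<le> s" "1 \<le> r" "2 / s + 1 / r \<le> (1 :: ereal)"
    and c: "c \<ge> 1" "s = \<infinity> \<Longrightarrow> AE t in tim T. max 1 \<bar>\<nu> t\<bar> / c \<le> 1" "(\<integral>\<^sup>+t. ennreal (pw s (max 1 \<bar>\<nu> t\<bar> / c)) \<partial>tim T) < \<infinity>"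
    and d: "d \<ge> 1" "r = \<infinity> \<Longrightarrow> AE t in tim T. max 1 \<bar>\<mu> t\<bar> / d \<le> 1" "(\<integral>\<^sup>+t. ennreal (pw r (max 1 \<bar>\<mu> t\<bar> / d)) \<partial>tim T) < \<infinity>"
  shows "integrable (tim T) (\<lambda>t. max 1 \<bar>\<nu> t\<bar> * max 1 \<bar>\<nu> t\<bar> * max 1 \<bar>\<mu> t\<bar>)"
proof (rule integrableI_bounded)
  let ?x = "\<lambda>t. max 1 \<bar>\<nu> t\<bar> / c" and ?z = "\<lambda>t. max 1 \<bar>\<mu> t\<bar> / d"
  have "AE t in tim T. s = \<infinity> \<longrightarrow> ?x t \<le> 1" "AE t in tim T. r = \<infinity> \<longrightarrow> ?z t \<le> 1"
  proof -
    show "AE t in tim T. s = \<infinity> \<longrightarrow> ?x t \<le> 1" by (cases "s = \<infinity>") (use c(2) in simp_all)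
    show "AE t in tim T. r = \<infinity> \<longrightarrow> ?z t \<le> 1" by (cases "r = \<infinity>") (use d(2) in simp_all)
  qed
  then have "AE t in tim T. ennreal (norm (max 1 \<bar>\<nu> t\<bar> * max 1 \<bar>\<nu> t\<bar> * max 1 \<bar>\<mu> t\<bar>)) \<le>
      ennreal (c * c * d) * (1 + ennreal (pw s (?x t)) + ennreal (pw s (?x t)) + ennreal (pw r (?z t)))"
  proof eventually_elim
    case (elim t)
    have "0 \<le> ?x t" "0 \<le> ?z t" using c(1) d(1) by (simp_all add: le_max_iff_disj)
    then have "?x t * ?x t * ?z t \<le> 1 + pw s (?x t) + pw s (?x t) + pw r (?z t)"
      by (intro young3 s) (use elim in blast)+
    then have "c * c * d * (?x t * ?x t * ?z t) \<le> c * c * d * (1 + pw s (?x t) + pw s (?x t) + pw r (?z t))"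
      using c(1) d(1) by (intro mult_left_mono) auto
    moreover have "c * c * d * (?x t * ?x t * ?z t) = norm (max 1 \<bar>\<nu> t\<bar> * max 1 \<bar>\<nu> t\<bar> * max 1 \<bar>\<mu> t\<bar>)"
    proof -
      have e: "c * c * d * (x / c * (x / c) * (z / d)) = x * x * z" for x z :: real using c(1) d(1) by simp
      have n: "norm (max 1 \<bar>\<nu> t\<bar> * max 1 \<bar>\<nu> t\<bar> * max 1 \<bar>\<mu> t\<bar>) = max 1 \<bar>\<nu> t\<bar> * max 1 \<bar>\<nu> t\<bar> * max 1 \<bar>\<mu> t\<bar>"
        unfolding real_norm_def by (intro abs_of_nonneg mult_nonneg_nonneg) auto
      show ?thesis by (rule trans[OF e n[symmetric]])
    qed
    ultimately have "norm (max 1 \<bar>\<nu> t\<bar> * max 1 \<bar>\<nu> t\<bar> * max 1 \<bar>\<mu> t\<bar>) \<le> c * c * d * (1 + pw s (?x t) + pw s (?x t) + pw r (?z t))"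
      by (simp only:)
    then have "ennreal (norm (max 1 \<bar>\<nu> t\<bar> * max 1 \<bar>\<nu> t\<bar> * max 1 \<bar>\<mu> t\<bar>)) \<le> ennreal (c * c * d * (1 + pw s (?x t) + pw s (?x t) + pw r (?z t)))"
      by (rule ennreal_leI)
    also have "\<dots> = ennreal (c * c * d) * (1 + ennreal (pw s (?x t)) + ennreal (pw s (?x t)) + ennreal (pw r (?z t)))"
      using c(1) d(1) by (simp add: ennreal_mult' ennreal_plus[symmetric] pw_nonneg add_nonneg_nonneg ennreal_1[symmetric] del: ennreal_plus ennreal_1)
    finally show ?case .
  qed
  then have "(\<integral>\<^sup>+t. ennreal (norm (max 1 \<bar>\<nu> t\<bar> * max 1 \<bar>\<nu> t\<bar> * max 1 \<bar>\<mu> t\<bar>)) \<partial>tim T) \<le>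
     (\<integral>\<^sup>+t. ennreal (c * c * d) * (1 + ennreal (pw s (?x t)) + ennreal (pw s (?x t)) + ennreal (pw r (?z t))) \<partial>tim T)"
    by (rule nn_integral_mono_AE)
  also have "\<dots> = ennreal (c * c * d) * (emeasure (tim T) UNIV + (\<integral>\<^sup>+t. ennreal (pw s (?x t)) \<partial>tim T) + (\<integral>\<^sup>+t. ennreal (pw s (?x t)) \<partial>tim T) + (\<integral>\<^sup>+t. ennreal (pw r (?z t)) \<partial>tim T))"
    by (simp add: nn_integral_cmult nn_integral_add)
  also have "\<dots> < \<infinity>"
  proof -
    have "emeasure (tim T) UNIV < \<infinity>" using tim.emeasure_finite[of T UNIV] by (simp add: less_top[symmetric])
    then have "emeasure (tim T) UNIV + (\<integral>\<^sup>+t. ennreal (pw s (?x t)) \<partial>tim T) + (\<integral>\<^sup>+t. ennreal (pw s (?x t)) \<partial>tim T) + (\<integral>\<^sup>+t. ennreal (pw r (?z t)) \<partial>tim T) < \<infinity>"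
      using c(3) d(3) unfolding infinity_ennreal_def by (simp only: ennreal_add_less_top simp_thms)
    then show ?thesis unfolding infinity_ennreal_def by (intro ennreal_mult_less_top[THEN iffD2] disjI2 conjI ennreal_less_top)
  qed
  finally show "(\<integral>\<^sup>+t. ennreal (norm (max 1 \<bar>\<nu> t\<bar> * max 1 \<bar>\<nu> t\<bar> * max 1 \<bar>\<mu> t\<bar>)) \<partial>tim T) < \<infinity>" .
qed measurable

lemma integrable_pair_of_slices:
  fixes F :: "real \<Rightarrow> real ^ 'd \<Rightarrow> 'b::{banach, second_countable_topology}"
  assumes [measurable]: "(\<lambda>(t, x). F t x) \<in> borel_measurable (borel \<Otimes>\<^sub>M borel)"
    and G: "integrable (tim T) G" and le: "AE t in tim T. (\<integral>\<^sup>+x. ennreal (norm (F t x)) \<partial>tor) \<le> ennreal (G t)"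
  shows "integrable (tim T \<Otimes>\<^sub>M tor) (\<lambda>(t, x). F t x)"
proof (rule integrableI_bounded)
  have "(\<integral>\<^sup>+z. ennreal (norm (case z of (t, x) \<Rightarrow> F t x)) \<partial>(tim T \<Otimes>\<^sub>M tor)) = (\<integral>\<^sup>+t. \<integral>\<^sup>+x. ennreal (norm (F t x)) \<partial>tor \<partial>tim T)"
    by (subst tor.nn_integral_fst[symmetric]) auto
  also have "\<dots> \<le> (\<integral>\<^sup>+t. ennreal (norm (G t)) \<partial>tim T)"
  proof (rule nn_integral_mono_AE)
    show "AE t in tim T. (\<integral>\<^sup>+x. ennreal (norm (F t x)) \<partial>tor) \<le> ennreal (norm (G t))"
      using le
    proof eventually_elim
      case (elim t)
      also have "ennreal (G t) \<le> ennreal (norm (G t))" by (intro ennreal_leI) simp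
      finally show ?case .
    qed
  qed
  also have "\<dots> < \<infinity>" using G by (simp add: integrable_iff_bounded)
  finally show "(\<integral>\<^sup>+z. ennreal (norm (case z of (t, x) \<Rightarrow> F t x)) \<partial>(tim T \<Otimes>\<^sub>M tor)) < \<infinity>" .
qed measurable

lemma vec_lambda_measurable:
  fixes f :: "'d::finite \<Rightarrow> 'a \<Rightarrow> real"
  assumes "\<And>i. f i \<in> borel_measurable M"
  shows "(\<lambda>x. \<chi> i. f i x) \<in> borel_measurable M"
proof -
  have "(\<lambda>x. (\<chi> i. f i x) \<bullet> b) \<in> borel_measurable M" if "b \<in> Basis" for b
  proof -
    obtain i where "b = axis i 1" using \<open>b \<in> Basis\<close> by (auto simp: Basis_vec_def)
    then show ?thesis using assms[of i] by (simp add: inner_axis)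
  qed
  then show ?thesis by (subst borel_measurable_euclidean_space) blast
qed

text \<open>Agreement is recorded twice: almost everywhere in space-time, to transfer the integrals
  of the weak formulation, and on almost every time slice, to transfer the Besov bounds. \<nu> is a
  Borel version of the seminorm in time, and \<open>c\<close> is the normalisation for
  \<open>young3\<close>.\<close>

definition borel_version ::
  "real \<Rightarrow> ereal \<Rightarrow> real \<Rightarrow> ereal \<Rightarrow> (real \<Rightarrow> real ^ 'd \<Rightarrow> real) \<Rightarrow> (real \<Rightarrow> real ^ 'd \<Rightarrow> real) \<Rightarrow> (real \<Rightarrow> real) \<Rightarrow> real \<Rightarrow> bool" where
  "borel_version T s \<alpha> p f F \<nu> c \<longleftrightarrow>
    (\<lambda>(t, x). F t x) \<in> borel_measurable (borel \<Otimes>\<^sub>M borel) \<and> (\<forall>t. periodic (F t)) \<and>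
    (AE z in lborel. z \<in> {0<..<T} \<times> torus_cell \<longrightarrow> f (fst z) (snd z) = F (fst z) (snd z)) \<and>
    (AE t in tim T. f t \<in> besov \<alpha> p \<and> (AE x in lborel. f t x = F t x) \<and> enn2real (besov_norm \<alpha> p (f t)) = \<nu> t) \<and>
    \<nu> \<in> borel_measurable borel \<and> c \<ge> 1 \<and> (s = \<infinity> \<longrightarrow> (AE t in tim T. max 1 \<bar>\<nu> t\<bar> / c \<le> 1)) \<and>
    (\<integral>\<^sup>+t. ennreal (pw s (max 1 \<bar>\<nu> t\<bar> / c)) \<partial>tim T) < \<infinity>"

lemma Lp_besov_borel_version:
  fixes f :: "real \<Rightarrow> real ^ 'd \<Rightarrow> real"
  assumes f: "f \<in> Lp_besov T s \<alpha> p" and per: "\<forall>t \<in> {0..T}. periodic (f t)" and s: "1 \<le> s"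
  shows "\<exists>F \<nu> c. borel_version T s \<alpha> p f F \<nu> c"
proof -
  have m: "(\<lambda>(t, x). f t x) \<in> borel_measurable (lebesgue_on ({0..T} \<times> UNIV))"
    and b: "AE t in lebesgue_on {0<..<T}. f t \<in> besov \<alpha> p"
    and n: "(\<lambda>t. besov_norm \<alpha> p (f t)) \<in> borel_measurable (lebesgue_on {0<..<T})"
    and l: "Lp_norm s (lebesgue_on {0<..<T}) (\<lambda>t. besov_norm \<alpha> p (f t)) < \<infinity>"
    using f unfolding Lp_besov_def mem_Collect_eq by blast+
  obtain F where F: "(\<lambda>(t, x). F t x) \<in> borel_measurable (borel \<Otimes>\<^sub>M borel)" "\<And>t. periodic (F t)"
    "AE t in lborel. t \<in> {0..T} \<longrightarrow> (AE x in lborel. f t x = F t x)"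
    "AE z in lborel. z \<in> {0<..<T} \<times> torus_cell \<longrightarrow> f (fst z) (snd z) = F (fst z) (snd z)"
  proof (rule periodic_borel_version[OF m])
    show "periodic (f t)" if "t \<in> {0..T}" for t using per that by blast
  qed (rule that; (assumption | simp))
  have nm: "(\<lambda>t. enn2real (besov_norm \<alpha> p (f t))) \<in> borel_measurable (lebesgue_on {0<..<T})" using n by simp
  obtain \<nu> where \<nu>: "\<nu> \<in> borel_measurable borel" "AE t in lborel. t \<in> {0<..<T} \<longrightarrow> enn2real (besov_norm \<alpha> p (f t)) = \<nu> t"
    by (rule lebesgue_on_borel_version[OF borel_open[OF open_greaterThanLessThan] nm]) (rule that; assumption)
  have b': "AE t in lborel. t \<in> {0<..<T} \<longrightarrow> f t \<in> besov \<alpha> p" using b by (subst (asm) AE_lebesgue_on) auto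
  have fin: "AE t in lborel. t \<in> {0<..<T} \<longrightarrow> besov_norm \<alpha> p (f t) < \<infinity> \<and> enn2real (besov_norm \<alpha> p (f t)) = \<nu> t"
    using b' \<nu>(2) by eventually_elim (auto simp: besov_def)
  obtain c where c: "c \<ge> 1" "s = \<infinity> \<Longrightarrow> AE t in tim T. max 1 \<bar>\<nu> t\<bar> / c \<le> 1"
    "(\<integral>\<^sup>+t. ennreal (pw s (max 1 \<bar>\<nu> t\<bar> / c)) \<partial>tim T) < \<infinity>"
    by (rule time_norm_pw[OF s l fin \<nu>(1)]) (rule that; (assumption | blast))
  have ae: "AE t in tim T. f t \<in> besov \<alpha> p \<and> (AE x in lborel. f t x = F t x) \<and> enn2real (besov_norm \<alpha> p (f t)) = \<nu> t"
    unfolding AE_tim using b' \<nu>(2) F(3) by eventually_elim auto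
  have "borel_version T s \<alpha> p f F \<nu> c"
    unfolding borel_version_def by (intro conjI allI impI F(1,2,4) ae \<nu>(1) c)
  then show ?thesis by blast
qed

lemma finite_AE_all:
  fixes P :: "'d::finite \<Rightarrow> 'a \<Rightarrow> bool"
  assumes "\<And>i. AE x in M. P i x"
  shows "AE x in M. \<forall>i. P i x"
proof -
  have "AE x in M. \<forall>i\<in>UNIV. P i x" by (rule AE_finite_allI) (use assms in auto)
  then show ?thesis by simp
qed

theorem theorem1:
  fixes T \<alpha> \<beta> :: real
    and p q p1 q1 :: ereal
    and u :: "real \<Rightarrow> real ^ 'd \<Rightarrow> real ^ 'd"
    and \<theta> :: "real \<Rightarrow> real ^ 'd \<Rightarrow> real"
  assumes "T > 0"
    and "0 < \<alpha>" "\<alpha> < 1" "0 < \<beta>" "\<beta> < 1"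
    and "1 \<le> p" "1 \<le> q"
    and "\<forall>t \<in> {0..T}. periodic (u t)" "\<forall>t \<in> {0..T}. periodic (\<theta> t)"
    and "weakly_div_free T u"
    and "weak_transport_solution T u \<theta>"
    and "\<theta> \<in> Lp_besov T p1 \<alpha> p"
    and "\<forall>i. (\<lambda>t x. u t x $ i) \<in> Lp_besov T q1 \<beta> q"
    and "2 * \<alpha> + \<beta> > 1"
    and "2 / p + 1 / q = 1"
    and "2 < p1" "p1 \<le> p * ereal CARD('d) / max (ereal CARD('d) - p * ereal \<alpha>) 0"
    and "1 \<le> q1" "q1 \<le> q * ereal CARD('d) / max (ereal CARD('d) - q * ereal \<beta>) 0"
    and "2 / p1 + 1 / q1 < 1"
  shows "\<forall>r::real. r \<ge> 1 \<and> loc_integrable T (\<lambda>t x. (\<bar>\<theta> t x\<bar> powr r) *\<^sub>R u t x) \<longrightarrow>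
           weak_transport_solution T u (\<lambda>t x. \<bar>\<theta> t x\<bar> powr r)"
proof -
  have p1: "1 \<le> p1" using \<open>2 < p1\<close> by (cases p1) auto
  have pq1: "2 / p1 + 1 / q1 \<le> (1 :: ereal)" and pq: "2 / p + 1 / q \<le> (1 :: ereal)" using assms(15,20) by auto
  obtain F \<nu> c where FV: "borel_version T p1 \<alpha> p \<theta> F \<nu> c"
    using Lp_besov_borel_version[OF assms(12,9) p1] by blast
  have F [measurable]: "(\<lambda>(t, x). F t x) \<in> borel_measurable (borel \<Otimes>\<^sub>M borel)" and F_per: "periodic (F t)"
    and F_eq: "AE z in lborel. z \<in> {0<..<T} \<times> torus_cell \<longrightarrow> \<theta> (fst z) (snd z) = F (fst z) (snd z)"
    and F_ae: "AE t in tim T. \<theta> t \<in> besov \<alpha> p \<and> (AE x in lborel. \<theta> t x = F t x) \<and> enn2real (besov_norm \<alpha> p (\<theta> t)) = \<nu> t"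
    and \<nu> [measurable]: "\<nu> \<in> borel_measurable borel" and c: "c \<ge> 1" "p1 = \<infinity> \<Longrightarrow> AE t in tim T. max 1 \<bar>\<nu> t\<bar> / c \<le> 1"
    "(\<integral>\<^sup>+t. ennreal (pw p1 (max 1 \<bar>\<nu> t\<bar> / c)) \<partial>tim T) < \<infinity>" for t
    using FV unfolding borel_version_def by blast+
  have "\<exists>W \<mu> d. borel_version T q1 \<beta> q (\<lambda>t x. u t x $ i) W \<mu> d" for i
    using assms(8,13) by (intro Lp_besov_borel_version assms(18)) (auto simp: periodic_def)
  then obtain W \<mu> d where WV: "\<And>i. borel_version T q1 \<beta> q (\<lambda>t x. u t x $ i) (W i) (\<mu> i) (d i)"
    by metis
  have W [measurable]: "(\<lambda>(t, x). W i t x) \<in> borel_measurable (borel \<Otimes>\<^sub>M borel)" and W_per: "periodic (W i t)"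
    and W_eq: "AE z in lborel. z \<in> {0<..<T} \<times> torus_cell \<longrightarrow> u (fst z) (snd z) $ i = W i (fst z) (snd z)"
    and W_ae: "AE t in tim T. (\<lambda>x. u t x $ i) \<in> besov \<beta> q \<and> (AE x in lborel. u t x $ i = W i t x) \<and> enn2real (besov_norm \<beta> q (\<lambda>x. u t x $ i)) = \<mu> i t"
    and \<mu> [measurable]: "\<mu> i \<in> borel_measurable borel" and d: "d i \<ge> 1" "q1 = \<infinity> \<Longrightarrow> AE t in tim T. max 1 \<bar>\<mu> i t\<bar> / d i \<le> 1"
    "(\<integral>\<^sup>+t. ennreal (pw q1 (max 1 \<bar>\<mu> i t\<bar> / d i)) \<partial>tim T) < \<infinity>" for i t
    using WV[of i] unfolding borel_version_def by blast+
  define v where "v t x = (\<chi> i. W i t x)" for t x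
  have v_meas [measurable]: "(\<lambda>(t, x). v t x) \<in> borel_measurable (borel \<Otimes>\<^sub>M borel)"
    unfolding v_def case_prod_beta' by (rule vec_lambda_measurable) (use W in \<open>simp add: case_prod_beta'\<close>)
  have v_per: "periodic (v t)" for t using W_per unfolding v_def periodic_def by simp
  have v_eq: "AE z in lborel. z \<in> {0<..<T} \<times> torus_cell \<longrightarrow> u (fst z) (snd z) = v (fst z) (snd z)"
    using finite_AE_all[OF W_eq] by eventually_elim (auto simp: v_def vec_eq_iff)
  \<comment> \<open>The maxima with 1 meet the requirements of \<open>besov_data\<close> and cost no
    integrability, the time interval being finite.\<close>
  define A where "A t = max 1 \<bar>\<nu> t\<bar>" for t
  define U where "U t i = max 1 \<bar>\<mu> i t\<bar>" for t i
  \<comment> \<open>The bound of \<open>besov_data\<close> with its constants written out, so that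
    it is a function of every \<open>t\<close>. The definition inside the locale can be unfolded
    only at times when the data satisfy its assumptions; there \<open>G_eq\<close> identifies the
    two.\<close>
  define G where "G t = (\<Sum>i\<in>(UNIV :: 'd set). tor_const TYPE('d) ^ 5 * (real CARD('d) * pi) ^ 2 * (A t * A t * U t i))" for t
  have G_int: "integrable (tim T) G"
    unfolding G_def A_def U_def
    by (intro Bochner_Integration.integrable_sum integrable_mult_right integrable_time_product[OF \<nu> \<mu> p1 assms(18) pq1 c d])
  have div: "AE t in tim T. integrable torus (u t) \<and> (\<forall>\<psi>. smooth \<psi> \<and> periodic \<psi> \<longrightarrow> (LINT x|torus. u t x \<bullet> grad \<psi> x) = 0)"
    using assms(10) unfolding weakly_div_free_def AE_tim by (subst (asm) AE_lebesgue_on) auto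
  have W_all: "AE t in tim T. \<forall>i. (\<lambda>x. u t x $ i) \<in> besov \<beta> q \<and> (AE x in lborel. u t x $ i = W i t x) \<and> enn2real (besov_norm \<beta> q (\<lambda>x. u t x $ i)) = \<mu> i t"
    by (rule finite_AE_all) (rule W_ae)
  have data: "AE t in tim T. besov_data (F t) (v t) \<alpha> \<beta> p q (A t) (U t)"
    using F_ae W_all div
  proof eventually_elim
    case (elim t)
    have Fm [measurable]: "F t \<in> borel_measurable borel" by measurable
    have Wm [measurable]: "W i t \<in> borel_measurable borel" for i by measurable
    have \<theta>e: "AE x in lborel. \<theta> t x = F t x" and We: "AE x in lborel. u t x $ i = W i t x" for i using elim by auto
    have ue: "AE x in lborel. u t x = v t x"
      using finite_AE_all[OF We] by eventually_elim (simp add: v_def vec_eq_iff)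
    have Wi: "integrable tor (W i t)" for i
      using elim(2) by (intro Lp_norm_imp_integrable[OF assms(7) _ We Wm]) (auto simp: besov_def)
    have vi: "integrable tor (v t)"
    proof -
      have "integrable tor (\<lambda>x. \<Sum>i\<in>UNIV. W i t x *\<^sub>R (axis i 1 :: real ^ 'd))"
        by (intro Bochner_Integration.integrable_sum integrable_scaleR_left Wi)
      moreover have "(\<Sum>i\<in>UNIV. W i t x *\<^sub>R (axis i 1 :: real ^ 'd)) = v t x" for x
        by (simp add: v_def vec_eq_iff axis_def if_distrib cong: if_cong)
      ultimately show ?thesis by simp
    qed
    have vm [measurable]: "v t \<in> borel_measurable borel" using borel_measurable_integrable[OF vi] by simp
    show ?case
    proof
      show "integrable tor (F t)"
        using elim(1) by (intro Lp_norm_imp_integrable[OF assms(6) _ \<theta>e Fm]) (auto simp: besov_def)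
      show "integrable tor (v t)" by (rule vi)
      show "(\<integral>x. F t x \<partial>tor) = 0"
        using elim(1) integral_torus[OF \<theta>e Fm] by (simp add: besov_def)
      show "(\<integral>x. v t x $ i \<partial>tor) = 0" for i
        using elim(2) integral_torus[OF We Wm, of i] by (simp add: besov_def v_def)
      show "Lb p tor (A t * norm w powr \<alpha>) (\<lambda>x. F t (x + w) - F t x)" if "w \<in> torus_cell" "w \<noteq> 0" for w
        by (rule besov_increment_Lb[OF assms(6) _ _ _ that \<theta>e Fm]) (use elim(1) in \<open>auto simp: besov_def A_def\<close>)
      show "Lb q tor (U t i * norm w powr \<beta>) (\<lambda>x. v t (x + w) $ i - v t x $ i)" if "w \<in> torus_cell" "w \<noteq> 0" for w i
        unfolding v_def vec_lambda_beta
        by (rule besov_increment_Lb[OF assms(7) _ _ _ that We Wm]) (use elim(2) in \<open>auto simp: besov_def U_def\<close>)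
      fix \<psi> :: "real ^ 'd \<Rightarrow> real"
      assume \<psi>: "smooth \<psi>" "periodic \<psi>"
      have [measurable]: "grad \<psi> \<in> borel_measurable borel" by (rule grad_measurable[OF \<psi>(1)])
      have "(LINT x|torus. u t x \<bullet> grad \<psi> x) = (\<integral>x. v t x \<bullet> grad \<psi> x \<partial>tor)"
        by (rule integral_torus) (use ue in \<open>auto elim!: eventually_mono\<close>)
      then show "(\<integral>x. v t x \<bullet> grad \<psi> x \<partial>tor) = 0" using elim(3) \<psi> by simp
    qed (use assms pq F_per v_per in \<open>auto simp: A_def U_def\<close>)
  qed
  note G_sum = G_def
  have G_eq: "besov_data.G (A t) (U t) = G t" if "besov_data (F t) (v t) \<alpha> \<beta> p q (A t) (U t)" for t
  proof -
    interpret besov_data "F t" "v t" \<alpha> \<beta> p q "A t" "U t" by (rule that)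
    show ?thesis unfolding G_sum G_def C_def D_def R_def ..
  qed
  \<comment> \<open>The passage between the Lebesgue and the Borel formulation, for an arbitrary
    Borel function \<open>k\<close> of the solution: the identity carries the hypothesis into
    \<open>transport\<close>, and the power of the absolute value carries the conclusion
    back.\<close>
  have transfer: "(LINT (t, x)|lebesgue_on ({0<..<T} \<times> torus_cell). (deriv (\<lambda>s. \<phi> s x) t + u t x \<bullet> grad (\<phi> t) x) * k (\<theta> t x)) =
      (\<integral>(t, x). (deriv (\<lambda>s. \<phi> s x) t + v t x \<bullet> grad (\<phi> t) x) * k (F t x) \<partial>(tim T \<Otimes>\<^sub>M tor))"
    if test: "test_fun T \<phi>" and k [measurable]: "k \<in> borel_measurable borel" for \<phi> and k :: "real \<Rightarrow> real"
  proof -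
    interpret test_function T \<phi> by standard (rule test)
    have "(\<lambda>(t, x). (\<phi>\<^sub>t t x + v t x \<bullet> grad (\<phi> t) x) * k (F t x)) \<in> borel_measurable (borel \<Otimes>\<^sub>M borel)" by measurable
    then have m: "(\<lambda>(t, x). (deriv (\<lambda>s. \<phi> s x) t + v t x \<bullet> grad (\<phi> t) x) * k (F t x)) \<in> borel_measurable borel"
      unfolding \<phi>\<^sub>t_def by (simp add: borel_prod)
    show ?thesis unfolding tim_tor_density
    proof (rule integral_lebesgue_on[OF _ m])
      show "{0<..<T} \<times> torus_cell \<in> sets (borel :: (real \<times> (real ^ 'd)) measure)"
        by (intro borel_Times) auto
      show "AE z in lborel. z \<in> {0<..<T} \<times> torus_cell \<longrightarrow>
        (case z of (t, x) \<Rightarrow> (deriv (\<lambda>s. \<phi> s x) t + u t x \<bullet> grad (\<phi> t) x) * k (\<theta> t x)) =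
        (case z of (t, x) \<Rightarrow> (deriv (\<lambda>s. \<phi> s x) t + v t x \<bullet> grad (\<phi> t) x) * k (F t x))"
        using F_eq v_eq by eventually_elim auto
    qed
  qed
  interpret transport T \<alpha> \<beta> F v G
  proof
    show "AE t in tim T. slice (F t) (v t) \<alpha> \<beta> (G t)"
      using data by eventually_elim (use besov_data.slice G_eq in fastforce)
    have "AE t in tim T. (\<integral>\<^sup>+x. ennreal (norm (F t x)) \<partial>tor) \<le> ennreal (G t)"
      using data by eventually_elim (use besov_data.f_norm_bound G_eq in fastforce)
    then show "integrable (tim T \<Otimes>\<^sub>M tor) (\<lambda>(t, x). F t x)" by (intro integrable_pair_of_slices[OF F G_int])
    have "AE t in tim T. (\<integral>\<^sup>+x. ennreal (norm (v t x)) \<partial>tor) \<le> ennreal (G t)"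
      using data by eventually_elim (use besov_data.v_norm_bound G_eq in fastforce)
    then show "integrable (tim T \<Otimes>\<^sub>M tor) (\<lambda>(t, x). v t x)" by (intro integrable_pair_of_slices[OF v_meas G_int])
    have "AE t in tim T. (\<integral>\<^sup>+x. ennreal (norm (F t x *\<^sub>R v t x)) \<partial>tor) \<le> ennreal (G t)"
      using data by eventually_elim (use besov_data.fv_norm_bound G_eq in fastforce)
    then show "integrable (tim T \<Otimes>\<^sub>M tor) (\<lambda>(t, x). F t x *\<^sub>R v t x)"
      by (intro integrable_pair_of_slices[OF _ G_int]) measurable
    show "(\<integral>(t, x). (deriv (\<lambda>s. \<phi> s x) t + v t x \<bullet> grad (\<phi> t) x) * F t x \<partial>(tim T \<Otimes>\<^sub>M tor)) = 0" if "test_fun T \<phi>" for \<phi>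
      using transfer[OF that, of "\<lambda>y. y"] assms(11) that unfolding weak_transport_solution_def by simp
  qed (use assms G_int in auto)
  have "weak_transport_solution T u (\<lambda>t x. \<bar>\<theta> t x\<bar> powr r)" for r
    unfolding weak_transport_solution_def
  proof (intro allI impI)
    fix \<phi> :: "real \<Rightarrow> real ^ 'd \<Rightarrow> real" assume \<phi>: "test_fun T \<phi>"
    show "(LINT (t, x)|lebesgue_on ({0<..<T} \<times> torus_cell). (deriv (\<lambda>s. \<phi> s x) t + u t x \<bullet> grad (\<phi> t) x) * \<bar>\<theta> t x\<bar> powr r) = 0"
      using transfer[OF \<phi>, of "\<lambda>y. \<bar>y\<bar> powr r"] integral_comp_eq_0[OF \<phi>, of "\<lambda>y. \<bar>y\<bar> powr r"] by simp
  qed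
  then show ?thesis by blast
qed

end
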